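(* Let $w$ be a weight satisfying Assumption (A) (both parts (i) and (ii)), let $X$ be a vertex reinforced random walk (VRRW) on $\mathbb{Z}$ with weight $w$ started at $X_0=0$, and let $R$ be the random set of sites visited infinitely often by $X$, with cardinality $|R|$. (i) If $i_-(w)=2$ then $|R|>4$ almost surely. (ii) If $i_-(w)=3$ then $|R|>5$ almost surely.
   Context: VRRW: given a weight sequence $(w(n))_{n\ge 0}$ in $(0,\infty)$, the VRRW $X=(X_n)_{n\ge0}$ is the nearest-neighbour process on $\mathbb{Z}$ with $X_0=0$ and $$\mathbb{P}\{X_{n+1}=X_n-1\mid X_0,\dots,X_n\}=1-\mathbb{P}\{X_{n+1}=X_n+1\mid X_0,\dots,X_n\}=\frac{w(Z_n(X_n-1))}{w(Z_n(X_n-1))+w(Z_n(X_n+1))},$$ where $Z_n(x)$ is the number of visits of $X$ to $x$ up to time $n$. Assumption (A) on the weight sequence: (i) $w$ is positive, non-decreasing, sub-linear and regularly varying with index $1$ at infinity, so that (for $n\ge1$) $w(n)=n/\ell(n)$ with $\lim_{n\to\infty}\ell(cn)/\ell(n)=1$ for all $c>0$ and $\lim_{n\to\infty}\ell(n)=\infty$; (ii) the sequence $\ell(n)$ is eventually non-decreasing. The sequence $w$ is extended to a continuous non-decreasing function $w:[0,\infty)\to(0,\infty)$ (weight function) by linear interpolation. Indexes: $W(x):=\int_0^x\frac{du}{w(u)}$, an increasing homeomorphism of $[0,\infty)$ with inverse $W^{-1}$. For measurable $f\ge0$ on $[0,\infty)$, $G(f)(x):=\int_0^x\frac{w(W^{-1}(f(u)))}{w(W^{-1}(u))}\,du$,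 and $G^{(n)}$ is the $n$-fold iterate of $G$. For $\eta\in(0,1)$, $i_\eta(w):=\inf\{n\ge2: G^{(n-1)}(\eta\,\mathrm{Id})\text{ is bounded}\}$, with $\mathrm{Id}$ the identity function and $\inf\emptyset=+\infty$. The map $\eta\mapsto i_\eta(w)$ is non-decreasing, and $i_-(w):=\lim_{\eta\to(1/2)^-}i_\eta(w)$ (left limit). *)

theory Defs
  imports "HOL-Probability.Probability"
begin

section \<open>Weights\<close>

definition weight_fun :: "(nat \<Rightarrow> real) \<Rightarrow> real \<Rightarrow> real" where
  "weight_fun w x =
     (let n = nat \<lfloor>x\<rfloor> in w n + (x - real n) * (w (Suc n) - w n))"

text \<open>On natural numbers \<open>n \<ge> 1\<close> this is the \<open>\<ell>\<close> with \<open>w n = n / \<ell> n\<close>; it is taken through the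
  interpolated weight function so that \<open>\<ell> (c * n)\<close> makes sense for real \<open>c\<close>.\<close>

definition ell :: "(nat \<Rightarrow> real) \<Rightarrow> real \<Rightarrow> real" where
  "ell w x = x / weight_fun w x"

definition regularly_varying :: "(real \<Rightarrow> real) \<Rightarrow> real \<Rightarrow> bool" where
  "regularly_varying f \<rho> \<longleftrightarrow>
     (\<forall>c>0. ((\<lambda>x. f (c * x) / f x) \<longlongrightarrow> c powr \<rho>) at_top)"

definition assumption_Ai :: "(nat \<Rightarrow> real) \<Rightarrow> bool" where
  "assumption_Ai w \<longleftrightarrow>
     (\<forall>n. 0 < w n) \<and> mono w \<and> (\<lambda>n. w n / real n) \<longlonglongrightarrow> 0 \<and>
     regularly_varying (weight_fun w) 1"

definition assumption_Aii :: "(nat \<Rightarrow> real) \<Rightarrow> bool" where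
  "assumption_Aii w \<longleftrightarrow> (\<exists>N. mono_on {N..} (\<lambda>n::nat. ell w (real n)))"

definition assumption_A :: "(nat \<Rightarrow> real) \<Rightarrow> bool" where
  "assumption_A w \<longleftrightarrow> assumption_Ai w \<and> assumption_Aii w"


lemma weight_fun_of_nat [simp]: "weight_fun w (real n) = w n"
  by (simp add: weight_fun_def)

lemma weight_fun_between:
  assumes "mono w" "0 \<le> x"
  shows "w (nat \<lfloor>x\<rfloor>) \<le> weight_fun w x" "weight_fun w x \<le> w (Suc (nat \<lfloor>x\<rfloor>))"
proof -
  let ?n = "nat \<lfloor>x\<rfloor>"
  have d: "0 \<le> w (Suc ?n) - w ?n"
    using assms(1) by (simp add: mono_def)
  have t: "0 \<le> x - real ?n" "x - real ?n \<le> 1"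
    using assms(2) by linarith+
  show "w ?n \<le> weight_fun w x"
    using mult_nonneg_nonneg[OF t(1) d] by (simp add: weight_fun_def Let_def)
  show "weight_fun w x \<le> w (Suc ?n)"
    using mult_right_mono[OF t(2) d] by (simp add: weight_fun_def Let_def)
qed

lemma weight_fun_pos:
  assumes "\<forall>n. 0 < w n" "mono w" "0 \<le> x"
  shows "0 < weight_fun w x"
  using weight_fun_between(1)[OF assms(2,3)] assms(1) by (meson less_le_trans)

lemma weight_fun_mono:
  assumes "mono w" "0 \<le> x" "x \<le> y"
  shows "weight_fun w x \<le> weight_fun w y"
proof (cases "nat \<lfloor>x\<rfloor> = nat \<lfloor>y\<rfloor>")
  case True
  have "0 \<le> w (Suc (nat \<lfloor>y\<rfloor>)) - w (nat \<lfloor>y\<rfloor>)"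
    using assms(1) by (simp add: mono_def)
  then show ?thesis
    using True assms(3) by (auto simp: weight_fun_def Let_def intro!: mult_right_mono)
next
  case False
  moreover have "nat \<lfloor>x\<rfloor> \<le> nat \<lfloor>y\<rfloor>"
    using assms(3) by (intro nat_mono floor_mono)
  ultimately have "Suc (nat \<lfloor>x\<rfloor>) \<le> nat \<lfloor>y\<rfloor>" by simp
  then have "w (Suc (nat \<lfloor>x\<rfloor>)) \<le> w (nat \<lfloor>y\<rfloor>)"
    using assms(1) by (simp add: mono_def)
  then show ?thesis
    using weight_fun_between(2)[of w x] weight_fun_between(1)[of w y] assms by linarith
qed

lemma ell_ratio:
  assumes "\<forall>n. 0 < w n" "mono w" "0 < c" "0 < x"
  shows "ell w (c * x) / ell w x = c / (weight_fun w (c * x) / weight_fun w x)"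
proof -
  have "0 < weight_fun w (c * x)" "0 < weight_fun w x"
    using assms by (auto intro!: weight_fun_pos)
  then show ?thesis using assms by (simp add: ell_def field_simps)
qed

lemma weight_fun_ratio:
  assumes "\<forall>n. 0 < w n" "mono w" "0 < c" "0 < x"
  shows "weight_fun w (c * x) / weight_fun w x = c / (ell w (c * x) / ell w x)"
proof -
  have "0 < weight_fun w (c * x)" "0 < weight_fun w x"
    using assms by (auto intro!: weight_fun_pos)
  then show ?thesis using assms by (simp add: ell_def field_simps)
qed

lemma regularly_varying_iff_ell:
  assumes pos: "\<forall>n. 0 < w n" and mono: "mono w"
  shows "regularly_varying (weight_fun w) 1 \<longleftrightarrow>
    (\<forall>c>0. (\<lambda>n. ell w (c * real n) / ell w (real n)) \<longlonglongrightarrow> 1)"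
proof
  assume rv: "regularly_varying (weight_fun w) 1"
  show "\<forall>c>0. (\<lambda>n. ell w (c * real n) / ell w (real n)) \<longlonglongrightarrow> 1"
  proof (intro allI impI)
    fix c :: real assume c: "0 < c"
    have "((\<lambda>x. weight_fun w (c * x) / weight_fun w x) \<longlongrightarrow> c) at_top"
      using rv c by (auto simp: regularly_varying_def)
    then have "(\<lambda>n. weight_fun w (c * real n) / weight_fun w (real n)) \<longlonglongrightarrow> c"
      by (rule filterlim_compose[OF _ filterlim_real_sequentially])
    then have "(\<lambda>n. c / (weight_fun w (c * real n) / weight_fun w (real n))) \<longlonglongrightarrow> c / c"
      using c by (intro tendsto_intros) auto
    then have "(\<lambda>n. c / (weight_fun w (c * real n) / weight_fun w (real n))) \<longlonglongrightarrow> 1"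
      using c by simp
    then show "(\<lambda>n. ell w (c * real n) / ell w (real n)) \<longlonglongrightarrow> 1"
      by (rule Lim_transform_eventually)
         (use eventually_gt_at_top[of "0::nat"] in eventually_elim,
           simp only: ell_ratio[OF pos mono c] of_nat_0_less_iff)
  qed
next
  assume L: "\<forall>c>0. (\<lambda>n. ell w (c * real n) / ell w (real n)) \<longlonglongrightarrow> 1"
  have wlim: "(\<lambda>n. weight_fun w (c * real n) / w n) \<longlonglongrightarrow> c" if c: "0 < c" for c
  proof -
    have "(\<lambda>n. c / (ell w (c * real n) / ell w (real n))) \<longlonglongrightarrow> c / 1"
      using c L by (intro tendsto_intros) auto
    then have "(\<lambda>n. c / (ell w (c * real n) / ell w (real n))) \<longlonglongrightarrow> c" by simp
    moreover have "eventually (\<lambda>n. c / (ell w (c * real n) / ell w (real n)) =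
        weight_fun w (c * real n) / w n) sequentially"
      using eventually_gt_at_top[of "0::nat"]
    proof eventually_elim
      case (elim n)
      then have "0 < real n" by simp
      from weight_fun_ratio[OF pos mono c this] show ?case by (simp only: weight_fun_of_nat)
    qed
    ultimately show ?thesis by (rule Lim_transform_eventually)
  qed
  show "regularly_varying (weight_fun w) 1"
    unfolding regularly_varying_def
  proof (intro allI impI)
    fix c :: real assume c: "0 < c"
    have "((\<lambda>x. weight_fun w (c * x) / weight_fun w x) \<longlongrightarrow> c) at_top"
    proof (rule order_tendstoI)
      fix a assume a: "a < c"
      define b where "b = (if a \<le> 0 then c / 2 else (a + c) / 2)"
      have b: "0 < b" "b < c" "a < b" using a c by (auto simp: b_def)
      let ?N = "\<lambda>x::real. Suc (nat \<lfloor>x\<rfloor>)"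
      have N: "filterlim ?N sequentially at_top"
        by (rule filterlim_compose[OF filterlim_Suc]) 
           (rule filterlim_compose[OF filterlim_nat_sequentially filterlim_floor_sequentially])
      have "eventually (\<lambda>n. a < weight_fun w (b * real n) / w n) sequentially"
        using wlim[OF b(1)] b(3) by (rule order_tendstoD)
      then have e1: "eventually (\<lambda>x. a < weight_fun w (b * real (?N x)) / w (?N x)) at_top"
        using N by (rule eventually_compose_filterlim)
      show "eventually (\<lambda>x. a < weight_fun w (c * x) / weight_fun w x) at_top"
        using e1 eventually_ge_at_top[of "max 1 (b / (c - b))"]
      proof eventually_elim
        case (elim x)
        have x: "1 \<le> x" "b / (c - b) \<le> x" using elim by auto
        have Nx: "real (?N x) \<le> x + 1" "0 \<le> x" using x by linarith+
        have "b * (x + 1) \<le> c * x" using x(2) b by (simp add: field_simps)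
        then have "b * real (?N x) \<le> c * x"
          using mult_left_mono[OF Nx(1), of b] b(1) by linarith
        then have 1: "weight_fun w (b * real (?N x)) \<le> weight_fun w (c * x)"
          using b(1) by (intro weight_fun_mono[OF mono]) auto
        have 2: "weight_fun w x \<le> w (?N x)" "0 < weight_fun w x"
          using weight_fun_between(2)[OF mono Nx(2)] weight_fun_pos[OF pos mono Nx(2)] by auto
        have "weight_fun w (b * real (?N x)) / w (?N x) \<le> weight_fun w (c * x) / weight_fun w x"
          using 1 2 b(1) weight_fun_pos[OF pos mono, of "c * x"] c Nx(2)
          by (intro frac_le) auto
        then show ?case using elim(1) by linarith
      qed
    next
      fix a assume a: "c < a"
      define b where "b = (a + c) / 2"
      have b: "0 < b" "c < b" "b < a" using a c by (auto simp: b_def)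
      let ?N = "\<lambda>x::real. nat \<lfloor>x\<rfloor>"
      have N: "filterlim ?N sequentially at_top"
        by (rule filterlim_compose[OF filterlim_nat_sequentially filterlim_floor_sequentially])
      have "eventually (\<lambda>n. weight_fun w (b * real n) / w n < a) sequentially"
        using wlim[OF b(1)] b(3) by (rule order_tendstoD)
      then have e1: "eventually (\<lambda>x. weight_fun w (b * real (?N x)) / w (?N x) < a) at_top"
        using N by (rule eventually_compose_filterlim)
      show "eventually (\<lambda>x. weight_fun w (c * x) / weight_fun w x < a) at_top"
        using e1 eventually_ge_at_top[of "max 1 (b / (b - c))"]
      proof eventually_elim
        case (elim x)
        have x: "1 \<le> x" "b / (b - c) \<le> x" using elim by auto
        have Nx: "x - 1 \<le> real (?N x)" "0 \<le> x" using x by linarith+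
        have "c * x \<le> b * (x - 1)" using x(2) b by (simp add: field_simps)
        then have "c * x \<le> b * real (?N x)"
          using mult_left_mono[OF Nx(1), of b] b(1) by linarith
        then have 1: "weight_fun w (c * x) \<le> weight_fun w (b * real (?N x))"
          using c Nx(2) by (intro weight_fun_mono[OF mono]) auto
        have 2: "w (?N x) \<le> weight_fun w x" "0 < w (?N x)"
          using weight_fun_between(1)[OF mono Nx(2)] pos by auto
        have "weight_fun w (c * x) / weight_fun w x \<le> weight_fun w (b * real (?N x)) / w (?N x)"
          using 1 2 b(1) weight_fun_pos[OF pos mono, of "b * real (?N x)"]
          by (intro frac_le) auto
        then show ?case using elim(1) by linarith
      qed
    qed
    then show "((\<lambda>x. weight_fun w (c * x) / weight_fun w x) \<longlongrightarrow> c powr 1) at_top"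
      using c by simp
  qed
qed

lemma sublinear_iff_ell:
  assumes "\<forall>n. 0 < w n"
  shows "(\<lambda>n. w n / real n) \<longlonglongrightarrow> 0 \<longleftrightarrow> filterlim (\<lambda>n. ell w (real n)) at_top sequentially"
proof -
  have *: "inverse (w n / real n) = ell w (real n)" for n
    by (simp add: ell_def)
  have "eventually (\<lambda>n. 0 < w n / real n) sequentially"
    using eventually_gt_at_top[of "0::nat"] by eventually_elim (simp add: assms)
  then have "filterlim (\<lambda>n. inverse (w n / real n)) at_top sequentially \<longleftrightarrow>
      (\<lambda>n. w n / real n) \<longlonglongrightarrow> 0"
    by (rule filterlim_inverse_at_top_iff)
  then show ?thesis by (simp only: *)
qed

lemma assumption_Ai_iff:
  "assumption_Ai w \<longleftrightarrow>
     (\<forall>n. 0 < w n) \<and> mono w \<and>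
     (\<forall>c>0. (\<lambda>n. ell w (c * real n) / ell w (real n)) \<longlonglongrightarrow> 1) \<and>
     filterlim (\<lambda>n. ell w (real n)) at_top sequentially"
  using regularly_varying_iff_ell sublinear_iff_ell
  by (auto simp: assumption_Ai_def)


section \<open>The indexes\<close>

definition W :: "(nat \<Rightarrow> real) \<Rightarrow> real \<Rightarrow> real" where
  "W w x = (LINT u:{0..x}|lborel. 1 / weight_fun w u)"

definition W_inv :: "(nat \<Rightarrow> real) \<Rightarrow> real \<Rightarrow> real" where
  "W_inv w = the_inv_into {0..} (W w)"

definition G :: "(nat \<Rightarrow> real) \<Rightarrow> (real \<Rightarrow> real) \<Rightarrow> real \<Rightarrow> real" where
  "G w f x =
     (LINT u:{0..x}|lborel. weight_fun w (W_inv w (f u)) / weight_fun w (W_inv w u))"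

text \<open>The infimum over the empty set is \<open>\<infinity>\<close> in \<^typ>\<open>enat\<close>.\<close>

definition i_index :: "(nat \<Rightarrow> real) \<Rightarrow> real \<Rightarrow> enat" where
  "i_index w \<eta> =
     Inf (enat ` {n. 2 \<le> n \<and> bounded (((G w ^^ (n - 1)) (\<lambda>x. \<eta> * x)) ` {0..})})"

text \<open>A left limit in the order topology of \<^typ>\<open>enat\<close>; it exists because \<open>\<eta> \<mapsto> i_index w \<eta>\<close> is
  non-decreasing on \<open>(0, 1)\<close> for the weights considered.\<close>

definition i_minus :: "(nat \<Rightarrow> real) \<Rightarrow> enat" where
  "i_minus w = Lim (at_left (1/2)) (i_index w)"


section \<open>The vertex reinforced random walk\<close>

definition visits :: "(nat \<Rightarrow> int) \<Rightarrow> nat \<Rightarrow> int \<Rightarrow> nat" where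
  "visits x n y = card {k. k \<le> n \<and> x k = y}"

definition left_prob :: "(nat \<Rightarrow> real) \<Rightarrow> (nat \<Rightarrow> int) \<Rightarrow> nat \<Rightarrow> real" where
  "left_prob w x n =
     w (visits x n (x n - 1)) / (w (visits x n (x n - 1)) + w (visits x n (x n + 1)))"

text \<open>As the walk takes countably many values, conditioning on \<open>X\<^sub>0, \<dots>, X\<^sub>n\<close> is elementary
  conditioning on each history \<open>x\<^sub>0, \<dots>, x\<^sub>n\<close> of positive probability.\<close>

locale vrrw = prob_space M for M :: "'a measure" +
  fixes w :: "nat \<Rightarrow> real" and X :: "nat \<Rightarrow> 'a \<Rightarrow> int"
  assumes weight_pos: "\<And>n. 0 < w n"
    and X_measurable: "\<And>n. X n \<in> measurable M (count_space UNIV)"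
    and X_0: "AE \<omega> in M. X 0 \<omega> = 0"
    and step_left: "\<And>n x. \<P>(\<omega> in M. \<forall>i\<le>n. X i \<omega> = x i) > 0 \<Longrightarrow>
          \<P>(\<omega> in M. X (Suc n) \<omega> = X n \<omega> - 1 \<bar> \<forall>i\<le>n. X i \<omega> = x i) = left_prob w x n"
    and step_right: "\<And>n x. \<P>(\<omega> in M. \<forall>i\<le>n. X i \<omega> = x i) > 0 \<Longrightarrow>
          \<P>(\<omega> in M. X (Suc n) \<omega> = X n \<omega> + 1 \<bar> \<forall>i\<le>n. X i \<omega> = x i) = 1 - left_prob w x n"

definition recurrent_sites :: "(nat \<Rightarrow> 'a \<Rightarrow> int) \<Rightarrow> 'a \<Rightarrow> int set" where
  "recurrent_sites X \<omega> = {y. infinite {n. X n \<omega> = y}}"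

text \<open>The set of sites visited infinitely often may be infinite, where \<^const>\<open>card\<close> is \<open>0\<close>.\<close>

definition ecard :: "'a set \<Rightarrow> enat" where
  "ecard A = (if finite A then enat (card A) else \<infinity>)"

end

theory Submission
  imports Defs "HOL-Real_Asymp.Real_Asymp"
begin

text \<open>Write \<open>V n\<close> for the sum of \<open>1 / w j\<close> over \<open>j < n\<close>, and \<open>Z y\<close> for the number of visits to the
site \<open>y\<close> so far. Let each step from \<open>y\<close> to a neighbour \<open>z\<close> add \<open>1 / w (Z z)\<close> to the flow from \<open>y\<close> to
\<open>z\<close>. The step is chosen with probability proportional to \<open>w (Z z)\<close>, so the flow from \<open>y\<close> to \<open>y + 1\<close>
minus the flow from \<open>y\<close> to \<open>y - 1\<close> is a martingale. Its quadratic variation is at most twice the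
sum of \<open>1 / (w j)\<^sup>2\<close>, which is finite for a weight of index 1; hence almost surely all these net
flows stay bounded (\<open>AE_net_flow_bounded\<close>). On the other hand \<open>V (Z z)\<close> is the sum of the two flows
into \<open>z\<close> (\<open>V_visits_eq\<close>). These two facts tie the numbers \<open>V (Z y)\<close> of neighbouring sites together
by linear relations with bounded errors. As \<open>w n = o(n)\<close>, a bounded error in \<open>V\<close> changes the
number of visits by at most a bounded factor (\<open>V_close_imp\<close>).

Suppose the recurrent sites are \<open>{a..b}\<close>. The flows leaving \<open>{a..b}\<close> are bounded, hence so are the
inward flows at \<open>a\<close> and at \<open>b\<close>. If \<open>b \<le> a + 2\<close>, some recurrent site only receives bounded flow,
which is absurd (\<open>at_least_four_sites\<close>). If \<open>b = a + 3\<close>, the four numbers of visits are comparable,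
and the inward flow at the ends is at least a multiple of the divergent series of \<open>1 / w (4 * j)\<close>
(\<open>not_four_sites\<close>). If \<open>b = a + 4\<close> and \<open>c\<close> is the middle site, then \<open>V (Z c)\<close> is
\<open>V (Z a) + V (Z b)\<close> up to a bounded error, and the inward flow at the ends dominates the
series of \<open>1 / w (W\<inverse> (W j / \<eta>))\<close> for each \<open>\<eta> < 1/2\<close>. That series diverges exactly
when \<open>G (\<eta> Id)\<close> is unbounded, which is what \<open>i_minus w = 3\<close> gives (\<open>not_five_sites\<close>).

It remains to see that the walk has bounded range: then its recurrent sites form a nonempty finite
interval. Consider the first arrival at a site \<open>s\<close>. Whatever happened to the left, with a
probability bounded below the walk never reaches \<open>s + 7\<close> (\<open>hist_prob_reached_next\<close>); iterating,
the probability of reaching \<open>7 * j + 1\<close> decays geometrically in \<open>j\<close>. For this, ask that the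
walk steps left at its first \<open>m\<close> visits to each of \<open>s + 2\<close>, ..., \<open>s + 5\<close> and at its first \<open>B\<close> visits
to \<open>s + 6\<close>; each of these finitely many choices has probability at least one half. Given this, the
later net flows at \<open>s + 1\<close>, ..., \<open>s + 5\<close> all stay below a constant \<open>C\<close> with probability at least one
half, and it turns out that then \<open>Z (s + 6) \<le> B\<close> for ever, so that \<open>s + 7\<close> is never reached
(\<open>confinement_bound\<close>). The reason is that for \<open>m\<close> large each of the sites \<open>s + 3\<close>, ..., \<open>s + 6\<close>
is visited much less than its left neighbour (\<open>decay_all\<close>): the numbers \<open>W (Z (s + 3))\<close>,
\<open>W (Z (s + 4))\<close>, \<open>W (Z (s + 5))\<close>, \<open>W (Z (s + 6))\<close> are dominated by \<open>u\<close>, \<open>u / 16\<close>, \<open>G (Id / 16) u\<close>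
and \<open>G (G (Id / 16)) u\<close> up to constants, where \<open>u = W (Z (s + 3))\<close>, and for \<open>i_minus w \<le> 3\<close> one of
the last two is bounded. The delicate point is to
start this chain at \<open>s + 3\<close>, since \<open>s + 1\<close> and \<open>s + 2\<close> compete with a site \<open>s\<close> that the rest of
the walk may visit at will: one needs that the flow from \<open>s + 3\<close> back to \<open>s + 2\<close> is small
compared with \<open>\<ell> (Z (s + 2))\<close>, and this is where \<open>\<ell>\<close> being eventually monotone enters
(\<open>V_gap_imp_w_gap\<close>, \<open>flow_ell_le\<close>).\<close>

section \<open>Weights and their reciprocal sums\<close>

text \<open>The discrete counterpart of \<open>W\<close>: each visit to a site raises \<open>V\<close> of its number of visits by the
reciprocal of the weight that the site had before, which makes \<open>V_visits_eq\<close> below an exact identity.\<close>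

definition V :: "(nat \<Rightarrow> real) \<Rightarrow> nat \<Rightarrow> real" where
  "V w n = (\<Sum>j<n. 1 / w j)"

lemma V_0 [simp]: "V w 0 = 0" by (simp add: V_def)
lemma V_Suc: "V w (Suc n) = V w n + 1 / w n" by (simp add: V_def)

locale weight_A =
  fixes w :: "nat \<Rightarrow> real"
  assumes A: "assumption_A w"
begin

lemma w_pos [simp]: "0 < w n" and mono: "mono w"
  using A by (auto simp: assumption_A_def assumption_Ai_def)

lemma w_nonzero [simp]: "w n \<noteq> 0" and nonneg [simp]: "0 \<le> w n"
  using w_pos[of n] by linarith+

lemma w_le: "m \<le> n \<Longrightarrow> w m \<le> w n"
  using mono by (simp add: mono_def)

lemma recip_le: "m \<le> n \<Longrightarrow> 1 / w n \<le> 1 / w m"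
  by (simp add: frac_le w_le)

lemma weight_ratio_tendsto: "0 < c \<Longrightarrow> (\<lambda>n. weight_fun w (c * real n) / w n) \<longlonglongrightarrow> c"
proof -
  assume c: "0 < c"
  have "((\<lambda>x. weight_fun w (c * x) / weight_fun w x) \<longlongrightarrow> c) at_top"
    using A c by (auto simp: assumption_A_def assumption_Ai_def regularly_varying_def)
  then have "(\<lambda>n. weight_fun w (c * real n) / weight_fun w (real n)) \<longlonglongrightarrow> c"
    by (rule filterlim_compose[OF _ filterlim_real_sequentially])
  then show ?thesis by simp
qed

text \<open>Regular variation, passed from real multiples of \<open>n\<close> to all integers beyond them by monotonicity.\<close>

lemma eventually_w_ge:
  assumes "0 < c" "a < c"
  shows "\<forall>\<^sub>F n in sequentially. \<forall>z. c * real n \<le> real z \<longrightarrow> a * w n \<le> w z"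
  using order_tendstoD(1)[OF weight_ratio_tendsto[OF assms(1)] assms(2)]
proof eventually_elim
  case (elim n)
  show ?case
  proof (intro allI impI)
    fix z assume z: "c * real n \<le> real z"
    have "weight_fun w (c * real n) \<le> w z"
      using weight_fun_mono[OF mono _ z] assms(1) by simp
    moreover have "a * w n \<le> weight_fun w (c * real n)"
      using elim by (simp add: field_simps)
    ultimately show "a * w n \<le> w z" by simp
  qed
qed

lemma eventually_w_le:
  assumes "0 < c" "c < a"
  shows "\<forall>\<^sub>F n in sequentially. \<forall>z. real z \<le> c * real n \<longrightarrow> w z \<le> a * w n"
  using order_tendstoD(2)[OF weight_ratio_tendsto[OF assms(1)] assms(2)]
proof eventually_elim
  case (elim n)
  show ?case
  proof (intro allI impI)
    fix z assume z: "real z \<le> c * real n"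
    have "w z \<le> weight_fun w (c * real n)"
      using weight_fun_mono[OF mono _ z] by simp
    moreover have "weight_fun w (c * real n) \<le> a * w n"
      using elim by (simp add: field_simps)
    ultimately show "w z \<le> a * w n" by simp
  qed
qed

lemma ell_at_top: "filterlim (\<lambda>n. real n / w n) at_top sequentially"
  using A sublinear_iff_ell[of w] by (simp add: assumption_A_def assumption_Ai_def ell_def)

lemma ell_eventually_mono: "\<exists>N. \<forall>m n. N \<le> m \<longrightarrow> m \<le> n \<longrightarrow> real m / w m \<le> real n / w n"
proof -
  obtain N where "mono_on {N..} (\<lambda>n::nat. ell w (real n))"
    using A by (auto simp: assumption_A_def assumption_Aii_def)
  then show ?thesis by (intro exI[of _ N]) (auto simp: ell_def mono_on_def)
qed

lemma V_nonneg [simp]: "0 \<le> V w n"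
  by (simp add: V_def sum_nonneg)

lemma V_mono: "m \<le> n \<Longrightarrow> V w m \<le> V w n"
  unfolding V_def by (intro sum_mono2) auto

lemma V_strict: "m < n \<Longrightarrow> V w m < V w n"
  using V_mono[of "Suc m" n] by (simp add: V_Suc) (smt (verit) w_pos divide_pos_pos)

lemma V_pos: "0 < n \<Longrightarrow> 0 < V w n"
  using V_strict[of 0 n] by simp

lemma V_diff: "m \<le> n \<Longrightarrow> V w n - V w m = (\<Sum>j=m..<n. 1 / w j)"
  unfolding V_def by (metis sum_diff_nat_ivl lessThan_atLeast0 le0)

lemma V_diff_ge: "m \<le> n \<Longrightarrow> (real n - real m) / w n \<le> V w n - V w m"
proof -
  assume mn: "m \<le> n"
  have "(\<Sum>j=m..<n. 1 / w n) \<le> (\<Sum>j=m..<n. 1 / w j)"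
    by (intro sum_mono recip_le) auto
  then show ?thesis using mn by (simp add: V_diff of_nat_diff)
qed

lemma V_diff_le: "m \<le> n \<Longrightarrow> V w n - V w m \<le> (real n - real m) / w m"
proof -
  assume mn: "m \<le> n"
  have "(\<Sum>j=m..<n. 1 / w j) \<le> (\<Sum>j=m..<n. 1 / w m)"
    by (intro sum_mono recip_le) auto
  then show ?thesis using mn by (simp add: V_diff of_nat_diff)
qed

lemma sum_recip_le_V: "(\<Sum>j=1..n. 1 / w j) \<le> V w n"
proof (induction n)
  case (Suc n)
  then show ?case using recip_le[of n "Suc n"] by (simp add: V_Suc)
qed simp

lemma w_doubling: "\<exists>n0\<ge>1. \<forall>n\<ge>n0. 3/2 * w n \<le> w (2*n) \<and> w (2*n) \<le> 3 * w n"
proof -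
  have "\<forall>\<^sub>F n in sequentially. 3/2 * w n \<le> w (2*n) \<and> w (2*n) \<le> 3 * w n"
    using eventually_w_ge[of 2 "3/2"] eventually_w_le[of 2 3]
    by (simp, elim eventually_elim2) auto
  then obtain n0 where "\<forall>n\<ge>n0. 3/2 * w n \<le> w (2*n) \<and> w (2*n) \<le> 3 * w n"
    unfolding eventually_sequentially by blast
  then show ?thesis by (intro exI[of _ "max n0 1"]) auto
qed

text \<open>By Cauchy condensation: \<open>w (2 * n) \<ge> 3/2 * w n\<close>, and \<open>(3/2)\<^sup>2 > 2\<close>.\<close>

lemma summable_recip_square: "summable (\<lambda>n. 1 / (w n)^2)"
proof -
  obtain n0 where n0: "n0 \<ge> 1" "\<And>n. n \<ge> n0 \<Longrightarrow> 3/2 * w n \<le> w (2*n)" using w_doubling by blast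
  define f where "f n = 1 / (w n)^2" for n
  have "summable (\<lambda>n. 2 ^ n * f (2 ^ n))"
  proof (rule summable_ratio_test[of "8/9" n0])
    fix n assume n: "n0 \<le> n"
    have "n0 \<le> 2^n" using n less_exp[of n] by linarith
    from n0(2)[OF this] have "(3/2 * w (2^n))^2 \<le> (w (2 ^ Suc n))^2"
      by (intro power_mono) auto
    then have *: "9/4 * (w (2^n))^2 \<le> (w (2 ^ Suc n))^2" by (simp add: power2_eq_square)
    have "2 * (1/(w (2 ^ Suc n))^2) \<le> 2 * (1 / (9/4 * (w (2^n))^2))"
      using * by (intro mult_left_mono divide_left_mono) auto
    also have "\<dots> = 8/9 * (1 / (w (2^n))^2)" by simp
    finally have "2^n * (2 * (1/(w (2 ^ Suc n))^2)) \<le> 2^n * (8/9 * (1 / (w (2^n))^2))"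
      by (intro mult_left_mono) auto
    then show "norm (2 ^ Suc n * f (2 ^ Suc n)) \<le> 8/9 * norm (2 ^ n * f (2 ^ n))"
      by (simp add: f_def mult_ac)
  qed simp
  then have "summable f"
    by (subst condensation_test[where f=f])
       (auto simp: f_def intro!: frac_le power_mono w_le)
  then show ?thesis by (simp add: f_def[abs_def])
qed

lemma V_at_top: "filterlim (V w) at_top sequentially"
  unfolding filterlim_at_top_ge[where c=0]
proof (intro allI impI)
  fix Z :: real
  have "\<not> summable (\<lambda>n. 1 / w n)"
  proof
    assume s: "summable (\<lambda>n. 1 / w n)"
    have "\<forall>\<^sub>F n in sequentially. 1 \<le> real n / w n"
      using ell_at_top unfolding filterlim_at_top by blast
    then obtain N where N: "\<And>n. n \<ge> N \<Longrightarrow> 1 \<le> real n / w n"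
      unfolding eventually_sequentially by blast
    have "summable (\<lambda>n. inverse (real n))"
    proof (rule summable_comparison_test'[OF s, of "max N 1"])
      fix n assume "max N 1 \<le> n"
      then show "norm (inverse (real n)) \<le> 1 / w n" using N[of n] by (simp add: field_simps)
    qed
    then show False using not_summable_harmonic[where 'a=real] by (simp)
  qed
  then have "\<not> (\<forall>n. V w n \<le> Z)"
    using summableI_nonneg_bounded[of "\<lambda>n. 1 / w n" Z] by (auto simp: V_def)
  then obtain N where "Z \<le> V w N" by (auto simp: not_le intro: less_imp_le)
  then show "\<forall>\<^sub>F n in sequentially. Z \<le> V w n"
    unfolding eventually_sequentially using V_mono order_trans by blast
qed

lemma V_eventually_ge: "\<exists>m. \<forall>n\<ge>m. Z \<le> V w n"
  using V_at_top unfolding filterlim_at_top eventually_sequentially by blast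

lemma V_bounded_imp: "\<exists>B. \<forall>n. V w n \<le> Z \<longrightarrow> n \<le> B"
proof -
  obtain m where m: "\<And>n. n \<ge> m \<Longrightarrow> Z + 1 \<le> V w n" using V_eventually_ge by blast
  have "n \<le> m" if "V w n \<le> Z" for n
    using m[of n] that by linarith
  then show ?thesis by blast
qed

text \<open>On each of the \<open>p\<close> dyadic blocks below \<open>2 ^ p * n\<close> the sum \<open>V\<close> gains at least a third of
\<open>\<ell> n\<close>, while for large \<open>n\<close> the value \<open>\<ell> (2 ^ p * n)\<close> is comparable to \<open>\<ell> n\<close> with constants
that do not depend on \<open>p\<close>.\<close>

lemma ell_negligible: "\<exists>m. \<forall>n\<ge>m. K * (real n / w n) \<le> V w n"
proof -
  obtain n0 where n0: "n0 \<ge> 1" "\<And>n. n \<ge> n0 \<Longrightarrow> w (2*n) \<le> 3 * w n" using w_doubling by blast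
  obtain N where N: "\<And>m n. N \<le> m \<Longrightarrow> m \<le> n \<Longrightarrow> real m / w m \<le> real n / w n"
    using ell_eventually_mono by blast
  obtain p :: nat where p: "12 * K \<le> real p" using real_arch_simple by blast
  obtain n1 where n1: "\<And>n z. n1 \<le> n \<Longrightarrow> 2^p * real n \<le> real z \<Longrightarrow> 2^p / 2 * w n \<le> w z"
    using eventually_w_ge[of "2^p" "2^p/2"] unfolding eventually_sequentially by auto
  define n2 where "n2 = max n0 (max N n1)"
  \<comment> \<open>One dyadic block contributes a third of \<open>\<ell> n\<close>, since \<open>w\<close> at most triples on it.\<close>
  have block: "real n / w n / 3 \<le> V w (2*n) - V w n" if "n0 \<le> n" for n
  proof -
    have "real n / (3 * w n) \<le> real n / w (2*n)" using n0(2)[OF that] by (intro divide_left_mono) auto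
    then show ?thesis using V_diff_ge[of n "2*n"] by simp
  qed
  show ?thesis
  proof (intro exI[of _ "2^p * n2"] allI impI)
    fix M assume M: "2^p * n2 \<le> M"
    define n where "n = M div 2^p"
    have n: "n2 \<le> n" "2^p * n \<le> M" "M \<le> 2 * (2^p * n)" "1 \<le> n"
    proof -
      show "n2 \<le> n" using M by (simp add: n_def less_eq_div_iff_mult_less_eq mult.commute)
      then show n1: "1 \<le> n" using n0(1) by (simp add: n2_def)
      show "2^p * n \<le> M" by (simp add: n_def)
      have "M < 2^p * Suc n" unfolding n_def using dividend_less_times_div[of "2^p" M] by simp
      also have "\<dots> \<le> 2^p * (2*n)" using n1 by (intro mult_left_mono) auto
      finally show "M \<le> 2 * (2^p * n)" by simp
    qed
    have ln: "0 \<le> real n / w n" by simp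
    have "real i * (real n / w n / 3) \<le> V w (2^i * n)" for i
    proof (induction i)
      case (Suc i)
      have n': "n0 \<le> 2^i * n" "N \<le> n" "n \<le> 2^i * n"
        using n(1) mult_le_mono1[of 1 "2^i" n] by (auto simp: n2_def intro: order_trans)
      have "real n / w n \<le> real (2^i * n) / w (2^i * n)" by (rule N[OF n'(2,3)])
      then have "real n / w n / 3 \<le> V w (2 * (2^i * n)) - V w (2^i * n)"
        using block[OF n'(1)] by (meson divide_right_mono order_trans zero_le_numeral)
      then show ?case using Suc by (simp add: algebra_simps add_divide_distrib)
    qed simp
    from this[of p] have a: "real p * (real n / w n / 3) \<le> V w M"
      using V_mono[OF n(2)] by linarith
    have "2^p / 2 * w n \<le> w M"
    proof (rule n1)
      show "n1 \<le> n" using n(1) by (simp add: n2_def)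
      show "2^p * real n \<le> real M" using of_nat_mono[OF n(2), where 'a=real] by simp
    qed
    moreover have "real M \<le> 2 * (2^p * real n)" using of_nat_mono[OF n(3), where 'a=real] by simp
    ultimately have "real M / w M \<le> (2 * (2^p * real n)) / (2^p / 2 * w n)"
      by (intro frac_le) auto
    also have "\<dots> = 4 * (real n / w n)" by (simp add: field_simps)
    finally have b: "real M / w M \<le> 4 * (real n / w n)" .
    show "K * (real M / w M) \<le> V w M"
    proof (cases "K \<le> 0")
      case True
      then have "K * (real M / w M) \<le> 0" by (intro mult_nonpos_nonneg) auto
      then show ?thesis using V_nonneg[of M] by linarith
    next
      case False
      then have "K * (real M / w M) \<le> K * (4 * (real n / w n))" using b by (intro mult_left_mono) auto
      also have "\<dots> \<le> real p / 12 * (4 * (real n / w n))" using p ln by (intro mult_right_mono) auto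
      also have "\<dots> = real p * (real n / w n / 3)" by (simp add: mult_ac)
      finally show ?thesis using a by linarith
    qed
  qed
qed

lemma geometric_beats_square: "0 < \<delta> \<Longrightarrow> \<exists>k0. \<forall>k\<ge>k0. (2/3)^k * (100 * (real k + 1)^2) \<le> \<delta>"
proof -
  assume "0 < (\<delta>::real)"
  have "(\<lambda>k::nat. (2/3)^k * (100 * (real k + 1)^2)) \<longlonglongrightarrow> 0" by real_asymp
  then have "\<forall>\<^sub>F k in sequentially. (2/3)^k * (100 * (real k + 1)^2) < \<delta>"
    using \<open>0 < \<delta>\<close> by (rule order_tendstoD)
  then show ?thesis unfolding eventually_sequentially using less_imp_le by blast
qed

text \<open>Write \<open>\<ell> = b / w b\<close> and let \<open>2 ^ k\<close> be the order of magnitude of \<open>b / j\<close>. On the one hand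
\<open>w j / w b \<le> (2/3) ^ k\<close>. On the other hand \<open>V\<close> gains at most \<open>\<ell>\<close> on each dyadic block between \<open>j\<close> and
\<open>b\<close>, as \<open>n / w n\<close> is monotone; so a gap proportional to \<open>V j\<close> forces \<open>V j \<le> 9 * (k + 1) * \<ell>\<close>.
Hence \<open>(1 + V j / \<ell>)\<^sup>2\<close> is quadratic in \<open>k\<close> at most, and the exponential factor wins because \<open>k\<close> is
large: the gap is also proportional to \<open>V b\<close>, which exceeds every multiple of \<open>\<ell>\<close>. The
damping factor on the right makes the bound summable, see \<open>sum_damped_recip_le\<close>.\<close>

lemma V_gap_imp_w_gap:
  assumes "0 < \<delta>"
  shows "\<exists>m. \<forall>b\<ge>m. \<forall>j. V w j \<le> 9/10 * V w b \<longrightarrow>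
    w j / w b \<le> \<delta> * ((real b / w b) / (real b / w b + V w j))^2 \<and> 16 * j \<le> b"
proof -
  obtain n0 where n0: "n0 \<ge> 1" "\<And>n. n \<ge> n0 \<Longrightarrow> 3/2 * w n \<le> w (2*n)" using w_doubling by blast
  obtain N where N: "\<And>m n. N \<le> m \<Longrightarrow> m \<le> n \<Longrightarrow> real m / w m \<le> real n / w n"
    using ell_eventually_mono by blast
  obtain k1 where k1: "\<And>k. k1 \<le> k \<Longrightarrow> (2/3)^k * (100 * (real k + 1)^2) \<le> \<delta>"
    using geometric_beats_square[OF assms] by blast
  define k0 where "k0 = max k1 4"
  define J where "J = max n0 N"
  obtain m1 where m1: "\<And>n. m1 \<le> n \<Longrightarrow> (10 * (real k0 + 1)) * (real n / w n) \<le> V w n"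
    using ell_negligible by blast
  obtain m2 where m2: "\<And>n. m2 \<le> n \<Longrightarrow> 10/9 * V w J \<le> V w n" using V_eventually_ge by blast
  have main: "w j / w b \<le> \<delta> * ((real b / w b) / (real b / w b + V w j))^2 \<and> 16 * j \<le> b"
    if j: "J \<le> j" and b: "m1 \<le> b" and g: "V w j \<le> 9/10 * V w b" for j b
  proof -
    have j1: "1 \<le> j" "n0 \<le> j" "N \<le> j" using j n0(1) by (auto simp: J_def)
    have Vj: "0 < V w j" using j1 by (intro V_pos) auto
    have jb: "j < b"
    proof (rule ccontr)
      assume "\<not> j < b"
      then have "V w b \<le> V w j" by (intro V_mono) auto
      then show False using g Vj by linarith
    qed
    define L where "L = real b / w b"
    have L: "0 < L" using jb by (auto simp: L_def)
    have "\<exists>k. 2^k * j \<le> b \<and> b < 2^Suc k * j"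
    proof -
      have "\<exists>k. b < 2^k * j"
      proof
        have "b * 1 < 2^b * j" using j1(1) less_exp[of b] by (intro mult_less_le_imp_less) auto
        then show "b < 2^b * j" by simp
      qed
      define k' where "k' = (LEAST k. b < 2^k * j)"
      have 1: "b < 2^k' * j" unfolding k'_def using \<open>\<exists>k. b < 2^k * j\<close> by (rule LeastI_ex)
      have "k' \<noteq> 0" using 1 jb by (intro notI) simp
      then obtain k where k: "k' = Suc k" by (cases k') auto
      have "\<not> b < 2^k * j" using k not_less_Least[of k "\<lambda>k. b < 2^k * j"] by (simp add: k'_def)
      then show ?thesis using 1 k by (intro exI[of _ k]) auto
    qed
    then obtain k where k: "2^k * j \<le> b" "b < 2^Suc k * j" by blast
    have ge: "j \<le> 2^i * j" for i by simp
    have up: "(3/2)^i * w j \<le> w (2^i * j)" for i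
    proof (induction i)
      case (Suc i)
      have "3/2 * w (2^i * j) \<le> w (2 * (2^i * j))" using n0(2) j1(2) ge[of i] order_trans by blast
      then show ?case using Suc by (simp add: mult_ac)
    qed simp
    have wb: "(3/2)^k * w j \<le> w b" using up[of k] w_le[OF k(1)] by linarith
    have step: "V w (2^i * j) - V w j \<le> real i * L" if "i \<le> k" for i
      using that
    proof (induction i)
      case (Suc i)
      have "V w (2 * (2^i * j)) - V w (2^i * j) \<le> (real (2 * (2^i * j)) - real (2^i*j)) / w (2^i * j)"
        by (rule V_diff_le) auto
      also have "\<dots> = real (2^i * j) / w (2^i * j)" by (simp add: algebra_simps)
      also have "\<dots> \<le> L" unfolding L_def
      proof (rule N)
        show "N \<le> 2^i * j" using j1(3) ge[of i] by linarith
        have "2^i * j \<le> 2^k * j" using Suc.prems by (intro mult_le_mono1) (simp add: power_increasing)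
        then show "2^i * j \<le> b" using k(1) by linarith
      qed
      finally show ?case using Suc by (simp add: algebra_simps)
    qed simp
    have last: "V w b - V w (2^k * j) \<le> L"
    proof -
      have "V w b - V w (2^k * j) \<le> (real b - real (2^k*j)) / w (2^k * j)"
        by (rule V_diff_le[OF k(1)])
      also have "\<dots> \<le> real (2^k * j) / w (2^k * j)"
        using k(2) by (intro divide_right_mono) (auto simp: algebra_simps of_nat_less_iff[where 'a=real, symmetric] simp del: of_nat_less_iff)
      also have "\<dots> \<le> L" unfolding L_def using k(1) j1(3) ge[of k] by (intro N) (auto intro: order_trans)
      finally show ?thesis .
    qed
    \<comment> \<open>The gap hypothesis and this bound together give both that \<open>k\<close> is large and that \<open>V j\<close> is small.\<close>
    have tot: "V w b - V w j \<le> (real k + 1) * L"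
      using step[of k] last by (simp add: algebra_simps)
    have "(10 * (real k0 + 1)) * L \<le> V w b" using m1[OF b] by (simp add: L_def)
    then have "(real k0 + 1) * L \<le> (real k + 1) * L" using tot g by (simp add: algebra_simps)
    then have kk: "k0 \<le> k" using L by simp
    have Vk: "V w j \<le> 9 * ((real k + 1) * L)" using tot g by linarith
    have "16 * j \<le> b"
    proof -
      have "(2::nat)^4 \<le> 2^k" using kk by (intro power_increasing) (auto simp: k0_def)
      then have "16 * j \<le> 2^k * j" by (intro mult_le_mono1) simp
      then show ?thesis using k(1) by linarith
    qed
    moreover have "w j / w b \<le> \<delta> * (L / (L + V w j))^2"
    proof -
      have LV: "(L + V w j) / L \<le> 10 * (real k + 1)"
      proof -
        have "1 * L \<le> (real k + 1) * L" using L by (intro mult_right_mono) auto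
        then have "L + V w j \<le> 10 * (real k + 1) * L" using Vk by linarith
        then show ?thesis using L by (simp add: field_simps)
      qed
      have "w j / w b \<le> (2/3)^k"
        using wb by (simp add: field_simps power_divide)
      then have "w j / w b * ((L + V w j) / L)^2 \<le> (2/3)^k * (10 * (real k + 1))^2"
        using LV L Vj by (intro mult_mono power_mono) auto
      also have "\<dots> = (2/3)^k * (100 * (real k + 1)^2)" by (simp add: power2_eq_square algebra_simps)
      also have "\<dots> \<le> \<delta>" using kk by (intro k1) (auto simp: k0_def)
      finally have "w j / w b * ((L + V w j) / L)^2 \<le> \<delta>" .
      moreover have "0 < ((L + V w j) / L)^2" using L Vj by (intro zero_less_power divide_pos_pos) auto
      ultimately have "w j / w b \<le> \<delta> / ((L + V w j) / L)^2" by (simp add: pos_le_divide_eq)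
      then show ?thesis by (simp add: power_divide)
    qed
    ultimately show ?thesis by (simp add: L_def)
  qed
  \<comment> \<open>For \<open>j < J\<close> compare with \<open>J\<close>: the left-hand side grows and the damping factor shrinks with \<open>j\<close>.\<close>
  show ?thesis
  proof (intro exI[of _ "max m1 (max m2 (16 * J))"] allI impI)
    fix b j assume b: "max m1 (max m2 (16 * J)) \<le> b" and g: "V w j \<le> 9/10 * V w b"
    show "w j / w b \<le> \<delta> * ((real b / w b) / (real b / w b + V w j))^2 \<and> 16 * j \<le> b"
    proof (cases "J \<le> j")
      case True
      then show ?thesis using main b g by auto
    next
      case False
      have "V w J \<le> 9/10 * V w b" using m2[of b] b by linarith
      from main[OF order_refl _ this] b
      have m: "w J / w b \<le> \<delta> * ((real b / w b) / (real b / w b + V w J))^2" by auto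
      have "w j / w b \<le> w J / w b" using False by (intro divide_right_mono w_le) auto
      also note m
      also have "\<delta> * ((real b / w b) / (real b / w b + V w J))^2 \<le> \<delta> * ((real b / w b) / (real b / w b + V w j))^2"
      proof (cases "b = 0")
        case False
        then have "0 < real b / w b" by simp
        moreover have "V w j \<le> V w J" using \<open>\<not> J \<le> j\<close> by (intro V_mono) auto
        ultimately show ?thesis using assms V_nonneg[of j] V_nonneg[of J]
          by (intro mult_left_mono power_mono divide_left_mono mult_pos_pos
              add_pos_nonneg) (auto intro!: divide_nonneg_nonneg add_nonneg_nonneg)
      qed simp
      finally show ?thesis using b False by auto
    qed
  qed
qed

text \<open>The summand is at most the increment of \<open>L * V / (L + V)\<close>, whose derivative in \<open>V\<close> is
\<open>(L / (L + V))\<^sup>2\<close> and which is bounded by \<open>L\<close>.\<close>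

lemma sum_damped_recip_le:
  assumes "0 \<le> L"
  shows "(\<Sum>j=1..n. 1 / w j * (L / (L + V w j))^2) \<le> L"
proof (cases "L = 0")
  case False
  then have L: "0 < L" using assms by simp
  have "(\<Sum>j=1..n. 1 / w j * (L / (L + V w j))^2) \<le> L * V w n / (L + V w n)"
  proof (induction n)
    case (Suc n)
    define a b where "a = V w n" and "b = V w (Suc n)"
    have ab: "0 \<le> a" "a \<le> b" "b - a = 1 / w n" by (simp_all add: a_def b_def V_Suc)
    have "1 / w (Suc n) * (L / (L + b))^2 \<le> (b - a) * (L / (L + b))^2"
      using recip_le[of n "Suc n"] ab(3) by (intro mult_right_mono) auto
    also have "\<dots> = L^2 * (b - a) / ((L + b) * (L + b))" by (simp add: power2_eq_square)
    also have "\<dots> \<le> L^2 * (b - a) / ((L + a) * (L + b))"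
      using ab L by (intro divide_left_mono mult_right_mono mult_pos_pos) auto
    also have "\<dots> = L * b / (L + b) - L * a / (L + a)"
      using ab L by (simp add: field_simps power2_eq_square)
    finally show ?case using Suc by (simp add: a_def b_def)
  qed simp
  also have "\<dots> \<le> L"
    using L V_nonneg[of n] add_pos_nonneg[OF L V_nonneg[of n]] by (simp add: divide_le_eq algebra_simps)
  finally show ?thesis .
qed simp

text \<open>If \<open>a > 2 * b\<close>, then \<open>V a - V b\<close> is at least half of \<open>a / w a\<close>, which tends to infinity.\<close>

lemma V_close_imp: "\<exists>A. \<forall>a b. V w a \<le> V w b + C \<longrightarrow> a \<le> 2 * b + A"
proof -
  obtain A where A: "\<And>n. A \<le> n \<Longrightarrow> 2 * C + 1 \<le> real n / w n"
    using ell_at_top unfolding filterlim_at_top eventually_sequentially by blast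
  have "a \<le> 2 * b + A" if "V w a \<le> V w b + C" for a b
  proof (rule ccontr)
    assume n: "\<not> a \<le> 2 * b + A"
    have "real a / w a \<le> 2 * ((real a - real b) / w a)"
      using n by (simp add: field_simps)
    also have "\<dots> \<le> 2 * (V w a - V w b)" using V_diff_ge[of b a] n by (intro mult_left_mono) auto
    also have "\<dots> \<le> 2 * C" using that by simp
    finally show False using A[of a] n by simp
  qed
  then show ?thesis by blast
qed

lemma w_Suc_le: "\<exists>c>0. \<forall>n. w (Suc n) \<le> c * w n"
proof -
  obtain n0 where n0: "n0 \<ge> 1" "\<And>n. n \<ge> n0 \<Longrightarrow> w (2*n) \<le> 3 * w n" using w_doubling by blast
  define c where "c = max 3 (w n0 / w 0)"
  have "w (Suc n) \<le> c * w n" for n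
  proof (cases "n0 \<le> n")
    case True
    have "w (Suc n) \<le> w (2 * n)" using True n0(1) by (intro w_le) auto
    also have "\<dots> \<le> 3 * w n" by (rule n0(2)[OF True])
    also have "\<dots> \<le> c * w n" by (intro mult_right_mono) (auto simp: c_def)
    finally show ?thesis .
  next
    case False
    have "w (Suc n) \<le> w n0" using False by (intro w_le) auto
    also have "\<dots> = w n0 / w 0 * w 0" by simp
    also have "\<dots> \<le> c * w n" by (intro mult_mono w_le) (auto simp: c_def)
    finally show ?thesis .
  qed
  moreover have "0 < c" by (simp add: c_def)
  ultimately show ?thesis by blast
qed

end

section \<open>The clock W and the operator G\<close>

lemma primitive_has_derivative:
  fixes f :: "real \<Rightarrow> real"
  assumes f: "continuous_on {0..} f" and x: "0 \<le> x"
  shows "((\<lambda>x. LINT u:{0..x}|lborel. f u) has_real_derivative f x) (at x within {0..})"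
proof -
  have c: "continuous_on {0..b} f" for b using f by (rule continuous_on_subset) auto
  have eq: "(LINT u:{0..t}|lborel. f u) = integral {0..t} f" for t
    by (intro set_borel_integral_eq_integral(2) borel_integrable_atLeastAtMost' c)
  have "((\<lambda>u. integral {0..u} f) has_real_derivative f x) (at x within {0..x+1})"
    using x by (intro integral_has_real_derivative c) auto
  moreover have "at x within {0..x+1} = at x within {0..}"
    using x by (intro at_within_nhd[of x "{..<x+1}"]) auto
  ultimately show ?thesis by (simp add: eq)
qed

text \<open>A mean value inequality for the one-sided derivatives at 0 that occur on the half-line.\<close>

lemma increment_ge:
  fixes f :: "real \<Rightarrow> real"
  assumes d: "\<And>z. 0 \<le> z \<Longrightarrow> (f has_real_derivative f' z) (at z within {0..})"
    and xy: "0 \<le> x" "x \<le> y" and c: "\<And>z. x \<le> z \<Longrightarrow> z \<le> y \<Longrightarrow> c \<le> f' z"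
  shows "c * (y - x) \<le> f y - f x"
proof -
  have "\<exists>z\<in>{x..y}. f y - f x = (\<lambda>h. f' z * h) (y - x)"
    using xy(2)
  proof (rule mvt_very_simple)
    fix z assume "x \<le> z" "z \<le> y"
    then have "(f has_real_derivative f' z) (at z within {x..y})"
      using xy by (intro DERIV_subset[OF d]) auto
    then show "(f has_derivative (\<lambda>h. f' z * h)) (at z within {x..y})"
      by (simp add: has_field_derivative_def)
  qed
  then obtain z where "z \<in> {x..y}" "f y - f x = f' z * (y - x)" by blast
  then show ?thesis using xy c[of z] by (auto intro: mult_right_mono)
qed

lemma increment_le:
  fixes f :: "real \<Rightarrow> real"
  assumes d: "\<And>z. 0 \<le> z \<Longrightarrow> (f has_real_derivative f' z) (at z within {0..})"
    and xy: "0 \<le> x" "x \<le> y" and c: "\<And>z. x \<le> z \<Longrightarrow> z \<le> y \<Longrightarrow> f' z \<le> c"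
  shows "f y - f x \<le> c * (y - x)"
proof -
  have "- c * (y - x) \<le> - f y - - f x"
    using xy c by (intro increment_ge[of "\<lambda>x. - f x" "\<lambda>x. - f' x"]) (auto intro: DERIV_minus d)
  then show ?thesis by simp
qed

lemma has_derivative_imp_continuous_on:
  assumes d: "\<And>z. 0 \<le> z \<Longrightarrow> (f has_real_derivative f' z) (at z within {0..})"
  shows "continuous_on {0..} f"
  using d by (intro DERIV_continuous_on) auto

context weight_A
begin

abbreviation wf :: "real \<Rightarrow> real" where "wf \<equiv> weight_fun w"
abbreviation Wf :: "real \<Rightarrow> real" where "Wf \<equiv> W w"
abbreviation Wi :: "real \<Rightarrow> real" where "Wi \<equiv> W_inv w"

lemma wf_pos: "0 \<le> x \<Longrightarrow> 0 < wf x"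
  by (rule weight_fun_pos) (use mono in auto)

lemma wf_mono: "0 \<le> x \<Longrightarrow> x \<le> y \<Longrightarrow> wf x \<le> wf y"
  by (rule weight_fun_mono[OF mono])

lemma wf_continuous: "continuous_on {0..} wf"
proof -
  have piece: "continuous_on {real n..real (Suc n)} wf" for n
  proof -
    have "continuous_on {real n..real (Suc n)} (\<lambda>x. w n + (x - real n) * (w (Suc n) - w n))"
      by (intro continuous_intros)
    moreover have "wf x = w n + (x - real n) * (w (Suc n) - w n)" if "x \<in> {real n..real (Suc n)}" for x
    proof (cases "x = real (Suc n)")
      case False
      then have "nat \<lfloor>x\<rfloor> = n" using that by (auto simp: nat_eq_iff floor_eq_iff)
      then show ?thesis by (simp add: weight_fun_def)
    next
      case True
      have "wf x = w (Suc n)" unfolding True by (rule weight_fun_of_nat)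
      then show ?thesis using True by simp
    qed
    ultimately show ?thesis using continuous_on_cong[OF refl] by (metis (no_types, lifting))
  qed
  have up: "continuous_on {0..real n} wf" for n
  proof (induction n)
    case (Suc n)
    have "{0..real (Suc n)} = {0..real n} \<union> {real n..real (Suc n)}" by auto
    then show ?case using continuous_on_closed_Un[OF _ _ Suc piece[of n]] by simp
  qed simp
  show ?thesis
  proof (clarsimp simp: continuous_on_eq_continuous_within)
    fix x :: real assume x: "0 \<le> x"
    obtain n where n: "x < real n" using reals_Archimedean2 by blast
    have "continuous (at x within {0..real n}) wf"
      using up[of n] x n by (auto simp: continuous_on_eq_continuous_within)
    moreover have "at x within {0..real n} = at x within {0..}"
      using x n by (intro at_within_nhd[of x "{..<real n}"]) auto
    ultimately show "continuous (at x within {0..}) wf" by simp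
  qed
qed

lemma W_derivative: "0 \<le> x \<Longrightarrow> (Wf has_real_derivative 1 / wf x) (at x within {0..})"
  unfolding W_def[abs_def]
  by (rule primitive_has_derivative)
     (auto intro!: continuous_on_divide continuous_on_const wf_continuous dest: wf_pos)

lemma W_0 [simp]: "Wf 0 = 0"
proof -
  have "{0..0::real} \<in> null_sets lborel" by (simp add: null_sets_def)
  then show ?thesis unfolding W_def set_lebesgue_integral_def
    by (intro integral_eq_zero_AE) (auto dest!: AE_not_in elim!: eventually_mono)
qed

lemma W_diff_ge: "0 \<le> x \<Longrightarrow> x \<le> y \<Longrightarrow> (y - x) / wf y \<le> Wf y - Wf x"
proof -
  assume xy: "0 \<le> x" "x \<le> y"
  have "1 / wf y * (y - x) \<le> Wf y - Wf x"
    using xy by (intro increment_ge[OF W_derivative] frac_le wf_pos wf_mono) auto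
  then show ?thesis by simp
qed

lemma W_diff_le: "0 \<le> x \<Longrightarrow> x \<le> y \<Longrightarrow> Wf y - Wf x \<le> (y - x) / wf x"
proof -
  assume xy: "0 \<le> x" "x \<le> y"
  have "Wf y - Wf x \<le> 1 / wf x * (y - x)"
    using xy by (intro increment_le[OF W_derivative] frac_le wf_pos wf_mono) auto
  then show ?thesis by simp
qed

lemma W_continuous: "continuous_on {0..} Wf"
  by (rule has_derivative_imp_continuous_on[OF W_derivative])

lemma W_strict: "0 \<le> x \<Longrightarrow> x < y \<Longrightarrow> Wf x < Wf y"
proof -
  assume a: "0 \<le> x" "x < y"
  then have "0 < (y - x) / wf y" using wf_pos[of y] by simp
  then show ?thesis using W_diff_ge[of x y] a by linarith
qed

lemma W_mono: "0 \<le> x \<Longrightarrow> x \<le> y \<Longrightarrow> Wf x \<le> Wf y"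
  using W_strict[of x y] by (cases "x = y") auto

lemma W_nonneg: "0 \<le> x \<Longrightarrow> 0 \<le> Wf x"
  using W_mono[of 0 x] by simp

text \<open>\<open>V\<close> is the left Riemann sum of the decreasing integrand of \<open>W\<close>.\<close>

lemma W_le_V: "Wf (real n) \<le> V w n"
proof (induction n)
  case (Suc n)
  then show ?case using W_diff_le[of "real n" "real (Suc n)"] by (simp add: V_Suc)
qed simp

lemma V_le_W: "V w n \<le> Wf (real n) + 1 / w 0"
proof -
  have "V w (Suc n) \<le> Wf (real n) + 1 / w 0"
  proof (induction n)
    case (Suc n)
    have "1 / w (Suc n) \<le> Wf (real (Suc n)) - Wf (real n)"
      using W_diff_ge[of "real n" "real (Suc n)"] weight_fun_of_nat[of w "Suc n"] by simp
    then show ?case using Suc by (simp add: V_Suc[of w "Suc n"])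
  qed (simp add: V_Suc)
  then show ?thesis using V_mono[of n "Suc n"] by simp
qed

lemma W_surj: assumes "0 \<le> y" shows "\<exists>x\<ge>0. Wf x = y"
proof -
  obtain n where "y + 1 / w 0 \<le> V w n" using V_eventually_ge by blast
  then have "y \<le> Wf (real n)" using V_le_W[of n] by linarith
  then have "\<exists>x\<ge>0. x \<le> real n \<and> Wf x = y"
    using assms by (intro IVT') (auto intro: continuous_on_subset[OF W_continuous])
  then show ?thesis by blast
qed

lemma W_inj: "inj_on Wf {0..}"
proof (rule inj_onI)
  fix x y :: real assume "x \<in> {0..}" "y \<in> {0..}" "Wf x = Wf y"
  then show "x = y" using W_strict[of x y] W_strict[of y x] by (cases x y rule: linorder_cases) auto
qed

lemma Wi_W [simp]: "0 \<le> x \<Longrightarrow> Wi (Wf x) = x"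
  unfolding W_inv_def by (rule the_inv_into_f_f[OF W_inj]) simp

lemma Wi: "0 \<le> y \<Longrightarrow> 0 \<le> Wi y \<and> Wf (Wi y) = y"
  using W_surj[of y] by auto

lemma Wi_nonneg: "0 \<le> y \<Longrightarrow> 0 \<le> Wi y" and W_Wi: "0 \<le> y \<Longrightarrow> Wf (Wi y) = y"
  using Wi by auto

lemma Wi_mono: "0 \<le> x \<Longrightarrow> x \<le> y \<Longrightarrow> Wi x \<le> Wi y"
  using W_strict[of "Wi y" "Wi x"] Wi[of x] Wi[of y] by linarith

text \<open>This is \<open>w\<close> read on the time scale of \<open>W\<close>, equivalently the derivative of the inverse of \<open>W\<close>; the
integrand of \<open>G f\<close> is \<open>phi (f u) / phi u\<close>.\<close>

definition phi :: "real \<Rightarrow> real" where "phi u = wf (Wi u)"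

lemma phi_pos: "0 \<le> u \<Longrightarrow> 0 < phi u"
  unfolding phi_def by (intro wf_pos Wi_nonneg)

lemma phi_mono: "0 \<le> u \<Longrightarrow> u \<le> v \<Longrightarrow> phi u \<le> phi v"
  unfolding phi_def by (intro wf_mono Wi_nonneg Wi_mono)

lemma phi_W [simp]: "0 \<le> x \<Longrightarrow> phi (Wf x) = wf x"
  by (simp add: phi_def)

text \<open>\<open>W\<close> grows at rate at least \<open>1 / wf x\<close> on \<open>{0..x}\<close>, so its inverse is locally Lipschitz.\<close>

lemma Wi_continuous: "continuous_on {0..} Wi"
proof (clarsimp simp: continuous_on_eq_continuous_within)
  fix x :: real assume x: "0 \<le> x"
  have lip: "\<bar>Wi a - Wi b\<bar> \<le> phi (x+1) * \<bar>a - b\<bar>" if "a \<in> {0..x+1}" "b \<in> {0..x+1}" "a \<le> b" for a b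
  proof -
    have m: "0 \<le> Wi a" "Wi a \<le> Wi b" using that by (auto intro: Wi_nonneg Wi_mono)
    have "(Wi b - Wi a) / wf (Wi b) \<le> b - a"
      using W_diff_ge[OF m] that by (simp add: W_Wi)
    then have "Wi b - Wi a \<le> phi b * (b - a)"
      using wf_pos[of "Wi b"] m by (simp add: phi_def field_simps)
    also have "\<dots> \<le> phi (x+1) * (b - a)" using that by (intro mult_right_mono phi_mono) auto
    finally show ?thesis using m that by simp
  qed
  have "(phi (x+1))-lipschitz_on {0..x+1} Wi"
  proof (rule lipschitz_onI)
    fix a b assume "a \<in> {0..x+1}" "b \<in> {0..x+1}"
    then show "dist (Wi a) (Wi b) \<le> phi (x+1) * dist a b"
      using lip[of a b] lip[of b a] by (cases "a \<le> b") (auto simp: dist_real_def abs_minus_commute)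
  qed (use phi_pos[of "x+1"] x in auto)
  then have "continuous (at x within {0..x+1}) Wi"
    using lipschitz_on_continuous_on[of _ "{0..x+1}" Wi] x by (simp add: continuous_on_eq_continuous_within)
  moreover have "at x within {0..x+1} = at x within {0..}"
    using x by (intro at_within_nhd[of x "{..<x+1}"]) auto
  ultimately show "continuous (at x within {0..}) Wi" by simp
qed

lemma phi_continuous: "continuous_on {0..} phi"
  unfolding phi_def[abs_def]
  by (rule continuous_on_compose2[OF wf_continuous Wi_continuous]) (auto intro: Wi_nonneg)

text \<open>A class of functions that \<open>G\<close> preserves and for which the integral defining \<open>G\<close> is a primitive of
its integrand.\<close>

definition admissible :: "(real \<Rightarrow> real) \<Rightarrow> bool" where
  "admissible f \<longleftrightarrow> continuous_on {0..} f \<and> (\<forall>x\<ge>0. 0 \<le> f x)"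

lemma admissible_linear: "0 \<le> c \<Longrightarrow> admissible (\<lambda>x. c * x)"
  by (auto simp: admissible_def intro!: continuous_intros)

lemma admissible_integrand: "admissible f \<Longrightarrow> continuous_on {0..} (\<lambda>u. phi (f u) / phi u)"
proof -
  assume "admissible f"
  then have f: "continuous_on {0..} f" "f ` {0..} \<subseteq> {0..}" by (auto simp: admissible_def)
  have "\<forall>u\<in>{0..}. phi u \<noteq> 0" using phi_pos by fastforce
  then show ?thesis
    by (intro continuous_on_divide phi_continuous continuous_on_compose2[OF phi_continuous f])
qed

lemma G_eq: "G w f = (\<lambda>x. LINT u:{0..x}|lborel. phi (f u) / phi u)"
  by (simp add: G_def[abs_def] phi_def)

lemma G_derivative:
  assumes "admissible f" "0 \<le> x"
  shows "(G w f has_real_derivative phi (f x) / phi x) (at x within {0..})"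
  unfolding G_eq using admissible_integrand[OF assms(1)] assms(2) by (rule primitive_has_derivative)

lemma G_0 [simp]: "G w f 0 = 0"
proof -
  have "{0..0::real} \<in> null_sets lborel" by (simp add: null_sets_def)
  then show ?thesis unfolding G_def set_lebesgue_integral_def
    by (intro integral_eq_zero_AE) (auto dest!: AE_not_in elim!: eventually_mono)
qed

lemma G_mono:
  assumes "admissible f" "0 \<le> x" "x \<le> y" shows "G w f x \<le> G w f y"
  using increment_ge[OF G_derivative[OF assms(1)] assms(2,3), of 0] assms
  by (auto simp: admissible_def less_imp_le phi_pos)

lemma G_nonneg: "admissible f \<Longrightarrow> 0 \<le> x \<Longrightarrow> 0 \<le> G w f x"
  using G_mono[of f 0 x] by simp

lemma admissible_G: "admissible f \<Longrightarrow> admissible (G w f)"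
  using has_derivative_imp_continuous_on[OF G_derivative] G_nonneg by (auto simp: admissible_def)

lemma admissible_iterate: "admissible f \<Longrightarrow> admissible ((G w ^^ n) f)"
  by (induction n) (auto intro: admissible_G)

lemma G_mono_fun:
  assumes fg: "admissible f" "admissible g" "\<And>x. 0 \<le> x \<Longrightarrow> f x \<le> g x" and x: "0 \<le> x"
  shows "G w f x \<le> G w g x"
proof -
  have "0 * (x - 0) \<le> (G w g x - G w f x) - (G w g 0 - G w f 0)"
  proof (rule increment_ge)
    show "((\<lambda>x. G w g x - G w f x) has_real_derivative phi (g z) / phi z - phi (f z) / phi z) (at z within {0..})"
      if "0 \<le> z" for z
      using that by (intro derivative_intros G_derivative fg)
    show "0 \<le> phi (g z) / phi z - phi (f z) / phi z" if "0 \<le> z" for z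
      using that phi_pos[of z] fg by (auto simp: admissible_def intro!: divide_right_mono phi_mono)
  qed (use x in auto)
  then show ?thesis by simp
qed

lemma iterate_mono_fun:
  assumes fg: "admissible f" "admissible g" "\<And>x. 0 \<le> x \<Longrightarrow> f x \<le> g x" and x: "0 \<le> x"
  shows "(G w ^^ n) f x \<le> (G w ^^ n) g x"
  using x
proof (induction n arbitrary: x)
  case (Suc n)
  then show ?case
    using G_mono_fun[OF admissible_iterate[OF fg(1)] admissible_iterate[OF fg(2)]] by simp
qed (use fg in auto)

lemma bounded_image_iff: "admissible f \<Longrightarrow> bounded (f ` {0..}) \<longleftrightarrow> (\<exists>B. \<forall>x\<ge>0. f x \<le> B)"
  by (force simp: admissible_def bounded_iff)

section \<open>Indices to the left of one half\<close>

lemma i_index_le_iff: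
  "i_index w \<eta> \<le> enat k \<longleftrightarrow> (\<exists>n. 2 \<le> n \<and> n \<le> k \<and> bounded (((G w ^^ (n - 1)) (\<lambda>x. \<eta> * x)) ` {0..}))"
    (is "_ \<longleftrightarrow> (\<exists>n. 2 \<le> n \<and> n \<le> k \<and> ?b n)")
proof
  let ?T = "enat ` {n. 2 \<le> n \<and> ?b n}"
  assume bound: "i_index w \<eta> \<le> enat k"
  have "?T \<noteq> {}"
  proof
    assume "?T = {}"
    then have "i_index w \<eta> = \<infinity>" unfolding i_index_def by (metis Inf_empty top_enat_def)
    then show False using bound by simp
  qed
  then obtain t where "t \<in> ?T" by blast
  then have "(LEAST x. x \<in> ?T) \<in> ?T" by (rule LeastI)
  then have "Inf ?T \<in> ?T" using \<open>?T \<noteq> {}\<close> unfolding Inf_enat_def by (simp only: if_False)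
  then obtain n where "2 \<le> n" "?b n" "Inf ?T = enat n" by blast
  then show "\<exists>n. 2 \<le> n \<and> n \<le> k \<and> ?b n" using bound by (auto simp: i_index_def)
next
  assume "\<exists>n. 2 \<le> n \<and> n \<le> k \<and> ?b n"
  then obtain n where n: "2 \<le> n" "n \<le> k" "?b n" by blast
  then have "i_index w \<eta> \<le> enat n" unfolding i_index_def by (intro Inf_lower) auto
  then show "i_index w \<eta> \<le> enat k" using n(2) by (meson enat_ord_simps(1) order_trans)
qed

lemma i_index_mono:
  assumes "0 < \<eta>" "\<eta> \<le> \<eta>'"
  shows "i_index w \<eta> \<le> i_index w \<eta>'"
proof (cases "i_index w \<eta>'")
  case (enat k)
  then obtain n where n: "2 \<le> n" "n \<le> k" "bounded (((G w ^^ (n - 1)) (\<lambda>x. \<eta>' * x)) ` {0..})"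
    using i_index_le_iff[of \<eta>' k] by auto
  have adm: "admissible (\<lambda>x. \<eta> * x)" "admissible (\<lambda>x. \<eta>' * x)" using assms by (auto intro: admissible_linear)
  obtain B where B: "\<And>x. 0 \<le> x \<Longrightarrow> (G w ^^ (n - 1)) (\<lambda>x. \<eta>' * x) x \<le> B"
    using n(3) adm by (auto simp: bounded_image_iff admissible_iterate)
  have "(G w ^^ (n - 1)) (\<lambda>x. \<eta> * x) x \<le> B" if "0 \<le> x" for x
    using iterate_mono_fun[OF adm _ that] B[OF that] assms by (meson mult_right_mono order_trans)
  then have "bounded (((G w ^^ (n - 1)) (\<lambda>x. \<eta> * x)) ` {0..})"
    using adm by (auto simp: bounded_image_iff admissible_iterate)
  then show ?thesis using n enat i_index_le_iff[of \<eta> k] by auto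
qed simp

text \<open>The index is monotone in \<open>\<eta>\<close>, so its left limit at \<open>1/2\<close> is a supremum.\<close>

lemma i_minus_eq: "i_minus w = (SUP \<eta>\<in>{0<..<1/2}. i_index w \<eta>)"
proof -
  have "(i_index w \<longlongrightarrow> (SUP \<eta>\<in>{0<..<1/2}. i_index w \<eta>)) (at_left (1/2))"
  proof (rule order_tendstoI)
    fix a assume "a < (SUP \<eta>\<in>{0<..<1/2}. i_index w \<eta>)"
    then obtain \<eta> where \<eta>: "0 < \<eta>" "\<eta> < 1/2" "a < i_index w \<eta>" by (auto simp: less_SUP_iff)
    have "\<forall>\<^sub>F x in at_left (1/2). x \<in> {\<eta><..<1/2}"
      using \<eta> by (intro eventually_at_leftI[of \<eta>]) auto
    then show "\<forall>\<^sub>F x in at_left (1/2). a < i_index w x"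
    proof eventually_elim
      case (elim x)
      then show ?case using \<eta>(3) i_index_mono[OF \<eta>(1), of x] by simp
    qed
  next
    fix a assume a: "(SUP \<eta>\<in>{0<..<1/2}. i_index w \<eta>) < a"
    have "\<forall>\<^sub>F x in at_left (1/2). x \<in> {0<..<1/2::real}"
      by (intro eventually_at_leftI[of 0]) auto
    then show "\<forall>\<^sub>F x in at_left (1/2). i_index w x < a"
    proof eventually_elim
      case (elim x)
      then show ?case using a by (meson SUP_upper le_less_trans)
    qed
  qed
  then show ?thesis unfolding i_minus_def by (intro tendsto_Lim) auto
qed

text \<open>The slope \<open>1/16\<close> is an arbitrary choice below \<open>1/2\<close>; it leaves room for constant factors.\<close>

abbreviation g16 :: "real \<Rightarrow> real" where "g16 \<equiv> G w (\<lambda>x. 1/16 * x)"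

lemma i_minus_2:
  assumes "i_minus w = 2"
  shows "bounded (g16 ` {0..})"
proof -
  have "i_index w (1/16) \<le> (SUP \<eta>\<in>{0<..<1/2}. i_index w \<eta>)" by (rule SUP_upper) auto
  then have "i_index w (1/16) \<le> enat 2" using assms by (simp add: i_minus_eq numeral_eq_enat)
  then obtain n where n: "2 \<le> n" "n \<le> 2" "bounded (((G w ^^ (n - 1)) (\<lambda>x. 1/16 * x)) ` {0..})"
    unfolding i_index_le_iff by blast
  then have "n = 2" by simp
  then show ?thesis using n(3) by simp
qed

lemma i_minus_3:
  assumes "i_minus w = 3"
  shows "bounded (g16 ` {0..}) \<or> bounded (G w g16 ` {0..})"
    "\<exists>\<eta>. 0 < \<eta> \<and> \<eta> < 1/2 \<and> \<not> bounded (G w (\<lambda>x. \<eta> * x) ` {0..})"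
proof -
  have s: "(SUP \<eta>\<in>{0<..<1/2}. i_index w \<eta>) = enat 3" using assms by (simp add: i_minus_eq numeral_eq_enat)
  have "i_index w (1/16) \<le> (SUP \<eta>\<in>{0<..<1/2}. i_index w \<eta>)" by (rule SUP_upper) auto
  then have "i_index w (1/16) \<le> enat 3" using s by simp
  then obtain n where n: "2 \<le> n" "n \<le> 3" "bounded (((G w ^^ (n - 1)) (\<lambda>x. 1/16 * x)) ` {0..})"
    by (auto simp: i_index_le_iff)
  have "n = 2 \<or> n = 3" using n by auto
  then show "bounded (g16 ` {0..}) \<or> bounded (G w g16 ` {0..})"
    using n(3) by (auto simp: numeral_2_eq_2 numeral_3_eq_3)
  have "enat 2 < (SUP \<eta>\<in>{0<..<1/2}. i_index w \<eta>)" unfolding s by simp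
  then obtain \<eta> where \<eta>: "0 < \<eta>" "\<eta> < 1/2" "enat 2 < i_index w \<eta>" by (auto simp: less_SUP_iff)
  then have "\<not> i_index w \<eta> \<le> enat 2" by simp
  then have "\<not> bounded (((G w ^^ (2 - 1)) (\<lambda>x. \<eta> * x)) ` {0..})"
    using i_index_le_iff[of \<eta> 2] by (metis order_refl)
  then show "\<exists>\<eta>. 0 < \<eta> \<and> \<eta> < 1/2 \<and> \<not> bounded (G w (\<lambda>x. \<eta> * x) ` {0..})"
    using \<eta> by auto
qed

section \<open>Boundedness of G as a statement on series\<close>

text \<open>Substituting \<open>u = W y / c\<close> in \<open>G (c Id)\<close> cancels the numerator of the integrand: the derivative in
\<open>y\<close> becomes \<open>1 / c / phi (W y / c)\<close>, which can be compared with sums over integers \<open>y\<close>.\<close>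

definition G_scaled :: "real \<Rightarrow> real \<Rightarrow> real" where "G_scaled c y = G w (\<lambda>x. c * x) (Wf y / c)"

lemma compose_W_derivative:
  assumes "admissible f" "0 < c" "0 \<le> y"
  shows "((\<lambda>y. G w f (Wf y / c)) has_real_derivative phi (f (Wf y / c)) / phi (Wf y / c) * (1 / wf y / c)) (at y within {0..})"
proof -
  have "(G w f has_real_derivative phi (f (Wf y / c)) / phi (Wf y / c)) (at (Wf y / c) within (\<lambda>y. Wf y / c) ` {0..})"
  proof (rule DERIV_subset[OF G_derivative[OF assms(1)]])
    show "0 \<le> Wf y / c" by (intro divide_nonneg_nonneg W_nonneg) (use assms in linarith)+
    have "0 \<le> Wf z / c" if "0 \<le> z" for z
      by (intro divide_nonneg_nonneg W_nonneg that) (use assms in linarith)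
    then show "(\<lambda>y. Wf y / c) ` {0..} \<subseteq> {0..}" by blast
  qed
  moreover have "((\<lambda>y. Wf y / c) has_real_derivative 1 / wf y / c) (at y within {0..})"
    using assms by (intro DERIV_cdivide W_derivative)
  ultimately have "(G w f \<circ> (\<lambda>y. Wf y / c) has_real_derivative
      phi (f (Wf y / c)) / phi (Wf y / c) * (1 / wf y / c)) (at y within {0..})"
    by (rule DERIV_image_chain)
  then show ?thesis by (simp only: o_def)
qed

lemma G_scaled_derivative:
  assumes "0 < c" "0 \<le> y"
  shows "(G_scaled c has_real_derivative 1 / c / phi (Wf y / c)) (at y within {0..})"
proof -
  have "phi (c * (Wf y / c)) / phi (Wf y / c) * (1 / wf y / c) = 1 / c / phi (Wf y / c)"
    using assms wf_pos[of y] by simp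
  then show ?thesis
    using compose_W_derivative[of "\<lambda>x. c * x" c y] assms admissible_linear[of c]
    unfolding G_scaled_def[abs_def] by simp
qed

lemma phi_W_div_mono: "0 < c \<Longrightarrow> 0 \<le> x \<Longrightarrow> x \<le> y \<Longrightarrow> phi (Wf x / c) \<le> phi (Wf y / c)"
  by (intro phi_mono divide_right_mono W_mono divide_nonneg_nonneg W_nonneg) auto

lemma phi_W_div_pos: "0 < c \<Longrightarrow> 0 \<le> x \<Longrightarrow> 0 < phi (Wf x / c)"
  by (intro phi_pos divide_nonneg_nonneg W_nonneg) auto

lemma G_scaled_0 [simp]: "G_scaled c 0 = 0" by (simp add: G_scaled_def)

lemma sum_le_G_scaled:
  assumes "0 < c" shows "(\<Sum>j=1..n. 1 / phi (Wf (real j) / c)) \<le> c * G_scaled c (real n)"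
proof (induction n)
  case (Suc n)
  have "1 / c / phi (Wf (real (Suc n)) / c) * (real (Suc n) - real n) \<le> G_scaled c (real (Suc n)) - G_scaled c (real n)"
    using assms
    by (intro increment_ge[OF G_scaled_derivative])
       (auto intro!: divide_left_mono phi_W_div_mono mult_pos_pos phi_W_div_pos)
  then have "1 / phi (Wf (real (Suc n)) / c) \<le> c * (G_scaled c (real (Suc n)) - G_scaled c (real n))"
    using assms phi_W_div_pos[of c "real (Suc n)"] by (simp add: field_simps)
  then show ?case using Suc by (simp add: algebra_simps)
qed simp

lemma G_scaled_le_sum:
  assumes "0 < c" shows "c * G_scaled c (real n) \<le> (\<Sum>j<n. 1 / phi (Wf (real j) / c))"
proof (induction n)
  case (Suc n)
  have "G_scaled c (real (Suc n)) - G_scaled c (real n) \<le> 1 / c / phi (Wf (real n) / c) * (real (Suc n) - real n)"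
    using assms
    by (intro increment_le[OF G_scaled_derivative])
       (auto intro!: divide_left_mono phi_W_div_mono mult_pos_pos phi_W_div_pos)
  then have "c * (G_scaled c (real (Suc n)) - G_scaled c (real n)) \<le> 1 / phi (Wf (real n) / c)"
    using assms phi_W_div_pos[of c "real n"] by (simp add: field_simps)
  then show ?case using Suc by (simp add: algebra_simps)
qed simp

lemma G_scaled_mono: "0 < c \<Longrightarrow> 0 \<le> x \<Longrightarrow> x \<le> y \<Longrightarrow> G_scaled c x \<le> G_scaled c y"
  unfolding G_scaled_def by (intro G_mono admissible_linear divide_right_mono W_mono divide_nonneg_nonneg W_nonneg) auto

lemma G_scaled_bounded_imp:
  assumes c: "0 < c" and B: "\<And>n. G_scaled c (real n) \<le> B"
  shows "bounded (G w (\<lambda>x. c * x) ` {0..})"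
proof -
  have "G w (\<lambda>x. c * x) t \<le> B" if "0 \<le> t" for t
  proof -
    have ct: "0 \<le> c * t" using c that by simp
    obtain n where n: "Wi (c * t) \<le> real n" using real_arch_simple by blast
    have "G w (\<lambda>x. c * x) t = G_scaled c (Wi (c * t))" using c ct by (simp add: G_scaled_def W_Wi)
    also have "\<dots> \<le> G_scaled c (real n)" using c n ct by (intro G_scaled_mono Wi_nonneg)
    also have "\<dots> \<le> B" by (rule B)
    finally show ?thesis .
  qed
  then show ?thesis using c by (auto simp: bounded_image_iff admissible_linear admissible_G)
qed

lemma unbounded_imp_sum_unbounded:
  assumes c: "0 < c" and u: "\<not> bounded (G w (\<lambda>x. c * x) ` {0..})"
  shows "\<exists>n. Z < (\<Sum>j<n. 1 / phi (Wf (real j) / c))"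
proof (rule ccontr)
  assume n: "\<not> ?thesis"
  have "G_scaled c (real n) \<le> Z / c" for n
    using G_scaled_le_sum[OF c, of n] n c by (simp add: field_simps not_less) (meson order_trans)
  then show False using G_scaled_bounded_imp[OF c] u by blast
qed

text \<open>Let \<open>y j\<close> solve \<open>G_scaled c (y j) = W j\<close> and take \<open>\<theta> j = 1 / wf (y j)\<close>. With \<open>H y = G (G (c Id)) (W y / c)\<close>
the derivatives satisfy \<open>H' = phi (G_scaled c y) * G_scaled' / wf y\<close>. On \<open>{y j..y (j + 1)}\<close> the value
\<open>G_scaled c y\<close> is at least \<open>W j\<close>, so that \<open>H\<close> gains at least
\<open>w j / wf (y (j + 1)) * (W (j + 1) - W j)\<close>, which is \<open>\<theta> (j + 1)\<close> up to a constant factor. So the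
partial sums of \<open>\<theta>\<close> are bounded with \<open>H\<close>.\<close>

lemma bounded_second_iterate_imp_majorant:
  assumes c: "0 < c" and b: "bounded (G w (G w (\<lambda>x. c * x)) ` {0..})"
    and u: "\<not> bounded (G w (\<lambda>x. c * x) ` {0..})"
  shows "\<exists>\<theta> B. (\<forall>j. 0 \<le> \<theta> j) \<and> (\<forall>n. (\<Sum>j=1..n. \<theta> j) \<le> B) \<and>
     (\<forall>j n. Wf (real j) \<le> G_scaled c (real n) \<longrightarrow> 1 / w n \<le> \<theta> j)"
proof -
  let ?g = "G w (\<lambda>x. c * x)"
  have adm: "admissible ?g" using c by (intro admissible_G admissible_linear) auto
  define H where "H y = G w ?g (Wf y / c)" for y
  obtain B where B: "\<And>x. 0 \<le> x \<Longrightarrow> G w ?g x \<le> B"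
    using b adm by (auto simp: bounded_image_iff admissible_G)
  have H_le: "H y \<le> B" if "0 \<le> y" for y
    unfolding H_def using c that by (intro B divide_nonneg_nonneg W_nonneg) auto
  have H_der: "(H has_real_derivative phi (G_scaled c y) / phi (Wf y / c) * (1 / wf y / c)) (at y within {0..})"
    if "0 \<le> y" for y
    using compose_W_derivative[OF adm c that] by (simp add: H_def[abs_def] G_scaled_def)
  have "\<exists>y\<ge>0. G_scaled c y = Wf (real j)" for j
  proof -
    obtain n where "Wf (real j) \<le> G_scaled c (real n)"
      using G_scaled_bounded_imp[OF c, of "Wf (real j)"] u by (meson le_cases)
    then have "\<exists>y\<ge>0. y \<le> real n \<and> G_scaled c y = Wf (real j)"
      using has_derivative_imp_continuous_on[OF G_scaled_derivative[OF c]] W_nonneg[of "real j"]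
      by (intro IVT') (auto intro: continuous_on_subset)
    then show ?thesis by blast
  qed
  then obtain y where y: "\<And>j. 0 \<le> y j" "\<And>j. G_scaled c (y j) = Wf (real j)" by metis
  have lt: "y i < y j" if "i < j" for i j
  proof (rule ccontr)
    assume "\<not> y i < y j"
    then have "Wf (real j) \<le> Wf (real i)" using G_scaled_mono[OF c, of "y j" "y i"] y by auto
    then show False using W_strict[of "real i" "real j"] that by simp
  qed
  obtain r where r: "0 < r" "\<And>n. w (Suc n) \<le> r * w n" using w_Suc_le by blast
  have step: "1 / wf (y (Suc j)) \<le> r * (H (y (Suc j)) - H (y j))" for j
  proof -
    \<comment> \<open>\<open>\<kappa>\<close> bounds \<open>H' / G_scaled'\<close> from below on \<open>{y j..y (j + 1)}\<close>.\<close>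
    define \<kappa> where "\<kappa> = w j / wf (y (Suc j))"
    have wp: "0 < wf (y (Suc j))" by (intro wf_pos y)
    have k0: "0 \<le> \<kappa>" using wp by (simp add: \<kappa>_def)
    have "0 * (y (Suc j) - y j) \<le> (H (y (Suc j)) - \<kappa> * G_scaled c (y (Suc j))) - (H (y j) - \<kappa> * G_scaled c (y j))"
    proof (rule increment_ge)
      show "((\<lambda>y. H y - \<kappa> * G_scaled c y) has_real_derivative
          phi (G_scaled c z) / phi (Wf z / c) * (1 / wf z / c) - \<kappa> * (1 / c / phi (Wf z / c))) (at z within {0..})"
        if "0 \<le> z" for z
        using that c by (intro derivative_intros DERIV_cmult H_der G_scaled_derivative)
      fix z assume z: "y j \<le> z" "z \<le> y (Suc j)"
      have z0: "0 \<le> z" using z y(1)[of j] by linarith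
      have wz: "0 < wf z" "wf z \<le> wf (y (Suc j))" using z z0 by (auto intro: wf_pos wf_mono)
      have "Wf (real j) \<le> G_scaled c z" using G_scaled_mono[OF c y(1) z(1)] y(2) by simp
      then have "w j \<le> phi (G_scaled c z)" using phi_mono[OF W_nonneg, of "real j" "G_scaled c z"] by simp
      then have "\<kappa> \<le> phi (G_scaled c z) / wf z" unfolding \<kappa>_def using wz nonneg[of j] by (intro frac_le) linarith+
      then have "\<kappa> * (1 / c / phi (Wf z / c)) \<le> phi (G_scaled c z) / wf z * (1 / c / phi (Wf z / c))"
        using c phi_W_div_pos[OF c z0] by (intro mult_right_mono) auto
      then show "0 \<le> phi (G_scaled c z) / phi (Wf z / c) * (1 / wf z / c) - \<kappa> * (1 / c / phi (Wf z / c))"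
        by (simp add: mult_ac)
    qed (use y lt[of j "Suc j"] in auto)
    then have "\<kappa> * (Wf (real (Suc j)) - Wf (real j)) \<le> H (y (Suc j)) - H (y j)"
      by (simp add: y right_diff_distrib)
    moreover have "1 / w (Suc j) \<le> Wf (real (Suc j)) - Wf (real j)"
      using W_diff_ge[of "real j" "real (Suc j)"] weight_fun_of_nat[of w "Suc j"] by simp
    ultimately have a: "\<kappa> * (1 / w (Suc j)) \<le> H (y (Suc j)) - H (y j)"
      using k0 by (meson mult_left_mono order_trans)
    have "1 / wf (y (Suc j)) \<le> r * (\<kappa> * (1 / w (Suc j)))"
      using r(2)[of j] wp by (simp add: \<kappa>_def field_simps)
    also have "\<dots> \<le> r * (H (y (Suc j)) - H (y j))" using a r(1) by (intro mult_left_mono) auto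
    finally show ?thesis .
  qed
  have sum: "(\<Sum>j=1..n. 1 / wf (y j)) \<le> r * (H (y n) - H (y 0))" for n
  proof (induction n)
    case (Suc n)
    then show ?case using step[of n] by (simp add: algebra_simps)
  qed simp
  have "0 \<le> H (y 0)" unfolding H_def using adm c y by (intro G_nonneg divide_nonneg_nonneg W_nonneg) auto
  then have "r * (H (y n) - H (y 0)) \<le> r * B" for n
    using H_le[OF y(1)[of n]] r(1) by (intro mult_left_mono) auto
  then have "(\<Sum>j=1..n. 1 / wf (y j)) \<le> r * B" for n using sum order_trans by blast
  moreover have "1 / w n \<le> 1 / wf (y j)" if "Wf (real j) \<le> G_scaled c (real n)" for j n
  proof -
    have "y j \<le> real n"
    proof (rule ccontr)
      assume "\<not> y j \<le> real n"
      have "1 / c / phi (Wf (y j) / c) * (y j - real n) \<le> G_scaled c (y j) - G_scaled c (real n)"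
        using c y \<open>\<not> y j \<le> real n\<close>
        by (intro increment_ge[OF G_scaled_derivative])
           (auto intro!: divide_left_mono phi_W_div_mono mult_pos_pos phi_W_div_pos)
      moreover have "0 < 1 / c / phi (Wf (y j) / c) * (y j - real n)"
        using c phi_W_div_pos[OF c y(1)[of j]] \<open>\<not> y j \<le> real n\<close> by simp
      ultimately show False using that y(2)[of j] by simp
    qed
    then have "wf (y j) \<le> w n" using wf_mono[OF y(1)[of j], of "real n"] by simp
    then show ?thesis using wf_pos[OF y(1)[of j]] by (intro frac_le) auto
  qed
  moreover have "0 \<le> 1 / wf (y j)" for j using wf_pos[OF y(1)[of j]] by simp
  ultimately show ?thesis
    by (intro exI[of _ "\<lambda>j. 1 / wf (y j)"] exI[of _ "r * B"] conjI allI impI)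
qed

end

section \<open>Weighted step counts of a path\<close>

definition nn_path :: "(nat \<Rightarrow> int) \<Rightarrow> nat \<Rightarrow> bool" where
  "nn_path x n \<longleftrightarrow> (\<forall>k<n. x (Suc k) = x k - 1 \<or> x (Suc k) = x k + 1)"

text \<open>Only the steps made after more than \<open>m\<close> visits to \<open>y\<close> count; for \<open>m = 0\<close> all steps do. The gate \<open>m\<close> is
used to leave out an initial phase during which the steps from \<open>y\<close> are prescribed.\<close>

definition flow :: "(nat \<Rightarrow> real) \<Rightarrow> nat \<Rightarrow> (nat \<Rightarrow> int) \<Rightarrow> nat \<Rightarrow> int \<Rightarrow> int \<Rightarrow> real" where
  "flow w m x n y z =
     (\<Sum>k<n. if x k = y \<and> x (Suc k) = z \<and> m < visits x k y then 1 / w (visits x k z) else 0)"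

definition net_flow :: "(nat \<Rightarrow> real) \<Rightarrow> nat \<Rightarrow> int \<Rightarrow> nat \<Rightarrow> (nat \<Rightarrow> int) \<Rightarrow> real" where
  "net_flow w g y n x = flow w g x n y (y + 1) - flow w g x n y (y - 1)"

definition flow2 :: "(nat \<Rightarrow> real) \<Rightarrow> nat \<Rightarrow> (nat \<Rightarrow> int) \<Rightarrow> nat \<Rightarrow> int \<Rightarrow> int \<Rightarrow> real" where
  "flow2 w m x n y z =
     (\<Sum>k<n. if x k = y \<and> x (Suc k) = z \<and> m < visits x k y then (1 / w (visits x k z))^2 else 0)"

definition crossings :: "(nat \<Rightarrow> int) \<Rightarrow> nat \<Rightarrow> int \<Rightarrow> int \<Rightarrow> nat" where
  "crossings x n y z = card {k. k < n \<and> x k = y \<and> x (Suc k) = z}"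

lemma nn_path_mono: "nn_path x n \<Longrightarrow> k \<le> n \<Longrightarrow> nn_path x k"
  by (auto simp: nn_path_def)

lemma nn_path_Suc: "nn_path x (Suc n) \<longleftrightarrow> nn_path x n \<and> (x (Suc n) = x n - 1 \<or> x (Suc n) = x n + 1)"
  by (auto simp: nn_path_def less_Suc_eq)

lemma visits_0: "visits x 0 y = (if x 0 = y then 1 else 0)"
proof -
  have "{k. k \<le> 0 \<and> x k = y} = (if x 0 = y then {0} else {})" by auto
  then show ?thesis by (simp add: visits_def)
qed

lemma visits_Suc: "visits x (Suc n) y = visits x n y + (if x (Suc n) = y then 1 else 0)"
proof -
  have "{k. k \<le> Suc n \<and> x k = y} = {k. k \<le> n \<and> x k = y} \<union> (if x (Suc n) = y then {Suc n} else {})"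
    by (auto simp: le_Suc_eq)
  then show ?thesis by (auto simp: visits_def)
qed

lemma visits_mono: "k \<le> n \<Longrightarrow> visits x k y \<le> visits x n y"
  unfolding visits_def by (intro card_mono) auto

lemma visits_pos_iff: "0 < visits x n y \<longleftrightarrow> (\<exists>k\<le>n. x k = y)"
  by (auto simp: visits_def card_gt_0_iff)

lemma visits_pos: "x k = y \<Longrightarrow> 0 < visits x k y"
  by (auto simp: visits_pos_iff)

lemma visits_cong: "(\<And>k. k \<le> n \<Longrightarrow> x k = x' k) \<Longrightarrow> visits x n y = visits x' n y"
  unfolding visits_def by (intro arg_cong[of _ _ card]) auto

lemma flow_0 [simp]: "flow w m x 0 y z = 0" by (simp add: flow_def)

lemma flow_Suc: "flow w m x (Suc n) y z = flow w m x n y z +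
    (if x n = y \<and> x (Suc n) = z \<and> m < visits x n y then 1 / w (visits x n z) else 0)"
  by (simp add: flow_def)

lemma flow2_0 [simp]: "flow2 w m x 0 y z = 0" by (simp add: flow2_def)

lemma flow2_Suc: "flow2 w m x (Suc n) y z = flow2 w m x n y z +
    (if x n = y \<and> x (Suc n) = z \<and> m < visits x n y then (1 / w (visits x n z))^2 else 0)"
  by (simp add: flow2_def)

lemma flow_cong: "(\<And>k. k \<le> n \<Longrightarrow> x k = x' k) \<Longrightarrow> flow w m x n y z = flow w m x' n y z"
  unfolding flow_def by (intro sum.cong refl) (auto simp: visits_cong[of _ x x'])

lemma flow2_cong: "(\<And>k. k \<le> n \<Longrightarrow> x k = x' k) \<Longrightarrow> flow2 w m x n y z = flow2 w m x' n y z"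
  unfolding flow2_def by (intro sum.cong refl) (auto simp: visits_cong[of _ x x'])

lemma crossings_0 [simp]: "crossings x 0 y z = 0" by (simp add: crossings_def)

lemma crossings_Suc: "crossings x (Suc n) y z = crossings x n y z + (if x n = y \<and> x (Suc n) = z then 1 else 0)"
proof -
  have "{k. k < Suc n \<and> x k = y \<and> x (Suc k) = z} =
      {k. k < n \<and> x k = y \<and> x (Suc k) = z} \<union> (if x n = y \<and> x (Suc n) = z then {n} else {})"
    by (auto simp: less_Suc_eq)
  then show ?thesis by (auto simp: crossings_def)
qed

lemma crossings_le_visits: "crossings x n y z \<le> visits x n z"
  by (induction n) (auto simp: crossings_Suc visits_Suc)

lemma crossings_le_visits_from: "z \<noteq> z' \<Longrightarrow> crossings x n y z + crossings x n y z' \<le> visits x n y"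
proof -
  assume "z \<noteq> z'"
  then have "crossings x n y z + crossings x n y z' + (if x n = y then 1 else 0) \<le> visits x n y"
    by (induction n) (auto simp: crossings_Suc visits_Suc visits_0)
  then show ?thesis by simp
qed

lemma visits_eq_crossings:
  assumes "nn_path x n" "x 0 \<noteq> z"
  shows "visits x n z = crossings x n (z - 1) z + crossings x n (z + 1) z"
  using assms(1)
proof (induction n)
  case 0 then show ?case using assms(2) by (simp add: visits_0)
next
  case (Suc n) then show ?case by (auto simp: nn_path_Suc visits_Suc crossings_Suc)
qed

lemma visits_le_neighbours:
  assumes "nn_path x n"
  shows "visits x n y \<le> visits x n (y - 1) + visits x n (y + 1) + 1"
proof -
  have "visits x n y \<le> visits x n (y - 1) + visits x n (y + 1) + (if x n = y then 1 else 0)"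
    using assms
  proof (induction n)
    case 0 then show ?case by (simp add: visits_0)
  next
    case (Suc n) then show ?case by (auto simp: nn_path_Suc visits_Suc split: if_splits)
  qed
  then show ?thesis by (auto split: if_splits)
qed

lemma visited_below:
  assumes "nn_path x n" "x 0 \<le> y" "y \<le> x n"
  shows "\<exists>k\<le>n. x k = y"
proof -
  have "\<bar>x (Suc i) - x i\<bar> \<le> 1" if "i < n" for i
  proof -
    have "x (Suc i) = x i - 1 \<or> x (Suc i) = x i + 1" using assms(1) that by (auto simp: nn_path_def)
    then show ?thesis by auto
  qed
  then show ?thesis using nat_intermed_int_val[of 0 n x y] assms by auto
qed

context weight_A
begin

lemma flow_nonneg [simp]: "0 \<le> flow w m x n y z"
  unfolding flow_def by (intro sum_nonneg) auto

lemma flow_mono: "k \<le> n \<Longrightarrow> flow w m x k y z \<le> flow w m x n y z"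
  unfolding flow_def by (intro sum_mono2) auto

text \<open>Every visit to \<open>z\<close> except a visit at time 0 is an arrival from one of the two neighbours.\<close>

lemma V_visits_eq:
  assumes "nn_path x n"
  shows "V w (visits x n z) = (if x 0 = z then 1 / w 0 else 0) + flow w 0 x n (z - 1) z + flow w 0 x n (z + 1) z"
  using assms
proof (induction n)
  case 0 then show ?case by (simp add: visits_0 V_Suc V_def)
next
  case (Suc n)
  have p: "0 < visits x n (x n)" by (rule visits_pos) simp
  have z: "x (Suc n) = z \<Longrightarrow> x n = z - 1 \<or> x n = z + 1" using Suc.prems by (auto simp: nn_path_Suc)
  have ih: "V w (visits x n z) = (if x 0 = z then 1 / w 0 else 0) + flow w 0 x n (z - 1) z + flow w 0 x n (z + 1) z"
    using Suc by (simp add: nn_path_Suc)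
  show ?case
  proof (cases "x (Suc n) = z")
    case False then show ?thesis using ih by (simp add: visits_Suc flow_Suc)
  next
    case True
    then show ?thesis using ih z[OF True] p by (auto simp: visits_Suc flow_Suc V_Suc)
  qed
qed

text \<open>Each crossing from \<open>y\<close> to \<open>z\<close> is also a visit to \<open>z\<close>, so the \<open>k\<close>-th one adds at most \<open>1 / w (k - 1)\<close>.\<close>

lemma flow_le_V_crossings: "flow w m x n y z \<le> V w (crossings x n y z)"
proof (induction n)
  case (Suc n)
  show ?case using Suc recip_le[OF crossings_le_visits[of x n y z]]
    by (auto simp: flow_Suc crossings_Suc V_Suc intro: add_increasing2)
qed simp

lemma flow_le_V_visits: "flow w m x n y z \<le> V w (visits x n z)"
  using flow_le_V_crossings V_mono[OF crossings_le_visits] order_trans by blast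

text \<open>Different departures from \<open>y\<close> see different numbers of visits to \<open>y\<close>, so a bound on a step by a
function of that number sums up along the integers.\<close>

lemma flow_le_sum:
  assumes \<theta>: "\<And>j. 0 \<le> \<theta> j"
    and bound: "\<And>k. k < n \<Longrightarrow> x k = y \<Longrightarrow> x (Suc k) = z \<Longrightarrow> m < visits x k y \<Longrightarrow> 1 / w (visits x k z) \<le> \<theta> (visits x k y)"
  shows "flow w m x n y z \<le> (\<Sum>j\<in>{m<..visits x n y}. \<theta> j)"
proof (cases n)
  case (Suc n')
  have "flow w m x (Suc i) y z \<le> (\<Sum>j\<in>{m<..visits x i y}. \<theta> j)" if "i \<le> n'" for i
    using that
  proof (induction i)
    case 0
    show ?case using bound[of 0] Suc \<theta>
      by (auto simp: flow_Suc visits_0 intro!: sum_nonneg order_trans[OF _ member_le_sum[of 1]])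
  next
    case (Suc i)
    show ?case
    proof (cases "x (Suc i) = y \<and> m < visits x (Suc i) y")
      case True
      then have "{m<..visits x (Suc i) y} = insert (visits x (Suc i) y) {m<..visits x i y}"
        by (auto simp: visits_Suc)
      moreover have "visits x (Suc i) y \<notin> {m<..visits x i y}" using True by (simp add: visits_Suc)
      ultimately have "(\<Sum>j\<in>{m<..visits x (Suc i) y}. \<theta> j) = \<theta> (visits x (Suc i) y) + (\<Sum>j\<in>{m<..visits x i y}. \<theta> j)"
        by simp
      moreover have "flow w m x (Suc (Suc i)) y z \<le> flow w m x (Suc i) y z + \<theta> (visits x (Suc i) y)"
        using bound[of "Suc i"] True Suc.prems \<open>n = Suc n'\<close> \<theta> by (auto simp: flow_Suc[of w m x "Suc i"])
      ultimately show ?thesis using Suc by linarith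
    next
      case False
      have "(\<Sum>j\<in>{m<..visits x i y}. \<theta> j) \<le> (\<Sum>j\<in>{m<..visits x (Suc i) y}. \<theta> j)"
        using visits_mono[of i "Suc i" x y] by (intro sum_mono2 \<theta>) auto
      moreover have "flow w m x (Suc (Suc i)) y z = flow w m x (Suc i) y z"
        using False by (auto simp: flow_Suc[of w m x "Suc i"])
      ultimately show ?thesis using Suc by linarith
    qed
  qed
  from this[of n'] Suc have "flow w m x n y z \<le> (\<Sum>j\<in>{m<..visits x n' y}. \<theta> j)" by simp
  also have "\<dots> \<le> (\<Sum>j\<in>{m<..visits x n y}. \<theta> j)"
    using visits_mono[of n' n x y] Suc by (intro sum_mono2 \<theta>) auto
  finally show ?thesis .
qed (simp add: sum_nonneg \<theta>)

lemma flow_le_visits_from: "flow w m x n y z \<le> real (visits x n y) / w 0"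
proof -
  have "flow w m x n y z \<le> (\<Sum>j\<in>{m<..visits x n y}. 1 / w 0)"
    by (intro flow_le_sum recip_le) auto
  also have "\<dots> = real (visits x n y - m) * (1 / w 0)" by simp
  also have "\<dots> \<le> real (visits x n y) * (1 / w 0)" by (intro mult_right_mono) auto
  finally show ?thesis by simp
qed

definition recip_squares :: real where "recip_squares = (\<Sum>j. 1 / (w j)^2)"

lemma recip_squares_nonneg: "0 \<le> recip_squares"
  unfolding recip_squares_def by (intro suminf_nonneg summable_recip_square) auto

text \<open>Each arrival at \<open>z\<close> sees a different number of earlier visits to \<open>z\<close>.\<close>

lemma flow2_le: "flow2 w m x n y z \<le> recip_squares"
proof -
  have "flow2 w m x n y z \<le> (\<Sum>j<visits x n z. 1 / (w j)^2)"
    by (induction n) (auto simp: flow2_Suc visits_Suc power_one_over sum_nonneg add_increasing2)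
  also have "\<dots> \<le> recip_squares" unfolding recip_squares_def by (intro sum_le_suminf summable_recip_square) auto
  finally show ?thesis .
qed

end

section \<open>Paths with few recurrent sites\<close>

text \<open>Nonempty by the pigeonhole principle; without gaps because a nearest-neighbour path that visits two
sites infinitely often crosses everything in between infinitely often.\<close>

lemma recurrent_interval:
  fixes x :: "nat \<Rightarrow> int"
  assumes nn: "\<And>n. nn_path x n" and N: "\<And>n. \<bar>x n\<bar> \<le> N"
  shows "\<exists>a b. a \<le> b \<and> {y. infinite {n. x n = y}} = {a..b}"
proof -
  define R where "R = {y. infinite {n. x n = y}}"
  have sub: "R \<subseteq> {-N..N}"
  proof
    fix y assume "y \<in> R"
    then have "{n. x n = y} \<noteq> {}" unfolding R_def by (metis (mono_tags, lifting) finite.emptyI mem_Collect_eq)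
    then obtain n where "x n = y" by blast
    then show "y \<in> {-N..N}" using N[of n] by (auto simp: abs_le_iff)
  qed
  then have fin: "finite R" by (rule finite_subset) simp
  have "range x \<subseteq> {-N..N}" using N by (auto simp: abs_le_iff) (smt (verit))
  then have "finite (range x)" by (rule finite_subset) simp
  then obtain i where "infinite (x -` {x i})"
    using pigeonhole_infinite[of UNIV x] by (auto simp: vimage_def)
  then have "x i \<in> R" by (simp add: R_def vimage_def)
  then have ne: "R \<noteq> {}" by blast
  define a b where "a = Min R" and "b = Max R"
  have ab: "a \<in> R" "b \<in> R" "\<And>y. y \<in> R \<Longrightarrow> a \<le> y \<and> y \<le> b" using fin ne by (auto simp: a_def b_def)
  have "y \<in> R" if "a \<le> y" "y \<le> b" for y
  proof (rule ccontr)
    assume "y \<notin> R"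
    then have "finite {n. x n = y}" by (simp add: R_def)
    then obtain T where T: "\<And>n. x n = y \<Longrightarrow> n \<le> T"
      using finite_nat_set_iff_bounded_le by auto
    have "infinite {n. x n = a}" "infinite {n. x n = b}" using ab by (auto simp: R_def)
    then obtain i j where i: "i > T" "x i = a" and j: "j > i" "x j = b"
      unfolding infinite_nat_iff_unbounded by blast
    have "\<bar>x (Suc k) - x k\<bar> \<le> 1" for k
      using nn[of "Suc k"] by (auto simp: nn_path_Suc)
    then have "\<exists>k\<ge>i. k \<le> j \<and> x k = y"
      using i j that by (intro nat_intermed_int_val) auto
    then obtain k where "i \<le> k" "x k = y" by blast
    then show False using T[of k] i(1) by simp
  qed
  then have "{a..b} \<subseteq> R" by (meson atLeastAtMost_iff subsetI)
  moreover have "R \<subseteq> {a..b}" using ab(3) by (meson atLeastAtMost_iff subsetI)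
  ultimately have "R = {a..b}" by (rule subset_antisym[rotated])
  moreover have "a \<le> b" using ab by blast
  ultimately show ?thesis unfolding R_def by blast
qed

text \<open>A deterministic trajectory with the property that almost surely holds for the walk: all net flows
are bounded.\<close>

locale balanced_path = weight_A +
  fixes x :: "nat \<Rightarrow> int" and a b :: int
  assumes nn: "\<And>n. nn_path x n"
    and balance: "\<And>y. \<exists>C. \<forall>n. \<bar>net_flow w 0 y n x\<bar> \<le> C"
    and R: "{y. infinite {n. x n = y}} = {a..b}"
    and ab: "a \<le> b"
begin

lemma visits_bounded: "y \<notin> {a..b} \<Longrightarrow> \<exists>N. \<forall>n. visits x n y \<le> N"
proof -
  assume "y \<notin> {a..b}"
  then have "finite {n. x n = y}" using R by blast
  then have "visits x n y \<le> card {n. x n = y}" for n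
    unfolding visits_def by (intro card_mono) auto
  then show ?thesis by blast
qed

lemma visits_unbounded: "y \<in> {a..b} \<Longrightarrow> \<exists>T. \<forall>n\<ge>T. N \<le> visits x n y"
proof -
  assume "y \<in> {a..b}"
  then have "infinite {n. x n = y}" using R by blast
  then obtain S where S: "S \<subseteq> {n. x n = y}" "finite S" "card S = N"
    using infinite_arbitrarily_large by blast
  obtain T where T: "\<forall>n\<in>S. n \<le> T" using S(2) finite_nat_set_iff_bounded_le by blast
  have "N \<le> visits x n y" if "T \<le> n" for n
    unfolding visits_def S(3)[symmetric] using S T that by (intro card_mono) (auto intro: order_trans)
  then show ?thesis by blast
qed

lemma eventually_confined: "\<exists>T. \<forall>n\<ge>T. x n \<noteq> a - 1 \<and> x n \<noteq> b + 1"
proof -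
  have "a - 1 \<notin> {y. infinite {n. x n = y}}" "b + 1 \<notin> {y. infinite {n. x n = y}}"
    unfolding R by auto
  then have "finite ({n. x n = a - 1} \<union> {n. x n = b + 1})" by simp
  then obtain T where "\<forall>n\<in>{n. x n = a - 1} \<union> {n. x n = b + 1}. n \<le> T"
    using finite_nat_set_iff_bounded_le by blast
  then have "x n \<noteq> a - 1 \<and> x n \<noteq> b + 1" if "Suc T \<le> n" for n using that by force
  then show ?thesis by blast
qed

definition bdd :: "(nat \<Rightarrow> real) \<Rightarrow> bool" where "bdd f \<longleftrightarrow> (\<exists>C. \<forall>n. f n \<le> C)"

lemma bdd_balance: "bdd (\<lambda>n. flow w 0 x n y (y + 1) - flow w 0 x n y (y - 1))"
    "bdd (\<lambda>n. flow w 0 x n y (y - 1) - flow w 0 x n y (y + 1))"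
proof -
  obtain C where C: "\<And>n. \<bar>flow w 0 x n y (y + 1) - flow w 0 x n y (y - 1)\<bar> \<le> C"
    using balance unfolding net_flow_def by blast
  show "bdd (\<lambda>n. flow w 0 x n y (y + 1) - flow w 0 x n y (y - 1))"
    "bdd (\<lambda>n. flow w 0 x n y (y - 1) - flow w 0 x n y (y + 1))"
    unfolding bdd_def using abs_le_D1[OF C] abs_le_D2[OF C] by (auto intro!: exI[of _ C])
qed

lemma bdd_add: "bdd f \<Longrightarrow> bdd g \<Longrightarrow> bdd (\<lambda>n. f n + g n)"
  unfolding bdd_def by (meson add_mono)

lemma bdd_le: "bdd g \<Longrightarrow> (\<And>n. f n \<le> g n) \<Longrightarrow> bdd f"
  unfolding bdd_def by (meson order_trans)

lemma bdd_flow_to: "z \<notin> {a..b} \<Longrightarrow> bdd (\<lambda>n. flow w 0 x n y z)"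
  using visits_bounded[of z] flow_le_V_visits[of 0 x _ y z] V_mono unfolding bdd_def by (meson order_trans)

lemma bdd_flow_from: "y \<notin> {a..b} \<Longrightarrow> bdd (\<lambda>n. flow w 0 x n y z)"
proof -
  assume "y \<notin> {a..b}"
  then obtain N where N: "\<And>n. visits x n y \<le> N" using visits_bounded by blast
  have "flow w 0 x n y z \<le> real N / w 0" for n
    using flow_le_visits_from[of 0 x n y z] N[of n] divide_right_mono[of "real (visits x n y)" "real N" "w 0"] by simp
  then show ?thesis unfolding bdd_def by blast
qed

text \<open>The outward flow at an end is bounded as its target is visited finitely often, and the net flow is
bounded.\<close>

lemma bdd_flow_ends: "bdd (\<lambda>n. flow w 0 x n a (a + 1))" "bdd (\<lambda>n. flow w 0 x n b (b - 1))"
  using bdd_add[OF bdd_balance(1)[of a] bdd_flow_to[of "a - 1" a]]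
    bdd_add[OF bdd_balance(2)[of b] bdd_flow_to[of "b + 1" b]] by simp_all

lemma not_bdd_V_visits: "y \<in> {a..b} \<Longrightarrow> \<not> bdd (\<lambda>n. V w (visits x n y))"
proof
  assume y: "y \<in> {a..b}" and "bdd (\<lambda>n. V w (visits x n y))"
  then obtain C where C: "\<And>n. V w (visits x n y) \<le> C" by (auto simp: bdd_def)
  obtain B where B: "\<And>n. V w n \<le> C \<Longrightarrow> n \<le> B" using V_bounded_imp by blast
  obtain T where "\<forall>n\<ge>T. Suc B \<le> visits x n y" using visits_unbounded[OF y] by blast
  then show False using B[OF C[of T]] by force
qed

lemma V_visits_le: "V w (visits x n z) \<le> 1 / w 0 + flow w 0 x n (z - 1) z + flow w 0 x n (z + 1) z"
  using V_visits_eq[OF nn, of n z] by auto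

lemma bdd_const: "bdd (\<lambda>n. c)" by (auto simp: bdd_def)

lemma inflow_unbounded:
  assumes "y \<in> {a..b}" "bdd (\<lambda>n. flow w 0 x n (y - 1) y)" "bdd (\<lambda>n. flow w 0 x n (y + 1) y)"
  shows False
  using not_bdd_V_visits[OF assms(1)] bdd_le[OF bdd_add[OF bdd_add[OF bdd_const assms(2)] assms(3)] V_visits_le]
  by blast

text \<open>With at most three recurrent sites, the site \<open>a\<close> (if \<open>b = a\<close>) or \<open>a + 1\<close> receives flow only from
transient sites and from the ends.\<close>

lemma at_least_four_sites: "a + 3 \<le> b"
proof (rule ccontr)
  assume "\<not> a + 3 \<le> b"
  then consider "b = a" | "b = a + 1" | "b = a + 2" using ab by linarith
  then show False
  proof cases
    case 1
    show ?thesis using 1 by (intro inflow_unbounded[of a] bdd_flow_from) auto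
  next
    case 2
    then show ?thesis using bdd_flow_ends(1)
      by (intro inflow_unbounded[of b] bdd_flow_from[of "b+1"]) auto
  next
    case 3
    then show ?thesis using bdd_flow_ends
      by (intro inflow_unbounded[of "a + 1"]) (auto simp: algebra_simps)
  qed
qed

lemma visits_le_twice:
  assumes "bdd (\<lambda>n. V w (visits x n y) - V w (visits x n z))"
  shows "\<exists>A. \<forall>n. visits x n y \<le> 2 * visits x n z + A"
proof -
  obtain C where C: "\<And>n. V w (visits x n y) \<le> V w (visits x n z) + C"
    using assms unfolding bdd_def by (metis diff_le_eq add.commute)
  then show ?thesis using V_close_imp[of C] by blast
qed

text \<open>Eventually every departure from an end goes inwards. Number the visits to \<open>{a, b}\<close> by \<open>j\<close>; if the
\<open>j\<close>-th one adds at least \<open>\<theta> j\<close> to the inward flow, then the boundedness of the inward flows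
contradicts the divergence of the sum of \<open>\<theta>\<close>.\<close>

lemma returns_impossible:
  assumes \<theta>: "\<And>Z. \<exists>n. Z < (\<Sum>j<n. \<theta> j)" "\<And>j. 0 \<le> \<theta> j" and "a < b"
    and ret: "\<And>k. T \<le> k \<Longrightarrow> x k = a \<Longrightarrow> \<theta> (visits x k a + visits x k b) \<le> 1 / w (visits x k (a + 1))"
      "\<And>k. T \<le> k \<Longrightarrow> x k = b \<Longrightarrow> \<theta> (visits x k a + visits x k b) \<le> 1 / w (visits x k (b - 1))"
  shows False
proof -
  obtain T' where T': "\<And>n. T' \<le> n \<Longrightarrow> x n \<noteq> a - 1 \<and> x n \<noteq> b + 1" using eventually_confined by blast
  define U where "U = max T T'"
  define m where "m k = visits x k a + visits x k b" for k
  define F where "F n = flow w 0 x n a (a + 1) + flow w 0 x n b (b - 1)" for n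
  have "(\<Sum>j\<in>{m U<..m n}. \<theta> j) \<le> F (Suc n)" if "U \<le> n" for n
    using that
  proof (induction rule: dec_induct)
    case base show ?case by (simp add: F_def)
  next
    case (step k)
    have k: "T \<le> Suc k" "T' \<le> Suc (Suc k)" using step by (auto simp: U_def)
    have nn_path_upto: "x (Suc (Suc k)) = x (Suc k) - 1 \<or> x (Suc (Suc k)) = x (Suc k) + 1"
      using nn[of "Suc (Suc k)"] by (simp add: nn_path_Suc)
    have mU: "m U \<le> m k" unfolding m_def using step by (intro add_mono visits_mono) auto
    show ?case
    proof (cases "x (Suc k) = a \<or> x (Suc k) = b")
      case True
      have mS: "m (Suc k) = Suc (m k)" using True \<open>a < b\<close> by (auto simp: m_def visits_Suc)
      have "{m U<..m (Suc k)} = insert (m (Suc k)) {m U<..m k}" using mU by (auto simp: mS)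
      then have "(\<Sum>j\<in>{m U<..m (Suc k)}. \<theta> j) = \<theta> (m (Suc k)) + (\<Sum>j\<in>{m U<..m k}. \<theta> j)"
        by (simp add: mS)
      moreover have "F (Suc k) + \<theta> (m (Suc k)) \<le> F (Suc (Suc k))"
      proof (cases "x (Suc k) = a")
        case True
        then have "x (Suc (Suc k)) = a + 1" using nn_path_upto T'[OF k(2)] by auto
        then show ?thesis using ret(1)[OF k(1) True] True \<open>a < b\<close>
          by (simp add: F_def flow_Suc[of _ _ _ "Suc k"] m_def visits_pos)
      next
        case False
        then have xb: "x (Suc k) = b" using True by simp
        then have "x (Suc (Suc k)) = b - 1" using nn_path_upto T'[OF k(2)] by auto
        then show ?thesis using ret(2)[OF k(1) xb] xb \<open>a < b\<close>
          by (simp add: F_def flow_Suc[of _ _ _ "Suc k"] m_def visits_pos)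
      qed
      ultimately show ?thesis using step.IH by linarith
    next
      case False
      then have "m (Suc k) = m k" by (simp add: m_def visits_Suc)
      moreover have "F (Suc k) \<le> F (Suc (Suc k))" unfolding F_def by (intro add_mono flow_mono) auto
      ultimately show ?thesis using step.IH by simp
    qed
  qed
  moreover obtain C where C: "\<And>n. F n \<le> C"
    using bdd_add[OF bdd_flow_ends] unfolding bdd_def F_def by blast
  ultimately have S: "(\<Sum>j\<in>{m U<..m n}. \<theta> j) \<le> C" if "U \<le> n" for n using that by (meson order_trans)
  define D where "D = (\<Sum>j\<le>m U. \<theta> j)"
  obtain N where N: "C + D < (\<Sum>j<N. \<theta> j)" using \<theta>(1) by blast
  obtain n0 where n0: "\<forall>n\<ge>n0. N \<le> visits x n a" using visits_unbounded[of a] ab by auto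
  define n where "n = max U n0"
  have "N \<le> m n" using n0 by (simp add: m_def n_def trans_le_add1)
  then have "{..<N} \<subseteq> {..m U} \<union> {m U<..m n}" by auto
  then have "(\<Sum>j<N. \<theta> j) \<le> (\<Sum>j\<in>{..m U} \<union> {m U<..m n}. \<theta> j)" by (intro sum_mono2 \<theta>(2)) auto
  also have "\<dots> = D + (\<Sum>j\<in>{m U<..m n}. \<theta> j)" unfolding D_def by (intro sum.union_disjoint) auto
  also have "\<dots> \<le> D + C" using S[of n] by (simp add: n_def)
  finally show False using N by simp
qed

lemma w_quadruple_le: "\<exists>n5. \<forall>n\<ge>n5. w (4 * n) \<le> 5 * w n"
proof -
  obtain N where "\<And>n z. N \<le> n \<Longrightarrow> real z \<le> 4 * real n \<Longrightarrow> w z \<le> 5 * w n"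
    using eventually_w_le[of 4 5] unfolding eventually_sequentially by auto
  then show ?thesis by (intro exI[of _ N]) simp
qed

text \<open>Here \<open>V (Z (a + 2))\<close> is, up to bounded terms, the flow from \<open>a + 1\<close> to the right; this is balanced by
the flow from \<open>a + 1\<close> to the left, which is at most \<open>V (Z a)\<close>. So \<open>Z (a + 2)\<close> is at most about
\<open>2 * Z a\<close>, and \<open>Z (a + 1)\<close> is controlled by its neighbours.\<close>

lemma not_four_sites: "b \<noteq> a + 3"
proof
  assume b: "b = a + 3"
  have "bdd (\<lambda>n. (1 / w 0 + flow w 0 x n b (b - 1)) + (flow w 0 x n (a+1) (a+2) - flow w 0 x n (a+1) a))"
    using bdd_balance(1)[of "a + 1"] by (intro bdd_add bdd_const bdd_flow_ends) (simp add: algebra_simps)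
  then have "bdd (\<lambda>n. V w (visits x n (a + 2)) - V w (visits x n a))"
  proof (rule bdd_le)
    fix n
    show "V w (visits x n (a + 2)) - V w (visits x n a) \<le>
      (1 / w 0 + flow w 0 x n b (b - 1)) + (flow w 0 x n (a+1) (a+2) - flow w 0 x n (a+1) a)"
      using V_visits_le[of n "a + 2"] flow_le_V_visits[of 0 x n "a + 1" a] by (simp add: b algebra_simps)
  qed
  then obtain A where A: "\<And>n. visits x n (a + 2) \<le> 2 * visits x n a + A"
    using visits_le_twice by blast
  obtain T where T: "\<forall>n\<ge>T. A + 1 \<le> visits x n a" using visits_unbounded[of a] ab by auto
  have le2: "visits x k (a + 2) \<le> 4 * (visits x k a + visits x k b)" if "T \<le> k" for k
    using A[of k] T that by fastforce
  have le1: "visits x k (a + 1) \<le> 4 * (visits x k a + visits x k b)" if "T \<le> k" for k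
  proof -
    have "visits x k (a + 1) \<le> visits x k a + visits x k (a + 2) + 1"
      using visits_le_neighbours[OF nn, of k "a + 1"] by (simp add: algebra_simps)
    moreover have "A + 1 \<le> visits x k a" using T that by blast
    ultimately show ?thesis using A[of k] by simp
  qed
  show False
  proof (rule returns_impossible[of "\<lambda>j. 1 / w (4 * j)" T])
    fix Z :: real
    obtain n5 where n5: "\<And>n. n \<ge> n5 \<Longrightarrow> w (4 * n) \<le> 5 * w n" using w_quadruple_le by blast
    obtain N where N: "5 * (Z + 1) + V w n5 \<le> V w N" "n5 \<le> N"
      using V_eventually_ge by (meson linear order_trans)
    have "(V w N - V w n5) / 5 = (\<Sum>j=n5..<N. 1 / (5 * w j))"
      using V_diff[OF N(2)] by (simp add: sum_divide_distrib mult.commute)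
    also have "\<dots> \<le> (\<Sum>j=n5..<N. 1 / w (4 * j))"
      using n5 by (intro sum_mono frac_le) auto
    also have "\<dots> \<le> (\<Sum>j<N. 1 / w (4 * j))" by (intro sum_mono2) auto
    finally show "\<exists>n. Z < (\<Sum>j<n. 1 / w (4 * j))" using N(1) by (intro exI[of _ N]) simp
  next
    fix k assume k: "T \<le> k"
    show "1 / w (4 * (visits x k a + visits x k b)) \<le> 1 / w (visits x k (a + 1))"
      by (rule recip_le[OF le1[OF k]])
    have "b - 1 = a + 2" by (simp add: b)
    then show "1 / w (4 * (visits x k a + visits x k b)) \<le> 1 / w (visits x k (b - 1))"
      using recip_le[OF le2[OF k]] by (simp only:)
  qed (use b in auto)
qed

text \<open>With \<open>c\<close> the middle site, balance at \<open>a + 1\<close> and \<open>b - 1\<close> gives \<open>V (Z c) \<le> V (Z a) + V (Z b) + C\<close>, hence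
\<open>V (Z c) \<le> 2 * V m + C\<close> where \<open>m = Z a + Z b\<close> numbers the visits to the ends. As \<open>1 / \<eta> > 2\<close>, this gives
\<open>W (Z c) \<le> W m / \<eta>\<close> eventually. Balance also shows that \<open>Z a\<close> and \<open>Z b\<close> are at most about \<open>2 * Z c\<close>, so
the two sites next to the ends have at most \<open>4 * Z c\<close> visits, and the \<open>m\<close>-th visit to an end adds
at least \<open>1 / (5 * phi (W m / \<eta>))\<close> to the inward flow.\<close>

lemma not_five_sites:
  assumes \<eta>: "0 < \<eta>" "\<eta> < 1/2" and u: "\<not> bounded (G w (\<lambda>x. \<eta> * x) ` {0..})"
  shows "b \<noteq> a + 4"
proof
  assume b: "b = a + 4"
  define c where "c = a + 2"
  have bc: "b = c + 2" "a = c - 2" by (auto simp: b c_def)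
  have "bdd (\<lambda>n. (1 / w 0 + flow w 0 x n (a - 1) a) + (flow w 0 x n (a+1) a - flow w 0 x n (a+1) c))"
    using bdd_balance(2)[of "a + 1"]
    by (intro bdd_add bdd_const bdd_flow_from) (simp_all add: c_def algebra_simps)
  then have "bdd (\<lambda>n. V w (visits x n a) - V w (visits x n c))"
  proof (rule bdd_le)
    fix n
    show "V w (visits x n a) - V w (visits x n c) \<le>
      (1 / w 0 + flow w 0 x n (a - 1) a) + (flow w 0 x n (a+1) a - flow w 0 x n (a+1) c)"
      using V_visits_le[of n a] flow_le_V_visits[of 0 x n "a + 1" c] by (simp add: algebra_simps)
  qed
  then obtain A1 where A1: "\<And>n. visits x n a \<le> 2 * visits x n c + A1"
    using visits_le_twice by blast
  have "bdd (\<lambda>n. (1 / w 0 + flow w 0 x n (b + 1) b) + (flow w 0 x n (b-1) b - flow w 0 x n (b-1) c))"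
    using bdd_balance(1)[of "b - 1"]
    by (intro bdd_add bdd_const bdd_flow_from) (simp_all add: bc algebra_simps)
  then have "bdd (\<lambda>n. V w (visits x n b) - V w (visits x n c))"
  proof (rule bdd_le)
    fix n
    show "V w (visits x n b) - V w (visits x n c) \<le>
      (1 / w 0 + flow w 0 x n (b + 1) b) + (flow w 0 x n (b-1) b - flow w 0 x n (b-1) c)"
      using V_visits_le[of n b] flow_le_V_visits[of 0 x n "b - 1" c] by (simp add: algebra_simps)
  qed
  then obtain A2 where A2: "\<And>n. visits x n b \<le> 2 * visits x n c + A2"
    using visits_le_twice by blast
  have "bdd (\<lambda>n. 1 / w 0 + (flow w 0 x n (a+1) c - flow w 0 x n (a+1) a) + (flow w 0 x n (b-1) c - flow w 0 x n (b-1) b))"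
    using bdd_balance(1)[of "a + 1"] bdd_balance(2)[of "b - 1"]
    by (intro bdd_add bdd_const) (simp_all add: bc algebra_simps)
  then obtain C where C: "\<And>n. 1 / w 0 + (flow w 0 x n (a+1) c - flow w 0 x n (a+1) a) + (flow w 0 x n (b-1) c - flow w 0 x n (b-1) b) \<le> C"
    unfolding bdd_def by blast
  define m where "m k = visits x k a + visits x k b" for k
  have Vc: "V w (visits x n c) \<le> 2 * V w (m n) + C" for n
  proof -
    have "V w (visits x n c) \<le> 1 / w 0 + flow w 0 x n (a + 1) c + flow w 0 x n (b - 1) c"
      using V_visits_le[of n c] by (simp add: bc algebra_simps)
    moreover have "flow w 0 x n (a+1) a \<le> V w (m n)"
      by (rule order_trans[OF flow_le_V_visits V_mono]) (simp add: m_def)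
    moreover have "flow w 0 x n (b-1) b \<le> V w (m n)"
      by (rule order_trans[OF flow_le_V_visits V_mono]) (simp add: m_def)
    ultimately show ?thesis using C[of n] by linarith
  qed
  \<comment> \<open>From \<open>W m \<ge> K\<close> on, \<open>2 * (W m + 1 / w 0) + C \<le> W m / \<eta>\<close>.\<close>
  define K where "K = (2 / w 0 + C) / (1 / \<eta> - 2)"
  have \<eta>2: "0 < 1 / \<eta> - 2" using \<eta> by (simp add: field_simps)
  obtain n5 where n5: "\<And>n. n \<ge> n5 \<Longrightarrow> w (4 * n) \<le> 5 * w n" using w_quadruple_le by blast
  obtain M0 where M0: "\<And>n. M0 \<le> n \<Longrightarrow> K + 1 / w 0 \<le> V w n" using V_eventually_ge by blast
  obtain T1 where T1: "\<forall>n\<ge>T1. A1 + A2 + 1 + n5 \<le> visits x n c" using visits_unbounded[of c] b c_def by auto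
  obtain T2 where T2: "\<forall>n\<ge>T2. M0 \<le> visits x n a" using visits_unbounded[of a] ab by auto
  define T where "T = max T1 T2"
  have main: "1 / (5 * phi (Wf (real (m k)) / \<eta>)) \<le> 1 / w z"
    if k: "T \<le> k" and z: "z \<le> 4 * visits x k c" for k z
  proof -
    have kT: "T1 \<le> k" "T2 \<le> k" using k by (auto simp: T_def)
    have "M0 \<le> m k" using T2 kT by (simp add: m_def trans_le_add1)
    then have "K \<le> Wf (real (m k))" using M0[of "m k"] V_le_W[of "m k"] by linarith
    then have "2 / w 0 + C \<le> Wf (real (m k)) * (1 / \<eta> - 2)"
      using \<eta>2 by (simp add: K_def pos_divide_le_eq)
    moreover have "Wf (real (visits x k c)) \<le> 2 * (Wf (real (m k)) + 1 / w 0) + C"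
    proof -
      have "2 * V w (m k) \<le> 2 * (Wf (real (m k)) + 1 / w 0)" by (intro mult_left_mono V_le_W) auto
      then show ?thesis using W_le_V[of "visits x k c"] Vc[of k] by linarith
    qed
    ultimately have "Wf (real (visits x k c)) \<le> Wf (real (m k)) / \<eta>"
      by (simp add: algebra_simps)
    then have "phi (Wf (real (visits x k c))) \<le> phi (Wf (real (m k)) / \<eta>)"
      by (intro phi_mono W_nonneg) auto
    then have "w (visits x k c) \<le> phi (Wf (real (m k)) / \<eta>)" by simp
    moreover have "w z \<le> 5 * w (visits x k c)"
    proof -
      have "n5 \<le> visits x k c" using T1 kT by fastforce
      then show ?thesis using w_le[OF z] n5 order_trans by blast
    qed
    ultimately show ?thesis by (intro frac_le) auto
  qed
  show False
  proof (rule returns_impossible[of "\<lambda>j. 1 / (5 * phi (Wf (real j) / \<eta>))" T])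
    fix Z :: real
    obtain n where "5 * Z < (\<Sum>j<n. 1 / phi (Wf (real j) / \<eta>))"
      using unbounded_imp_sum_unbounded[OF \<eta>(1) u] by blast
    also have "\<dots> = 5 * (\<Sum>j<n. 1 / (5 * phi (Wf (real j) / \<eta>)))"
      by (simp add: sum_distrib_left)
    finally show "\<exists>n. Z < (\<Sum>j<n. 1 / (5 * phi (Wf (real j) / \<eta>)))" by auto
  next
    show "0 \<le> 1 / (5 * phi (Wf (real j) / \<eta>))" for j
      using phi_W_div_pos[OF \<eta>(1), of "real j"] by simp
    show "a < b" by (simp add: b)
  next
    fix k assume k: "T \<le> k"
    have c1: "A1 + A2 + 1 \<le> visits x k c" using T1 k by (fastforce simp: T_def)
    show "1 / (5 * phi (Wf (real (visits x k a + visits x k b)) / \<eta>)) \<le> 1 / w (visits x k (a + 1))"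
      using main[OF k, of "visits x k (a + 1)"] visits_le_neighbours[OF nn, of k "a + 1"] A1[of k] c1
      by (simp add: m_def bc)
    show "1 / (5 * phi (Wf (real (visits x k a + visits x k b)) / \<eta>)) \<le> 1 / w (visits x k (b - 1))"
      using main[OF k, of "visits x k (b - 1)"] visits_le_neighbours[OF nn, of k "b - 1"] A2[of k] c1
      by (simp add: m_def bc algebra_simps)
  qed
qed

end

section \<open>Confinement near the first arrival at a site\<close>

text \<open>At \<open>s + 1\<close> no initial steps are prescribed.\<close>

definition gate :: "nat \<Rightarrow> int \<Rightarrow> int \<Rightarrow> nat" where
  "gate m s y = (if y = s + 1 then 0 else m)"

text \<open>The four clauses serve, in this order: to turn a gap in \<open>V\<close> into a gap in \<open>w\<close>; to absorb the additive
constants \<open>C\<close> and \<open>1 / w 0\<close> into \<open>V\<close>, \<open>\<ell>\<close> and \<open>W\<close>; to use regular variation for the factor \<open>7/5\<close>;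
and to use that \<open>\<ell>\<close> is monotone.\<close>

definition (in weight_A) large_enough :: "real \<Rightarrow> nat \<Rightarrow> bool" where
  "large_enough C m \<longleftrightarrow>
     (\<forall>b\<ge>m. \<forall>j. V w j \<le> 9/10 * V w b \<longrightarrow>
        w j / w b \<le> 1/128 * ((real b / w b) / (real b / w b + V w j))^2 \<and> 16 * j \<le> b) \<and>
     (\<forall>b\<ge>m. 128 * (C + 1 / w 0) \<le> V w b \<and> 16 * C \<le> real b / w b \<and> 1 / w 0 \<le> Wf (real b)) \<and>
     (\<forall>n\<ge>m. \<forall>z. 7/5 * real n \<le> real z \<longrightarrow> 5/4 * w n \<le> w z) \<and>
     (\<forall>i n. m \<le> i \<longrightarrow> i \<le> n \<longrightarrow> real i / w i \<le> real n / w n)"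

lemma (in weight_A) large_enough_exists: "\<exists>m0. \<forall>m\<ge>m0. large_enough C m"
proof -
  obtain m1 where m1: "\<forall>b\<ge>m1. \<forall>j. V w j \<le> 9/10 * V w b \<longrightarrow>
        w j / w b \<le> 1/128 * ((real b / w b) / (real b / w b + V w j))^2 \<and> 16 * j \<le> b"
    using V_gap_imp_w_gap[of "1/128"] by auto
  obtain m2 where m2: "\<forall>b\<ge>m2. 128 * (C + 1 / w 0) \<le> V w b" using V_eventually_ge by blast
  obtain m3 where m3: "\<forall>b\<ge>m3. 16 * C \<le> real b / w b"
    using ell_at_top unfolding filterlim_at_top eventually_sequentially by blast
  obtain m4 where m4: "\<forall>b\<ge>m4. 2 / w 0 \<le> V w b" using V_eventually_ge by blast
  obtain m5 where m5: "\<forall>n\<ge>m5. \<forall>z. 7/5 * real n \<le> real z \<longrightarrow> 5/4 * w n \<le> w z"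
    using eventually_w_ge[of "7/5" "5/4"] unfolding eventually_sequentially by auto
  obtain m6 where m6: "\<forall>i n. m6 \<le> i \<longrightarrow> i \<le> n \<longrightarrow> real i / w i \<le> real n / w n"
    using ell_eventually_mono by blast
  have m4': "1 / w 0 \<le> Wf (real b)" if "m4 \<le> b" for b
    using m4 that V_le_W[of b] by fastforce
  have "large_enough C m" if "Max {m1,m2,m3,m4,m5,m6} \<le> m" for m
    unfolding large_enough_def using that m1 m2 m3 m4' m5 m6 by auto
  then show ?thesis by blast
qed

text \<open>The part of the path at \<open>s\<close> and to its left is arbitrary. Bounding the net flows from above says that the
path does not go right more than it should.\<close>

locale confinement = weight_A +
  fixes C :: real and m :: nat and s :: int and x :: "nat \<Rightarrow> int" and n :: nat
  assumes large: "large_enough C m" and C0: "0 \<le> C"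
    and nn: "nn_path x n" and start: "x 0 < s"
    and forced: "\<And>k y. k < n \<Longrightarrow> y \<in> {s+2..s+5} \<Longrightarrow> x k = y \<Longrightarrow> visits x k y \<le> m \<Longrightarrow> x (Suc k) = y - 1"
    and net_flow: "\<And>k y. k \<le> n \<Longrightarrow> y \<in> {s+1..s+5} \<Longrightarrow> net_flow w (gate m s y) y k x \<le> C"
    and below7: "\<And>k. k \<le> n \<Longrightarrow> x k \<noteq> s + 7"
begin

lemma w_gap:
  assumes "m \<le> b" "V w j \<le> 9/10 * V w b"
  shows "w j / w b \<le> 1/128 * ((real b / w b) / (real b / w b + V w j))^2" "16 * j \<le> b"
  using large assms unfolding large_enough_def by blast+

lemma recip_w_gap:
  assumes "m \<le> b" "V w j \<le> 9/10 * V w b"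
  shows "1 / w b \<le> 1/128 * (1 / w j)"
proof -
  have "((real b / w b) / (real b / w b + V w j))^2 \<le> 1"
  proof (rule power_le_one)
    have r: "0 \<le> real b / w b" by simp
    show "0 \<le> (real b / w b) / (real b / w b + V w j)"
      by (intro divide_nonneg_nonneg add_nonneg_nonneg r V_nonneg)
    show "(real b / w b) / (real b / w b + V w j) \<le> 1"
      using r V_nonneg[of j] by (intro divide_le_eq_1_pos[THEN iffD2] divide_le_eq_1[THEN iffD2]) linarith
  qed
  then have "w j / w b \<le> 1/128" using w_gap(1)[OF assms] by linarith
  then show ?thesis by (simp add: field_simps)
qed

lemma V_large: "m \<le> b \<Longrightarrow> 128 * (C + 1 / w 0) \<le> V w b"
  and ell_large: "m \<le> b \<Longrightarrow> 16 * C \<le> real b / w b"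
  and W_large: "m \<le> b \<Longrightarrow> 1 / w 0 \<le> Wf (real b)"
  using large unfolding large_enough_def by blast+

lemma ell_mono: "m \<le> i \<Longrightarrow> i \<le> j \<Longrightarrow> real i / w i \<le> real j / w j"
  using large unfolding large_enough_def by blast

lemma w_growth: "m \<le> i \<Longrightarrow> 7/5 * real i \<le> real z \<Longrightarrow> 5/4 * w i \<le> w z"
  using large unfolding large_enough_def by blast

lemma nn_path_upto: "k \<le> n \<Longrightarrow> nn_path x k"
  using nn nn_path_mono by blast

text \<open>The first visit to \<open>y + 1\<close> comes from \<open>y\<close>, and the first \<open>m\<close> steps from \<open>y\<close> go left. So as soon as
\<open>V (Z (y + 1))\<close> is nonzero, \<open>V (Z y)\<close> exceeds all constants that \<open>large_enough\<close> takes care of; this is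
why the estimates below close without additive terms.\<close>

lemma visited_above_imp_gate:
  assumes "y \<in> {s+2..s+5}" "k \<le> n" "0 < visits x k (y + 1)"
  shows "m < visits x k y"
  using assms(2,3)
proof (induction k)
  case 0 then show ?case using assms(1) start by (auto simp: visits_0 split: if_splits)
next
  case (Suc k)
  show ?case
  proof (cases "0 < visits x k (y + 1)")
    case True
    then show ?thesis using Suc visits_mono[of k "Suc k" x y] by auto
  next
    case False
    then have xS: "x (Suc k) = y + 1" using Suc.prems(2) by (auto simp: visits_Suc split: if_splits)
    have "x k = y \<or> x k = y + 2"
      using nn_path_upto[of "Suc k"] Suc.prems(1) xS by (auto simp: nn_path_Suc)
    moreover have "x k \<noteq> y + 2"
    proof
      assume "x k = y + 2"
      then have "\<exists>i\<le>k. x i = y + 1"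
        using visited_below[of x k "y + 1"] nn_path_upto[of k] Suc.prems(1) start assms(1) by auto
      then show False using False by (simp add: visits_pos_iff)
    qed
    ultimately have "x k = y" by simp
    then have "m < visits x k y"
      using forced[of k y] assms(1) Suc.prems(1) xS by (auto simp: not_le[symmetric])
    then show ?thesis using visits_mono[of k "Suc k" x y] by auto
  qed
qed

lemma flow_right_ungated:
  assumes y: "y \<in> {s+1..s+5}" and k: "k \<le> n"
  shows "flow w 0 x k y (y + 1) = flow w (gate m s y) x k y (y + 1)"
proof (cases "y = s + 1")
  case False
  then have y': "y \<in> {s+2..s+5}" using y by auto
  have "m < visits x i y" if "i < k" "x i = y" "x (Suc i) = y + 1" for i
    using forced[of i y] y' that k by (auto simp: not_le[symmetric])
  then show ?thesis unfolding flow_def gate_def using False by (intro sum.cong refl) auto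
qed (simp add: gate_def)

lemma flow_right_le:
  assumes y: "y \<in> {s+1..s+5}" and k: "k \<le> n"
  shows "flow w 0 x k y (y + 1) \<le> flow w (gate m s y) x k y (y - 1) + C"
  using net_flow[OF k y] flow_right_ungated[OF y k] by (simp add: net_flow_def)

lemma V_visits_above:
  assumes "s \<le> y" "k \<le> n"
  shows "V w (visits x k (y + 1)) = flow w 0 x k y (y + 1) + flow w 0 x k (y + 2) (y + 1)"
  using V_visits_eq[OF nn_path_upto[OF assms(2)], of "y + 1"] start assms(1) by (simp add: algebra_simps)

text \<open>The invariant propagated in time. The factor \<open>9/10\<close> is dictated by \<open>y = s + 2\<close>, where the
estimate gives little more than \<open>4/5\<close>; further right the ratio is much smaller, see \<open>strong_decay\<close>.\<close>

definition decay :: "nat \<Rightarrow> bool" where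
  "decay k \<longleftrightarrow> (\<forall>y\<in>{s+2..s+5}. V w (visits x k (y + 1)) \<le> 9/10 * V w (visits x k y))"

lemma departure_bound:
  assumes "y \<in> {s+2..s+5}" "k \<le> n" "decay k" "x k = y + 1"
  shows "m \<le> visits x k y" "V w (visits x k (y + 1)) \<le> 9/10 * V w (visits x k y)"
  using visited_above_imp_gate[of y k] visits_pos[of x k "y + 1"] assms by (auto simp: decay_def)

text \<open>By the invariant, at each departure from \<open>y + 1\<close> the weight of \<open>y\<close> is at least 128 times the weight
of \<open>y + 1\<close>.\<close>

lemma flow_left_le:
  assumes y: "y \<in> {s+2..s+5}" and k: "k \<le> n" and dec: "\<And>i. i < k \<Longrightarrow> decay i"
  shows "flow w g x k (y + 1) y \<le> 1/128 * V w (visits x k (y + 1))"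
proof -
  have "flow w g x k (y + 1) y \<le> (\<Sum>j\<in>{g<..visits x k (y + 1)}. 1/128 * (1 / w j))"
  proof (rule flow_le_sum)
    fix i assume i: "i < k" "x i = y + 1"
    show "1 / w (visits x i y) \<le> 1/128 * (1 / w (visits x i (y + 1)))"
      using i k by (intro recip_w_gap departure_bound[OF y _ dec]) auto
  qed simp
  also have "\<dots> \<le> (\<Sum>j=1..visits x k (y + 1). 1/128 * (1 / w j))" by (intro sum_mono2) auto
  also have "\<dots> = 1/128 * (\<Sum>j=1..visits x k (y + 1). 1 / w j)" by (rule sum_distrib_left[symmetric])
  also have "\<dots> \<le> 1/128 * V w (visits x k (y + 1))" by (intro mult_left_mono sum_recip_le_V) auto
  finally show ?thesis .
qed

lemma V_visits_next_le:
  assumes y: "y \<in> {s+2..s+5}" and k: "k \<le> n" and dec: "\<And>i. i < k \<Longrightarrow> decay i"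
  shows "V w (visits x k (y + 1)) \<le> V w (visits x k y) + 1 / w 0"
proof (cases k)
  case 0
  then show ?thesis using y start V_nonneg[of "visits x 0 y"] by (auto simp: visits_0 add_nonneg_nonneg)
next
  case (Suc i)
  have "V w (visits x i (y + 1)) \<le> 9/10 * V w (visits x i y)" using dec[of i] Suc y by (auto simp: decay_def)
  also have "\<dots> \<le> V w (visits x i y)" by simp
  also have "\<dots> \<le> V w (visits x k y)" using Suc by (intro V_mono visits_mono) simp
  finally have "V w (visits x i (y + 1)) \<le> V w (visits x k y)" .
  moreover have "V w (visits x k (y + 1)) \<le> V w (visits x i (y + 1)) + 1 / w 0"
    using recip_le[of 0 "visits x i (y + 1)"] by (simp add: Suc visits_Suc V_Suc)
  ultimately show ?thesis by linarith
qed

text \<open>The flow into \<open>y + 1\<close> from the right is a small fraction of \<open>V (Z (y + 1))\<close> itself, so it can be absorbed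
on the left-hand side of estimates.\<close>

lemma return_flow_le:
  assumes y: "y \<in> {s+2..s+5}" and k: "k \<le> n" and dec: "\<And>i. i < k \<Longrightarrow> decay i"
  shows "flow w 0 x k (y + 2) (y + 1) \<le> 1/128 * (V w (visits x k (y + 1)) + 1 / w 0)"
proof (cases "y = s + 5")
  case True
  have "x i \<noteq> y + 2" if "i < k" for i
    using below7[of i] that k True by (simp add: algebra_simps)
  then have "flow w 0 x k (y + 2) (y + 1) = 0"
    unfolding flow_def by (intro sum.neutral) auto
  then show ?thesis by simp
next
  case False
  then have y': "y + 1 \<in> {s+2..s+5}" using y by auto
  have "flow w 0 x k (y + 2) (y + 1) \<le> 1/128 * V w (visits x k (y + 2))"
    using flow_left_le[OF y' k dec, of 0] by (simp add: algebra_simps)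
  also have "\<dots> \<le> 1/128 * (V w (visits x k (y + 1)) + 1 / w 0)"
    using V_visits_next_le[OF y' k dec] by (simp add: algebra_simps)
  finally show ?thesis .
qed

lemma V_visits_above_le:
  assumes y: "y \<in> {s+2..s+5}" and k: "k \<le> n" and dec: "\<And>i. i < k \<Longrightarrow> decay i"
  shows "127/128 * V w (visits x k (y + 1)) \<le> flow w m x k y (y - 1) + C + 1 / w 0"
proof -
  have g: "gate m s y = m" using y by (simp add: gate_def)
  have "0 \<le> 1 / w 0" by simp
  moreover have "V w (visits x k (y + 1)) = flow w 0 x k y (y + 1) + flow w 0 x k (y + 2) (y + 1)"
    using y by (intro V_visits_above k) auto
  moreover have "flow w 0 x k y (y + 1) \<le> flow w m x k y (y - 1) + C"
    using y flow_right_le[OF _ k, of y] unfolding g by auto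
  moreover have "flow w 0 x k (y + 2) (y + 1) \<le> 1/128 * (V w (visits x k (y + 1)) + 1 / w 0)"
    by (rule return_flow_le[OF y k dec])
  moreover define e where "e = 1 / w 0"
  ultimately show ?thesis unfolding e_def[symmetric] by (simp add: field_simps)
qed

lemma constants_absorbed:
  assumes y: "y \<in> {s+2..s+5}" and k: "k \<le> n" and "0 < visits x k (y + 1)"
  shows "C + 1 / w 0 \<le> 1/128 * V w (visits x k y)"
  using visited_above_imp_gate[OF assms] V_large[of "visits x k y"] by simp

lemma strong_decay:
  assumes y: "y \<in> {s+3..s+5}" and k: "k \<le> n" and dec: "\<And>i. i < k \<Longrightarrow> decay i"
  shows "V w (visits x k (y + 1)) \<le> 1/32 * V w (visits x k y)"
proof (cases "0 < visits x k (y + 1)")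
  case True
  have y': "y \<in> {s+2..s+5}" "y - 1 \<in> {s+2..s+5}" using y by auto
  have "flow w m x k y (y - 1) \<le> 1/128 * V w (visits x k y)"
    using flow_left_le[OF y'(2) k dec, of m] by simp
  moreover have "127/128 * V w (visits x k (y + 1)) \<le> flow w m x k y (y - 1) + C + 1 / w 0"
    by (rule V_visits_above_le[OF y'(1) k dec])
  ultimately show ?thesis
    using constants_absorbed[OF y'(1) k True] V_nonneg[of "visits x k y"] by linarith
qed simp

text \<open>The sharp form of \<open>flow_left_le\<close> at \<open>s + 3\<close>: with the damping factor of \<open>V_gap_imp_w_gap\<close> the
departures from \<open>s + 3\<close> contribute in total only a fraction of \<open>\<ell> (Z (s + 2))\<close>.\<close>

lemma flow_ell_le:
  assumes k: "k \<le> n" and dec: "\<And>i. i < k \<Longrightarrow> decay i"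
  defines "N \<equiv> visits x k (s + 2)"
  shows "flow w 0 x k (s + 3) (s + 2) \<le> 1/128 * (real N / w N)"
proof -
  define L where "L = real N / w N"
  have L0: "0 \<le> L" by (simp add: L_def)
  have "flow w 0 x k (s + 3) (s + 2) \<le>
      (\<Sum>j\<in>{0<..visits x k (s + 3)}. 1/128 * (1 / w j * (L / (L + V w j))^2))"
  proof (rule flow_le_sum)
    fix i assume i: "i < k" "x i = s + 3"
    define b j where "b = visits x i (s + 2)" and "j = visits x i (s + 3)"
    have d: "m \<le> b" "V w j \<le> 9/10 * V w b"
      using departure_bound[of "s + 2" i] i k dec[of i] by (simp_all add: b_def j_def algebra_simps)
    have j: "0 < V w j" using i by (intro V_pos) (simp add: j_def visits_pos)
    define l where "l = real b / w b"
    have l: "0 \<le> l" "l \<le> L" unfolding l_def L_def N_def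
      using d(1) i(1) visits_mono[of i k x "s+2"] by (auto simp: b_def[symmetric] intro: ell_mono)
    have "l / (l + V w j) \<le> L / (L + V w j)"
      using l j by (simp add: field_simps)
    then have "(l / (l + V w j))^2 \<le> (L / (L + V w j))^2"
      using l j by (intro power_mono) auto
    then have "w j / w b \<le> 1/128 * (L / (L + V w j))^2"
      using w_gap(1)[OF d] by (simp add: l_def)
    then have "w j / w b / w j \<le> 1/128 * (L / (L + V w j))^2 / w j"
      by (rule divide_right_mono) simp
    then show "1 / w (visits x i (s + 2)) \<le> 1/128 * (1 / w (visits x i (s + 3)) * (L / (L + V w (visits x i (s + 3))))^2)"
      by (simp add: b_def[symmetric] j_def[symmetric])
  qed simp
  also have "\<dots> = 1/128 * (\<Sum>j=1..visits x k (s + 3). 1 / w j * (L / (L + V w j))^2)"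
    by (subst sum_distrib_left) (intro sum.cong, auto)
  also have "\<dots> \<le> 1/128 * L" by (intro mult_left_mono sum_damped_recip_le L0) auto
  finally show ?thesis by (simp add: L_def)
qed

text \<open>By balance at \<open>s + 1\<close>, the sum \<open>V (Z (s + 2))\<close> exceeds \<open>V l\<close>, with \<open>l\<close> the number of crossings from
\<open>s + 1\<close> to \<open>s\<close>, by less than half of \<open>\<ell> (Z (s + 2))\<close>; so \<open>l > Z (s + 2) / 2\<close>. Besides these crossings,
\<open>s + 1\<close> has one visit for each crossing to \<open>s + 2\<close>, and those make up nearly all of \<open>Z (s + 2)\<close>.\<close>

lemma visits_s1_ge:
  assumes k: "k \<le> n" and dec: "\<And>i. i \<le> k \<Longrightarrow> decay i" and N: "m < visits x k (s + 2)"
  shows "7/5 * real (visits x k (s + 2)) \<le> real (visits x k (s + 1))"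
proof -
  define N where "N = visits x k (s + 2)"
  define l where "l = crossings x k (s + 1) s"
  define L where "L = real N / w N"
  have L: "0 < L" "16 * C \<le> L" using ell_large[of N] N by (auto simp: L_def N_def)
  have "V w N = flow w 0 x k (s + 1) (s + 2) + flow w 0 x k (s + 3) (s + 2)"
    using V_visits_above[of "s + 1" k] k by (simp add: N_def algebra_simps)
  also have "flow w 0 x k (s + 1) (s + 2) \<le> flow w 0 x k (s + 1) s + C"
    using flow_right_le[of "s + 1" k] k by (simp add: gate_def algebra_simps)
  also have "flow w 0 x k (s + 1) s \<le> V w l" unfolding l_def by (rule flow_le_V_crossings)
  also have "flow w 0 x k (s + 3) (s + 2) \<le> 1/128 * L"
    unfolding L_def N_def using k dec by (intro flow_ell_le) auto
  finally have VN: "V w N - V w l < 1/2 * L" using L by simp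
  have lN: "real N < 2 * real l"
  proof (rule ccontr)
    assume n: "\<not> real N < 2 * real l"
    then have "l \<le> N" by simp
    have "1/2 * L = (real N / 2) / w N" by (simp add: L_def)
    also have "\<dots> \<le> (real N - real l) / w N" using n by (intro divide_right_mono) auto
    also have "\<dots> \<le> V w N - V w l" by (rule V_diff_ge[OF \<open>l \<le> N\<close>])
    finally show False using VN by simp
  qed
  have "V w (visits x k (s + 3)) \<le> 9/10 * V w N"
    using dec[of k] by (auto simp: decay_def N_def algebra_simps dest!: bspec[of _ _ "s + 2"])
  then have z3: "16 * visits x k (s + 3) \<le> N" using w_gap(2)[of N] N by (simp add: N_def)
  have "N = crossings x k (s + 1) (s + 2) + crossings x k (s + 3) (s + 2)"
    using visits_eq_crossings[OF nn_path_upto[OF k], of "s + 2"] start by (simp add: N_def algebra_simps)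
  moreover have "crossings x k (s + 3) (s + 2) \<le> visits x k (s + 3)"
    using crossings_le_visits_from[of "s+2" "s+4" x k "s+3"] by linarith
  moreover have "l + crossings x k (s + 1) (s + 2) \<le> visits x k (s + 1)"
    unfolding l_def by (rule crossings_le_visits_from) auto
  ultimately show ?thesis using lN z3 unfolding N_def[symmetric] by linarith
qed

text \<open>Induction on time: the flows up to time \<open>k\<close> only involve the invariant at earlier times. For \<open>y = s + 2\<close>,
a departure from \<open>s + 2\<close> sees at least \<open>7/5\<close> times as many visits at \<open>s + 1\<close>, so that the leftward
flow is at most \<open>4/5\<close> of \<open>V (Z (s + 2))\<close>.\<close>

lemma decay_all: "k \<le> n \<Longrightarrow> decay k"
proof (induction k rule: less_induct)
  case (less k)
  have dec: "\<And>i. i < k \<Longrightarrow> decay i" using less by auto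
  have "V w (visits x k (y + 1)) \<le> 9/10 * V w (visits x k y)" if y: "y \<in> {s+2..s+5}" for y
  proof (cases "y = s + 2")
    case False
    then have "V w (visits x k (y + 1)) \<le> 1/32 * V w (visits x k y)"
      using y less.prems dec by (intro strong_decay) auto
    then show ?thesis using V_nonneg[of "visits x k y"] by linarith
  next
    case True
    show ?thesis
    proof (cases "0 < visits x k (y + 1)")
      case visited: True
      have "flow w m x k (s + 2) (s + 1) \<le> (\<Sum>j\<in>{m<..visits x k (s + 2)}. 4/5 * (1 / w j))"
      proof (rule flow_le_sum)
        fix i assume i: "i < k" "m < visits x i (s + 2)"
        have "7/5 * real (visits x i (s + 2)) \<le> real (visits x i (s + 1))"
          using i less.prems by (intro visits_s1_ge dec) auto
        then have "5/4 * w (visits x i (s + 2)) \<le> w (visits x i (s + 1))"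
          using i by (intro w_growth) auto
        then show "1 / w (visits x i (s + 1)) \<le> 4/5 * (1 / w (visits x i (s + 2)))"
          by (simp add: field_simps)
      qed simp
      also have "\<dots> \<le> (\<Sum>j=1..visits x k (s + 2). 4/5 * (1 / w j))" by (intro sum_mono2) auto
      also have "\<dots> = 4/5 * (\<Sum>j=1..visits x k (s + 2). 1 / w j)" by (rule sum_distrib_left[symmetric])
      also have "\<dots> \<le> 4/5 * V w (visits x k (s + 2))" by (intro mult_left_mono sum_recip_le_V) auto
      finally have "flow w m x k y (y - 1) \<le> 4/5 * V w (visits x k y)" by (simp add: True algebra_simps)
      moreover have "127/128 * V w (visits x k (y + 1)) \<le> flow w m x k y (y - 1) + C + 1 / w 0"
        by (rule V_visits_above_le[OF y less.prems dec])
      ultimately show ?thesis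
        using constants_absorbed[OF y less.prems visited]
          V_nonneg[of "visits x k y"] by linarith
    qed simp
  qed
  then show ?case unfolding decay_def by blast
qed

abbreviation A16 :: "nat \<Rightarrow> real" where "A16 i \<equiv> G_scaled (1/16) (real i)"

lemma A16_nonneg: "0 \<le> A16 i"
  using G_scaled_mono[of "1/16" 0 "real i"] by simp

text \<open>At each departure from \<open>s + 4\<close> one has \<open>W (Z (s + 3)) \<ge> 16 * W (Z (s + 4))\<close>, so the leftward flow from
\<open>s + 4\<close> is bounded by the sum that \<open>sum_le_G_scaled\<close> compares with \<open>G (Id / 16)\<close>.\<close>

lemma V_visits_s5_le:
  assumes k: "k \<le> n"
  shows "V w (visits x k (s + 5)) \<le> A16 (visits x k (s + 4)) / 8 + 2 * (C + 1 / w 0)"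
proof -
  have dec: "decay i" if "i < k" for i using that k by (intro decay_all) auto
  have W4: "16 * Wf (real (visits x i (s + 4))) \<le> Wf (real (visits x i (s + 3)))" if i: "i \<le> k" for i
  proof (cases "0 < visits x i (s + 4)")
    case True
    have i': "i \<le> n" using i k by simp
    have "m < visits x i (s + 3)" using visited_above_imp_gate[of "s+3" i] True i' by (simp add: algebra_simps)
    then have "V w (visits x i (s + 3)) \<le> 2 * Wf (real (visits x i (s + 3)))"
      using V_le_W[of "visits x i (s + 3)"] W_large[of "visits x i (s + 3)"] by simp
    moreover have "V w (visits x i (s + 4)) \<le> 1/32 * V w (visits x i (s + 3))"
      using strong_decay[of "s + 3" i] i' decay_all by (simp add: algebra_simps)
    ultimately show ?thesis using W_le_V[of "visits x i (s + 4)"] by linarith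
  qed (simp add: W_nonneg)
  have "flow w m x k (s + 4) (s + 3) \<le>
      (\<Sum>j\<in>{m<..visits x k (s + 4)}. 1 / phi (Wf (real j) / (1/16)))"
  proof (rule flow_le_sum)
    show "0 \<le> 1 / phi (Wf (real j) / (1/16))" for j
      using phi_W_div_pos[of "1/16" "real j"] by simp
  next
    fix i assume i: "i < k" "m < visits x i (s + 4)"
    have "phi (Wf (real (visits x i (s + 4))) / (1/16)) \<le> phi (Wf (real (visits x i (s + 3))))"
      using W4[of i] i by (intro phi_mono divide_nonneg_nonneg W_nonneg) auto
    then show "1 / w (visits x i (s + 3)) \<le> 1 / phi (Wf (real (visits x i (s + 4))) / (1/16))"
      using phi_W_div_pos[of "1/16" "real (visits x i (s + 4))"] by (intro frac_le) auto
  qed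
  also have "\<dots> \<le> (\<Sum>j=1..visits x k (s + 4). 1 / phi (Wf (real j) / (1/16)))"
    using phi_W_div_pos[of "1/16"] by (intro sum_mono2) (auto intro: less_imp_le)
  also have "\<dots> \<le> 1/16 * A16 (visits x k (s + 4))" by (rule sum_le_G_scaled) simp
  finally have "flow w m x k (s + 4) (s + 4 - 1) \<le> 1/16 * A16 (visits x k (s + 4))" by (simp add: algebra_simps)
  then have "127/128 * V w (visits x k (s + 5)) \<le> 1/16 * A16 (visits x k (s + 4)) + C + 1 / w 0"
    using V_visits_above_le[of "s + 4" k] k dec by (simp add: algebra_simps)
  moreover have "0 \<le> C + 1 / w 0" using C0 by (simp add: add_nonneg_nonneg)
  moreover define e where "e = 1 / w 0"
  ultimately show ?thesis
    using A16_nonneg[of "visits x k (s + 4)"] unfolding e_def[symmetric] by (simp add: field_simps)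
qed

lemma V_visits_s6_le:
  assumes k: "k \<le> n"
  shows "V w (visits x k (s + 6)) \<le> flow w m x k (s + 5) (s + 4) + C"
proof -
  have "flow w 0 x k (s + 7) (s + 6) = 0"
    unfolding flow_def using below7 k by (intro sum.neutral) auto
  then have "V w (visits x k (s + 6)) = flow w 0 x k (s + 5) (s + 6)"
    using V_visits_above[of "s + 5" k] k by (simp add: algebra_simps)
  then show ?thesis using flow_right_le[of "s + 5" k] k by (simp add: gate_def algebra_simps)
qed

end

context weight_A
begin

text \<open>If \<open>G (Id / 16)\<close> is bounded, then so is \<open>V (Z (s + 5))\<close> by \<open>V_visits_s5_le\<close>, and \<open>Z (s + 6)\<close> is
controlled by the number of departures from \<open>s + 5\<close>. Otherwise the additive constants can be absorbed for
large \<open>m\<close>, and \<open>W (Z (s + 5)) \<le> G_scaled (1/16) (Z (s + 4))\<close> holds at all times; now the flow from \<open>s + 5\<close>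
to \<open>s + 4\<close> is summed by means of \<open>bounded_second_iterate_imp_majorant\<close>.\<close>

lemma confinement_bound:
  assumes b: "bounded (g16 ` {0..}) \<or> bounded (G w g16 ` {0..})" and C0: "0 \<le> C"
  shows "\<exists>m B. large_enough C m \<and> (\<forall>s x n. confinement w C m s x n \<longrightarrow> visits x n (s + 6) \<le> B)"
proof -
  obtain m0 where m0: "\<And>m. m0 \<le> m \<Longrightarrow> large_enough C m" using large_enough_exists by blast
  show ?thesis
  proof (cases "bounded (g16 ` {0..})")
    case True
    then obtain A where A: "\<And>t. 0 \<le> t \<Longrightarrow> g16 t \<le> A"
      using bounded_image_iff[OF admissible_G[OF admissible_linear[of "1/16"]]] by auto
    have A': "G_scaled (1/16) (real i) \<le> A" for i
      unfolding G_scaled_def by (intro A divide_nonneg_nonneg W_nonneg) auto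
    obtain B5 where B5: "\<And>i. V w i \<le> A / 8 + 2 * (C + 1 / w 0) \<Longrightarrow> i \<le> B5" using V_bounded_imp by blast
    obtain B6 where B6: "\<And>i. V w i \<le> real B5 / w 0 + C \<Longrightarrow> i \<le> B6" using V_bounded_imp by blast
    have "visits x n (s + 6) \<le> B6" if "confinement w C m0 s x n" for s x n
    proof -
      interpret confinement w C m0 s x n by (rule that)
      have "V w (visits x n (s + 5)) \<le> A / 8 + 2 * (C + 1 / w 0)"
        using V_visits_s5_le[of n] A'[of "visits x n (s + 4)"] by simp
      then have "visits x n (s + 5) \<le> B5" by (rule B5)
      then have "real (visits x n (s + 5)) / w 0 \<le> real B5 / w 0" by (intro divide_right_mono) auto
      then show ?thesis
        using V_visits_s6_le[of n] flow_le_visits_from[of m0 x n "s+5" "s+4"] by (intro B6) simp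
    qed
    then show ?thesis using m0 by blast
  next
    case False
    then have b2: "bounded (G w g16 ` {0..})" using b by blast
    obtain \<theta> B where \<theta>: "\<And>j. 0 \<le> \<theta> j" "\<And>n. (\<Sum>j=1..n. \<theta> j) \<le> B"
        "\<And>j n. Wf (real j) \<le> G_scaled (1/16) (real n) \<Longrightarrow> 1 / w n \<le> \<theta> j"
      using bounded_second_iterate_imp_majorant[of "1/16", OF _ b2 False] by auto
    obtain m1 where m1: "4 * (C + 1 / w 0) \<le> G_scaled (1/16) (real m1)"
      using G_scaled_bounded_imp[of "1/16" "4 * (C + 1 / w 0)"] False by (meson le_cases zero_less_divide_1_iff zero_less_numeral)
    obtain B6 where B6: "\<And>i. V w i \<le> B + C \<Longrightarrow> i \<le> B6" using V_bounded_imp by blast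
    define m where "m = max m0 m1"
    have "visits x n (s + 6) \<le> B6" if "confinement w C m s x n" for s x n
    proof -
      interpret confinement w C m s x n by (rule that)
      have W5: "Wf (real (visits x k (s + 5))) \<le> A16 (visits x k (s + 4))" if k: "k \<le> n" for k
      proof (cases "0 < visits x k (s + 5)")
        case True
        then have "m < visits x k (s + 4)"
          using visited_above_imp_gate[of "s+4" k] k by (simp add: algebra_simps)
        then have "A16 m1 \<le> A16 (visits x k (s + 4))" by (intro G_scaled_mono) (auto simp: m_def)
        then have "2 * (C + 1 / w 0) \<le> A16 (visits x k (s + 4)) / 2" using m1 by linarith
        then have "V w (visits x k (s + 5)) \<le> A16 (visits x k (s + 4))"
          using V_visits_s5_le[OF k] A16_nonneg[of "visits x k (s + 4)"] by linarith
        then show ?thesis using W_le_V[of "visits x k (s + 5)"] by linarith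
      qed (simp add: A16_nonneg)
      have "flow w m x n (s + 5) (s + 4) \<le> (\<Sum>j\<in>{m<..visits x n (s + 5)}. \<theta> j)"
      proof (rule flow_le_sum[OF \<theta>(1)])
        fix i assume "i < n"
        then show "1 / w (visits x i (s + 4)) \<le> \<theta> (visits x i (s + 5))" by (intro \<theta>(3) W5) simp
      qed
      also have "\<dots> \<le> (\<Sum>j=1..visits x n (s + 5). \<theta> j)" by (intro sum_mono2 \<theta>(1)) auto
      also have "\<dots> \<le> B" by (rule \<theta>(2))
      finally show ?thesis using V_visits_s6_le[of n] by (intro B6) simp
    qed
    moreover have "large_enough C m" by (rule m0) (simp add: m_def)
    ultimately show ?thesis by blast
  qed
qed

end

section \<open>Histories and their law\<close>

definition extend :: "(nat \<Rightarrow> int) \<Rightarrow> nat \<Rightarrow> int \<Rightarrow> nat \<Rightarrow> int" where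
  "extend h n d = h(Suc n := h n + d)"

lemma extend_le [simp]: "k \<le> n \<Longrightarrow> extend h n d k = h k"
  and extend_Suc [simp]: "extend h n d (Suc n) = h n + d"
  and extend_after [simp]: "Suc n < k \<Longrightarrow> extend h n d k = h k"
  by (auto simp: extend_def)

text \<open>Histories are 0 after time \<open>n\<close>, so that distinct elements of this finite set differ before or at time \<open>n\<close>
and expectations of functionals of the history become finite sums.\<close>

primrec histories :: "nat \<Rightarrow> (nat \<Rightarrow> int) set" where
  "histories 0 = {\<lambda>_. 0}"
| "histories (Suc n) = (\<lambda>(h, d). extend h n d) ` (histories n \<times> {-1, 1})"

lemma finite_histories: "finite (histories n)"
  by (induction n) auto

lemma histories_zero_after: "h \<in> histories n \<Longrightarrow> n < k \<Longrightarrow> h k = 0"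
  by (induction n arbitrary: h) fastforce+

lemma histories_start: "h \<in> histories n \<Longrightarrow> h 0 = 0"
  by (induction n arbitrary: h) fastforce+

lemma nn_path_cong: "(\<And>k. k \<le> n \<Longrightarrow> x k = x' k) \<Longrightarrow> nn_path x n = nn_path x' n"
  unfolding nn_path_def by (intro all_cong imp_cong refl) auto

lemma histories_nn_path: "h \<in> histories n \<Longrightarrow> nn_path h n"
proof (induction n arbitrary: h)
  case 0 then show ?case by (simp add: nn_path_def)
next
  case (Suc n)
  then obtain h' d where h: "h' \<in> histories n" "d = -1 \<or> d = 1" "h = extend h' n d" by auto
  have "nn_path h n = nn_path h' n" by (rule nn_path_cong) (simp add: h)
  moreover have "h n = h' n" "h (Suc n) = h' n + d" by (simp_all add: h)
  ultimately show ?case using Suc.IH[OF h(1)] h(2) by (auto simp: nn_path_Suc)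
qed

lemma histories_eqI: "h \<in> histories n \<Longrightarrow> h' \<in> histories n \<Longrightarrow> (\<And>k. k \<le> n \<Longrightarrow> h k = h' k) \<Longrightarrow> h = h'"
  using histories_zero_after by (metis ext not_le)

lemma sum_histories_Suc:
  fixes f :: "(nat \<Rightarrow> int) \<Rightarrow> real"
  shows "(\<Sum>h\<in>histories (Suc n). f h) = (\<Sum>h\<in>histories n. f (extend h n (-1)) + f (extend h n 1))"
proof -
  have inj: "inj_on (\<lambda>(h, d). extend h n d) (histories n \<times> {-1, 1})"
  proof (rule inj_onI, clarify)
    fix h d h' d'
    assume h: "h \<in> histories n" "h' \<in> histories n" and e: "extend h n d = extend h' n d'"
    have "h k = h' k" if "k \<le> n" for k
      using fun_cong[OF e, of k] that by simp
    then have "h = h'" using h histories_eqI by blast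
    then show "h = h' \<and> d = d'" using fun_cong[OF e, of "Suc n"] by simp
  qed
  have "(\<Sum>h\<in>histories (Suc n). f h) = (\<Sum>(h, d)\<in>histories n \<times> {-1, 1}. f (extend h n d))"
    unfolding histories.simps by (subst sum.reindex[OF inj]) (simp add: case_prod_unfold)
  also have "\<dots> = (\<Sum>h\<in>histories n. \<Sum>d\<in>{-1,1::int}. f (extend h n d))"
    by (rule sum.cartesian_product[symmetric])
  finally show ?thesis by simp
qed

definition adapted :: "(nat \<Rightarrow> (nat \<Rightarrow> int) \<Rightarrow> 'b) \<Rightarrow> bool" where
  "adapted F \<longleftrightarrow> (\<forall>n x x'. (\<forall>k\<le>n. x k = x' k) \<longrightarrow> F n x = F n x')"

lemma adaptedD: "adapted F \<Longrightarrow> (\<And>k. k \<le> n \<Longrightarrow> x k = x' k) \<Longrightarrow> F n x = F n x'"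
  by (simp add: adapted_def)

lemma adapted_extend: "adapted F \<Longrightarrow> k \<le> n \<Longrightarrow> F k (extend h n d) = F k h"
  unfolding adapted_def by (metis extend_le order_trans)

context vrrw
begin

definition cylinder :: "nat \<Rightarrow> (nat \<Rightarrow> int) \<Rightarrow> 'a set" where
  "cylinder n h = {\<omega> \<in> space M. \<forall>i\<le>n. X i \<omega> = h i}"

lemma sets_cylinder [measurable, simp]: "cylinder n h \<in> sets M"
proof -
  have "cylinder n h = (\<Inter>i\<in>{..n}. X i -` {h i} \<inter> space M)" by (auto simp: cylinder_def)
  also have "\<dots> \<in> sets M" by (intro sets.finite_INT) (auto intro: measurable_sets[OF X_measurable])
  finally show ?thesis .
qed

lemma left_prob_bounds: "0 < left_prob w x n" "left_prob w x n < 1"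
  unfolding left_prob_def using weight_pos by (auto intro!: divide_pos_pos add_pos_pos simp: add_pos_pos)

lemma prob_cylinder_extend:
  "prob (cylinder (Suc n) (extend h n (-1))) = prob (cylinder n h) * left_prob w h n"
  "prob (cylinder (Suc n) (extend h n 1)) = prob (cylinder n h) * (1 - left_prob w h n)"
proof -
  have e: "{\<omega> \<in> space M. X (Suc n) \<omega> = X n \<omega> + d \<and> (\<forall>i\<le>n. X i \<omega> = h i)} = cylinder (Suc n) (extend h n d)" for d
    unfolding cylinder_def by (auto simp: le_Suc_eq)
  have sub: "cylinder (Suc n) (extend h n d) \<subseteq> cylinder n h" for d
    unfolding e[symmetric] by (auto simp: cylinder_def)
  have c: "{\<omega> \<in> space M. \<forall>i\<le>n. X i \<omega> = h i} = cylinder n h" by (simp add: cylinder_def)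
  show "prob (cylinder (Suc n) (extend h n (-1))) = prob (cylinder n h) * left_prob w h n"
    "prob (cylinder (Suc n) (extend h n 1)) = prob (cylinder n h) * (1 - left_prob w h n)"
  proof (atomize (full), cases "prob (cylinder n h) = 0")
    case True
    have "prob (cylinder (Suc n) (extend h n d)) = 0" for d
      using finite_measure_mono[OF sub[of d]] True by (simp add: measure_le_0_iff)
    then show "prob (cylinder (Suc n) (extend h n (-1))) = prob (cylinder n h) * left_prob w h n \<and>
      prob (cylinder (Suc n) (extend h n 1)) = prob (cylinder n h) * (1 - left_prob w h n)"
      using True by simp
  next
    case False
    then have p: "0 < prob {\<omega> \<in> space M. \<forall>i\<le>n. X i \<omega> = h i}" unfolding c using zero_less_measure_iff by blast
    have e': "{\<omega> \<in> space M. X (Suc n) \<omega> = X n \<omega> - 1 \<and> (\<forall>i\<le>n. X i \<omega> = h i)} = cylinder (Suc n) (extend h n (-1))"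
      using e[of "-1"] by simp
    show "prob (cylinder (Suc n) (extend h n (-1))) = prob (cylinder n h) * left_prob w h n \<and>
      prob (cylinder (Suc n) (extend h n 1)) = prob (cylinder n h) * (1 - left_prob w h n)"
      using step_left[OF p] step_right[OF p] False
      unfolding cond_prob_def c e[of 1] e' by (simp add: field_simps)
  qed
qed

text \<open>The expectation of \<open>F n\<close> on the history of the walk up to time \<open>n\<close>.\<close>

definition mean :: "nat \<Rightarrow> (nat \<Rightarrow> (nat \<Rightarrow> int) \<Rightarrow> real) \<Rightarrow> real" where
  "mean n F = (\<Sum>h\<in>histories n. prob (cylinder n h) * F n h)"

lemma mean_0: "mean 0 F = F 0 (\<lambda>_. 0)"
proof -
  have "prob (cylinder 0 (\<lambda>_. 0)) = 1"
  proof (subst prob_eq_1[OF sets_cylinder])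
    show "AE \<omega> in M. \<omega> \<in> cylinder 0 (\<lambda>_. 0)"
      using X_0 AE_space by eventually_elim (simp add: cylinder_def)
  qed
  then show ?thesis by (simp add: mean_def)
qed

lemma mean_Suc: "mean (Suc n) F = (\<Sum>h\<in>histories n. prob (cylinder n h) *
    (left_prob w h n * F (Suc n) (extend h n (-1)) + (1 - left_prob w h n) * F (Suc n) (extend h n 1)))"
  unfolding mean_def by (subst sum_histories_Suc) (simp add: prob_cylinder_extend algebra_simps)

lemma mean_mono: "(\<And>h. h \<in> histories n \<Longrightarrow> F n h \<le> F' n h) \<Longrightarrow> mean n F \<le> mean n F'"
  unfolding mean_def by (intro sum_mono mult_left_mono) auto

lemma mean_supermartingale:
  assumes "\<And>n h. h \<in> histories n \<Longrightarrow>
    left_prob w h n * F (Suc n) (extend h n (-1)) + (1 - left_prob w h n) * F (Suc n) (extend h n 1) \<le> F n h"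
  shows "mean n F \<le> F 0 (\<lambda>_. 0)"
proof (induction n)
  case 0 then show ?case by (simp add: mean_0)
next
  case (Suc n)
  have "mean (Suc n) F \<le> mean n F"
    unfolding mean_Suc unfolding mean_def by (intro sum_mono mult_left_mono assms) auto
  then show ?case using Suc by simp
qed

lemma mean_one: "mean n (\<lambda>_ _. 1) = 1"
proof (induction n)
  case (Suc n) then show ?case by (simp add: mean_Suc) (simp add: mean_def)
qed (simp add: mean_0)

definition hist_prob :: "nat \<Rightarrow> (nat \<Rightarrow> (nat \<Rightarrow> int) \<Rightarrow> bool) \<Rightarrow> real" where
  "hist_prob n B = mean n (\<lambda>n h. if B n h then 1 else 0)"

definition hist_event :: "nat \<Rightarrow> (nat \<Rightarrow> (nat \<Rightarrow> int) \<Rightarrow> bool) \<Rightarrow> 'a set" where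
  "hist_event n B = (\<Union>h\<in>{h\<in>histories n. B n h}. cylinder n h)"

lemma sets_hist_event [measurable, simp]: "hist_event n B \<in> sets M"
  unfolding hist_event_def using finite_histories by (intro sets.finite_UN) auto

lemma prob_hist_event: "prob (hist_event n B) = hist_prob n B"
proof -
  have "disjoint_family_on (cylinder n) {h\<in>histories n. B n h}"
  proof (unfold disjoint_family_on_def, intro ballI impI, rule ccontr)
    fix h h' assume h: "h \<in> {h\<in>histories n. B n h}" "h' \<in> {h\<in>histories n. B n h}" "h \<noteq> h'"
      and "cylinder n h \<inter> cylinder n h' \<noteq> {}"
    then obtain \<omega> where "\<omega> \<in> cylinder n h" "\<omega> \<in> cylinder n h'" by blast
    then have "\<And>k. k \<le> n \<Longrightarrow> h k = h' k" by (auto simp: cylinder_def)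
    then show False using h histories_eqI[of h n h'] by auto
  qed
  then have "prob (hist_event n B) = (\<Sum>h\<in>{h\<in>histories n. B n h}. prob (cylinder n h))"
    unfolding hist_event_def using finite_histories by (intro finite_measure_finite_Union) auto
  also have "\<dots> = hist_prob n B" unfolding hist_prob_def mean_def
    by (subst sum.inter_filter[OF finite_histories]) (intro sum.cong, auto)
  finally show ?thesis .
qed

lemma AE_history: "AE \<omega> in M. \<forall>n. \<exists>h\<in>histories n. \<forall>i\<le>n. X i \<omega> = h i"
proof (subst AE_all_countable, intro allI)
  fix n
  have "prob (hist_event n (\<lambda>_ _. True)) = 1" unfolding prob_hist_event hist_prob_def by (simp add: mean_one)
  then have "AE \<omega> in M. \<omega> \<in> hist_event n (\<lambda>_ _. True)" by (simp add: prob_eq_1)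
  then show "AE \<omega> in M. \<exists>h\<in>histories n. \<forall>i\<le>n. X i \<omega> = h i"
    by (rule AE_mp) (auto simp: hist_event_def cylinder_def intro!: AE_I2)
qed

lemma AE_nn_path: "AE \<omega> in M. X 0 \<omega> = 0 \<and> (\<forall>n. nn_path (\<lambda>i. X i \<omega>) n)"
  using AE_history
proof eventually_elim
  case (elim \<omega>)
  have "nn_path (\<lambda>i. X i \<omega>) n" for n
  proof -
    obtain h where h: "h \<in> histories n" "\<forall>i\<le>n. X i \<omega> = h i" using elim by blast
    then have "nn_path (\<lambda>i. X i \<omega>) n = nn_path h n" by (intro nn_path_cong) auto
    then show ?thesis using histories_nn_path[OF h(1)] by simp
  qed
  moreover have "X 0 \<omega> = 0" using elim[rule_format, of 0] by auto
  ultimately show ?case by blast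
qed

text \<open>Continuity from below. The event itself is only covered almost surely by the union of the cylinders,
namely on the trajectories that are nearest-neighbour paths from 0.\<close>

lemma eventual_event_bound:
  assumes ad: "adapted B" and mono: "\<And>n x. B n x \<Longrightarrow> B (Suc n) x" and c: "\<And>n. hist_prob n B \<le> c"
  shows "\<exists>A\<in>sets M. prob A \<le> c \<and> (AE \<omega> in M. (\<exists>n. B n (\<lambda>i. X i \<omega>)) \<longrightarrow> \<omega> \<in> A)"
proof -
  define E where "E n = (\<Union>k\<le>n. hist_event k B)" for n
  have "prob (E n) \<le> c" for n
  proof -
    have "AE \<omega> in M. \<omega> \<in> E n \<longrightarrow> \<omega> \<in> hist_event n B"
      using AE_history AE_space
    proof eventually_elim
      case (elim \<omega>)
      show ?case
      proof
        assume "\<omega> \<in> E n"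
        then obtain k h where k: "k \<le> n" "h \<in> histories k" "B k h" "\<forall>i\<le>k. X i \<omega> = h i"
          by (auto simp: E_def hist_event_def cylinder_def)
        obtain h' where h': "h' \<in> histories n" "\<forall>i\<le>n. X i \<omega> = h' i" using elim by blast
        have "B k h'" using ad k h' unfolding adapted_def by (metis order_trans)
        then have "B (k + i) h'" for i using mono by (induction i) auto
        from this[of "n - k"] have "B n h'" using k(1) by simp
        then show "\<omega> \<in> hist_event n B" using h' elim by (auto simp: hist_event_def cylinder_def)
      qed
    qed
    then have "prob (E n) \<le> prob (hist_event n B)"
      by (intro finite_measure_mono_AE) auto
    then show ?thesis using c[of n] by (simp add: prob_hist_event)
  qed
  moreover have "(\<lambda>n. prob (E n)) \<longlonglongrightarrow> prob (\<Union>n. E n)"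
  proof (rule finite_Lim_measure_incseq)
    show "range E \<subseteq> sets M" by (auto simp: E_def)
    show "incseq E" unfolding E_def incseq_def by (intro allI impI UN_mono) auto
  qed
  ultimately have "prob (\<Union>n. E n) \<le> c" by (intro LIMSEQ_le_const2) auto
  moreover have "AE \<omega> in M. (\<exists>n. B n (\<lambda>i. X i \<omega>)) \<longrightarrow> \<omega> \<in> (\<Union>n. E n)"
    using AE_history AE_space
  proof eventually_elim
    case (elim \<omega>)
    show ?case
    proof
      assume "\<exists>n. B n (\<lambda>i. X i \<omega>)"
      then obtain n where n: "B n (\<lambda>i. X i \<omega>)" by blast
      obtain h where h: "h \<in> histories n" "\<forall>i\<le>n. X i \<omega> = h i" using elim by blast
      have "B n h" using ad n h(2) unfolding adapted_def by metis
      then show "\<omega> \<in> (\<Union>n. E n)" using h elim by (auto simp: E_def hist_event_def cylinder_def)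
    qed
  qed
  moreover have "(\<Union>n. E n) \<in> sets M" unfolding E_def by auto
  ultimately show ?thesis by blast
qed

lemma AE_not_eventual:
  assumes ad: "\<And>j::nat. adapted (B j)" and mono: "\<And>j n x. B j n x \<Longrightarrow> B j (Suc n) x"
    and c: "\<And>j n. hist_prob n (B j) \<le> c j" and lim: "c \<longlonglongrightarrow> 0"
  shows "AE \<omega> in M. \<exists>j. \<forall>n. \<not> B j n (\<lambda>i. X i \<omega>)"
proof -
  have "\<forall>j. \<exists>A. A \<in> sets M \<and> prob A \<le> c j \<and> (AE \<omega> in M. (\<exists>n. B j n (\<lambda>i. X i \<omega>)) \<longrightarrow> \<omega> \<in> A)"
    using eventual_event_bound[OF ad mono c] by blast
  then obtain A where A: "\<And>j. A j \<in> sets M" "\<And>j. prob (A j) \<le> c j"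
      "\<And>j. AE \<omega> in M. (\<exists>n. B j n (\<lambda>i. X i \<omega>)) \<longrightarrow> \<omega> \<in> A j" by metis
  have "prob (\<Inter>j. A j) \<le> c j" for j
    using finite_measure_mono[of "\<Inter>j. A j" "A j"] A(1,2) by (meson INF_lower UNIV_I order_trans)
  then have "prob (\<Inter>j. A j) \<le> 0" by (intro LIMSEQ_le_const[OF lim]) auto
  then have "prob (\<Inter>j. A j) = 0" by (simp add: measure_le_0_iff)
  moreover have "(\<Inter>j. A j) \<in> sets M" using A(1) by auto
  ultimately have "AE \<omega> in M. \<omega> \<notin> (\<Inter>j. A j)" using prob_eq_0 by blast
  moreover have "AE \<omega> in M. \<forall>j. (\<exists>n. B j n (\<lambda>i. X i \<omega>)) \<longrightarrow> \<omega> \<in> A j"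
    using A(3) by (simp add: AE_all_countable)
  ultimately show ?thesis by eventually_elim blast
qed

text \<open>This turns the upper bound on the range into a lower bound.\<close>

lemma reflected_vrrw: "vrrw M w (\<lambda>n \<omega>. - X n \<omega>)"
proof -
  have v: "visits (\<lambda>i. - x i) n y = visits x n (- y)" for x n y
    unfolding visits_def by (intro arg_cong[of _ _ card]) auto
  have lp: "left_prob w (\<lambda>i. - x i) n = 1 - left_prob w x n" for x n
    using weight_pos[of "visits x n (x n - 1)"] weight_pos[of "visits x n (x n + 1)"]
    by (simp add: left_prob_def v field_simps)
  have eq: "(- X i \<omega> = x i) = (X i \<omega> = - x i)" for i \<omega> and x :: "nat \<Rightarrow> int" by auto
  show ?thesis
  proof
    show "0 < w n" for n by (rule weight_pos)
    show "(\<lambda>\<omega>. - X n \<omega>) \<in> M \<rightarrow>\<^sub>M count_space UNIV" for n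
      using X_measurable[of n] by (rule measurable_compose) simp
    show "AE \<omega> in M. - X 0 \<omega> = 0" using X_0 by simp
  next
    fix n and x :: "nat \<Rightarrow> int"
    assume p: "0 < \<P>(\<omega> in M. \<forall>i\<le>n. - X i \<omega> = x i)"
    have e1: "(- X (Suc n) \<omega> = - X n \<omega> - 1) = (X (Suc n) \<omega> = X n \<omega> + 1)" for \<omega> by auto
    have e2: "(- X (Suc n) \<omega> = - X n \<omega> + 1) = (X (Suc n) \<omega> = X n \<omega> - 1)" for \<omega> by auto
    show "\<P>(\<omega> in M. - X (Suc n) \<omega> = - X n \<omega> - 1 \<bar> \<forall>i\<le>n. - X i \<omega> = x i) = left_prob w x n"
      unfolding e1 eq using step_right[of n "\<lambda>i. - x i"] p unfolding eq by (simp add: lp)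
    show "\<P>(\<omega> in M. - X (Suc n) \<omega> = - X n \<omega> + 1 \<bar> \<forall>i\<le>n. - X i \<omega> = x i) = 1 - left_prob w x n"
      unfolding e2 eq using step_left[of n "\<lambda>i. - x i"] p unfolding eq by (simp add: lp)
  qed
qed

end

section \<open>Net flows are martingales\<close>

text \<open>The square minus the quadratic variation. With the quadratic variation itself, rather than its
compensator, this is still a martingale, and it is bounded below by the path-by-path estimate \<open>flow2_le\<close>.\<close>

definition compensated_square :: "(nat \<Rightarrow> real) \<Rightarrow> nat \<Rightarrow> int \<Rightarrow> nat \<Rightarrow> (nat \<Rightarrow> int) \<Rightarrow> real" where
  "compensated_square w g y n x = (net_flow w g y n x)^2 - flow2 w g x n y (y + 1) - flow2 w g x n y (y - 1)"

lemma adapted_net_flow: "adapted (net_flow w g y)"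
proof (unfold adapted_def, intro allI impI)
  fix n and x x' :: "nat \<Rightarrow> int" assume "\<forall>k\<le>n. x k = x' k"
  then have "flow w g x n y z = flow w g x' n y z" for z by (intro flow_cong) auto
  then show "net_flow w g y n x = net_flow w g y n x'" by (simp add: net_flow_def)
qed

lemma adapted_compensated_square: "adapted (compensated_square w g y)"
proof (unfold adapted_def, intro allI impI)
  fix n and x x' :: "nat \<Rightarrow> int" assume a: "\<forall>k\<le>n. x k = x' k"
  then have "flow2 w g x n y z = flow2 w g x' n y z" for z by (intro flow2_cong) auto
  moreover have "net_flow w g y n x = net_flow w g y n x'"
    using a by (intro adaptedD[OF adapted_net_flow]) auto
  ultimately show "compensated_square w g y n x = compensated_square w g y n x'" by (simp add: compensated_square_def)
qed

locale vrrw_A = vrrw M w X + weight_A w for M :: "'a measure" and w X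
begin

text \<open>A step from \<open>y\<close> changes the net flow by \<open>- a\<close> or \<open>b\<close> with \<open>p * a = (1 - p) * b\<close>, and
\<open>(D + t)\<^sup>2 - t\<^sup>2\<close> is affine in \<open>t\<close>.\<close>

lemma compensated_square_martingale:
  "left_prob w h n * compensated_square w g y (Suc n) (extend h n (-1)) +
   (1 - left_prob w h n) * compensated_square w g y (Suc n) (extend h n 1) = compensated_square w g y n h"
proof -
  define p where "p = left_prob w h n"
  have fl: "flow w g (extend h n d) n y z = flow w g h n y z"
    "flow2 w g (extend h n d) n y z = flow2 w g h n y z" for d z
    by (auto intro: flow_cong flow2_cong)
  have vi: "visits (extend h n d) n z = visits h n z" for d z by (auto intro: visits_cong)
  show ?thesis
  proof (cases "h n = y \<and> g < visits h n y")
    case False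
    then have "compensated_square w g y (Suc n) (extend h n d) = compensated_square w g y n h" for d
      by (auto simp: compensated_square_def net_flow_def flow_Suc flow2_Suc fl vi)
    then show ?thesis by (simp add: algebra_simps)
  next
    case True
    define a b where "a = 1 / w (visits h n (y - 1))" and "b = 1 / w (visits h n (y + 1))"
    define D where "D = net_flow w g y n h"
    define q where "q = flow2 w g h n y (y + 1) + flow2 w g h n y (y - 1)"
    have L: "compensated_square w g y (Suc n) (extend h n (-1)) = (D - a)^2 - q - a^2"
      using True by (simp add: compensated_square_def net_flow_def flow_Suc flow2_Suc fl vi a_def D_def q_def algebra_simps)
    have R: "compensated_square w g y (Suc n) (extend h n 1) = (D + b)^2 - q - b^2"
      using True by (simp add: compensated_square_def net_flow_def flow_Suc flow2_Suc fl vi b_def D_def q_def algebra_simps)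
    have pa: "p * a = (1 - p) * b"
    proof -
      define u v where "u = w (visits h n (y - 1))" and "v = w (visits h n (y + 1))"
      have uv: "0 < u" "0 < v" by (simp_all add: u_def v_def)
      have "p = u / (u + v)" using True by (simp add: p_def left_prob_def u_def v_def)
      moreover have "a = 1 / u" "b = 1 / v" by (simp_all only: a_def b_def u_def v_def)
      ultimately show ?thesis using uv by (simp only:) (simp add: field_simps)
    qed
    have "p * ((D - a)^2 - q - a^2) + (1 - p) * ((D + b)^2 - q - b^2) = D^2 - q - 2 * D * (p * a - (1 - p) * b)"
      by (simp add: power2_eq_square algebra_simps)
    then show ?thesis unfolding L R p_def[symmetric] pa by (simp add: compensated_square_def D_def q_def)
  qed
qed

lemma compensated_square_ge: "(net_flow w g y n x)^2 \<le> compensated_square w g y n x + 2 * recip_squares"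
  using flow2_le[of g x n y "y + 1"] flow2_le[of g x n y "y - 1"] by (simp add: compensated_square_def)

text \<open>Chebyshev's inequality for the compensated square stopped when the net flow first exceeds \<open>r\<close>.\<close>

lemma net_flow_maximal_inequality:
  assumes "0 < (r::real)"
  shows "hist_prob n (\<lambda>n x. \<exists>k\<le>n. r \<le> \<bar>net_flow w g y k x\<bar>) \<le> 2 * recip_squares / r^2"
proof -
  let ?B = "\<lambda>n x. \<exists>k\<le>n. r \<le> \<bar>net_flow w g y k x\<bar>"
  define F where "F n x = (compensated_square w g y n x + 2 * recip_squares) / r^2" for n x
  define H where "H n x = (if ?B n x then 1 else F n x)" for n x
  have F0: "0 \<le> F n x" for n x
    unfolding F_def by (intro divide_nonneg_nonneg order_trans[OF zero_le_power2 compensated_square_ge]) auto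
  have F1: "1 \<le> F n x" if "r \<le> \<bar>net_flow w g y n x\<bar>" for n x
  proof -
    have "r^2 \<le> (net_flow w g y n x)^2"
      using power_mono[OF that, of 2] assms by simp
    then show ?thesis unfolding F_def using compensated_square_ge[of g y n x] assms by simp
  qed
  have ex: "net_flow w g y k (extend h n d) = net_flow w g y k h" if "k \<le> n" for k h n d
    using adapted_extend[OF adapted_net_flow that] .
  have "hist_prob n ?B \<le> mean n H"
    unfolding hist_prob_def by (intro mean_mono) (auto simp: H_def F0)
  also have "\<dots> \<le> H 0 (\<lambda>_. 0)"
  proof (rule mean_supermartingale)
    fix n h
    define p where "p = left_prob w h n"
    have p: "0 < p" "p < 1" using left_prob_bounds by (auto simp: p_def)
    show "left_prob w h n * H (Suc n) (extend h n (-1)) + (1 - left_prob w h n) * H (Suc n) (extend h n 1) \<le> H n h"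
    proof (cases "?B n h")
      case True
      then have "?B (Suc n) (extend h n d)" for d using ex by (metis le_SucI)
      then show ?thesis using True by (simp add: H_def)
    next
      case False
      have "H (Suc n) (extend h n d) \<le> F (Suc n) (extend h n d)" for d
      proof (cases "?B (Suc n) (extend h n d)")
        case True
        then have "r \<le> \<bar>net_flow w g y (Suc n) (extend h n d)\<bar>"
          using False ex by (metis le_Suc_eq)
        then show ?thesis using F1 True by (simp add: H_def)
      next
        case False
        then show ?thesis unfolding H_def by (simp only: if_False order_refl)
      qed
      then have "p * H (Suc n) (extend h n (-1)) + (1 - p) * H (Suc n) (extend h n 1) \<le>
          p * F (Suc n) (extend h n (-1)) + (1 - p) * F (Suc n) (extend h n 1)"
        using p by (intro add_mono mult_left_mono) auto
      also have "\<dots> = (p * compensated_square w g y (Suc n) (extend h n (-1)) +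
          (1 - p) * compensated_square w g y (Suc n) (extend h n 1) + 2 * recip_squares) / r^2"
        unfolding F_def times_divide_eq_right add_divide_distrib[symmetric]
        by (rule arg_cong[of _ _ "\<lambda>t. t / r^2"]) (simp add: algebra_simps)
      also have "\<dots> = F n h" unfolding p_def compensated_square_martingale F_def ..
      also have "F n h = H n h" unfolding H_def using False by (simp only: if_False)
      finally show ?thesis unfolding p_def .
    qed
  qed
  also have "\<dots> = 2 * recip_squares / r^2"
    using assms by (simp add: H_def F_def compensated_square_def net_flow_def)
  finally show ?thesis .
qed

lemma AE_net_flow_bounded: "AE \<omega> in M. \<forall>y. \<exists>C. \<forall>n. \<bar>net_flow w 0 y n (\<lambda>i. X i \<omega>)\<bar> \<le> C"
proof (subst AE_all_countable, intro allI)
  fix y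
  have "AE \<omega> in M. \<exists>j. \<forall>n. \<not> (\<exists>k\<le>n. real (Suc j) \<le> \<bar>net_flow w 0 y k (\<lambda>i. X i \<omega>)\<bar>)"
  proof (rule AE_not_eventual[where c = "\<lambda>j. 2 * recip_squares / (real (Suc j))^2"])
    show "adapted (\<lambda>n x. \<exists>k\<le>n. real (Suc j) \<le> \<bar>net_flow w 0 y k x\<bar>)" for j
      using adapted_net_flow[of w 0 y] unfolding adapted_def by (metis order_trans)
    show "hist_prob n (\<lambda>n x. \<exists>k\<le>n. real (Suc j) \<le> \<bar>net_flow w 0 y k x\<bar>) \<le> 2 * recip_squares / (real (Suc j))^2" for j n
      by (rule net_flow_maximal_inequality) simp
    have "(\<lambda>j. 1 / (real (Suc j))^2) \<longlonglongrightarrow> 0" by real_asymp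
    then have "(\<lambda>j. 2 * recip_squares * (1 / (real (Suc j))^2)) \<longlonglongrightarrow> 0" by (rule tendsto_mult_right_zero)
    then show "(\<lambda>j. 2 * recip_squares / (real (Suc j))^2) \<longlonglongrightarrow> 0" by simp
  qed (auto intro: le_SucI)
  then show "AE \<omega> in M. \<exists>C. \<forall>n. \<bar>net_flow w 0 y n (\<lambda>i. X i \<omega>)\<bar> \<le> C"
    by eventually_elim (meson less_imp_le linorder_not_le order_refl)
qed

end

section \<open>The range is bounded\<close>

definition reached :: "int \<Rightarrow> nat \<Rightarrow> (nat \<Rightarrow> int) \<Rightarrow> bool" where
  "reached y n x \<longleftrightarrow> (\<exists>k\<le>n. x k = y)"

lemma adapted_reached: "adapted (reached y)"
  unfolding adapted_def reached_def by (metis)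

lemma reached_Suc: "reached y (Suc n) x \<longleftrightarrow> reached y n x \<or> x (Suc n) = y"
  unfolding reached_def by (auto simp: le_Suc_eq)

lemma reached_extend: "reached y n (extend h n d) = reached y n h"
  using adapted_extend[OF adapted_reached] by blast

text \<open>The times at which confinement prescribes a step to the left.\<close>

definition held :: "nat \<Rightarrow> nat \<Rightarrow> int \<Rightarrow> nat \<Rightarrow> (nat \<Rightarrow> int) \<Rightarrow> bool" where
  "held m B s k x \<longleftrightarrow> x k \<in> {s+2..s+6} \<and> visits x k (x k) \<le> (if x k = s + 6 then B else m)"

definition held_count :: "nat \<Rightarrow> nat \<Rightarrow> int \<Rightarrow> nat \<Rightarrow> (nat \<Rightarrow> int) \<Rightarrow> nat" where
  "held_count m B s n x = (\<Sum>k<n. if held m B s k x then 1 else 0)"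

lemma held_count_Suc: "held_count m B s (Suc n) x = held_count m B s n x + (if held m B s n x then 1 else 0)"
  by (simp add: held_count_def)

lemma adapted_held: "adapted (held m B s)"
proof (unfold adapted_def, intro allI impI)
  fix n and x x' :: "nat \<Rightarrow> int" assume a: "\<forall>k\<le>n. x k = x' k"
  then have "visits x n y = visits x' n y" for y by (intro visits_cong) auto
  then show "held m B s n x = held m B s n x'" using a by (simp add: held_def)
qed

lemma adapted_held_count: "adapted (held_count m B s)"
proof (unfold adapted_def, intro allI impI)
  fix n and x x' :: "nat \<Rightarrow> int" assume "\<forall>k\<le>n. x k = x' k"
  then have "held m B s k x = held m B s k x'" if "k < n" for k
    using \<open>\<forall>k\<le>n. x k = x' k\<close> that by (intro adaptedD[OF adapted_held]) auto
  then show "held_count m B s n x = held_count m B s n x'" unfolding held_count_def by (intro sum.cong) auto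
qed

lemma held_at_site_le: "(\<Sum>k<n. if x k = y \<and> visits x k y \<le> l then 1 else 0) \<le> (l::nat)"
proof -
  have "(\<Sum>k<n. if x k = y \<and> visits x k y \<le> l then 1 else 0) \<le> l \<and>
    (\<Sum>k<n. if x k = y \<and> visits x k y \<le> l then 1 else 0) + (if x n = y then 1 else 0) \<le> visits x n y"
    by (induction n) (auto simp: visits_Suc visits_0)
  then show ?thesis by blast
qed

text \<open>At each site, different held times see different numbers of visits.\<close>

lemma held_count_le: "held_count m B s n x \<le> 4 * m + B"
proof -
  let ?c = "\<lambda>y l k. if x k = y \<and> visits x k y \<le> l then 1 else (0::nat)"
  have "held_count m B s n x \<le>
      (\<Sum>k<n. ?c (s+2) m k + ?c (s+3) m k + ?c (s+4) m k + ?c (s+5) m k + ?c (s+6) B k)"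
    unfolding held_count_def
  proof (rule sum_mono)
    fix k
    show "(if held m B s k x then 1 else 0) \<le> ?c (s+2) m k + ?c (s+3) m k + ?c (s+4) m k + ?c (s+5) m k + ?c (s+6) B k"
    proof (cases "held m B s k x")
      case True
      then have "x k = s+2 \<or> x k = s+3 \<or> x k = s+4 \<or> x k = s+5 \<or> x k = s+6" by (auto simp: held_def)
      then show ?thesis using True by (auto simp: held_def)
    qed simp
  qed
  also have "\<dots> \<le> m + m + m + m + B"
    unfolding sum.distrib by (intro add_mono held_at_site_le)
  finally show ?thesis by simp
qed

definition escape_chance :: "nat \<Rightarrow> nat \<Rightarrow> real" where
  "escape_chance m B = 1 / 2 / 2 ^ (4 * m + B)"

context vrrw_A
begin

text \<open>Positivity forces all five net flows to be at most \<open>C\<close> in absolute value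
(\<open>potential_pos_imp_net_flow\<close>), and for \<open>C\<^sup>2 \<ge> 20 * recip_squares\<close> the initial value is at least one half.\<close>

definition potential :: "real \<Rightarrow> nat \<Rightarrow> int \<Rightarrow> nat \<Rightarrow> (nat \<Rightarrow> int) \<Rightarrow> real" where
  "potential C m s n x =
     1 - (\<Sum>y\<in>{s+1..s+5}. compensated_square w (gate m s y) y n x + 2 * recip_squares) / C^2"

text \<open>As soon as the potential is not positive, or a held step goes right, the history is given up.\<close>

definition tame :: "real \<Rightarrow> nat \<Rightarrow> nat \<Rightarrow> int \<Rightarrow> nat \<Rightarrow> (nat \<Rightarrow> int) \<Rightarrow> bool" where
  "tame C m B s n x \<longleftrightarrow> (\<forall>k\<le>n. 0 < potential C m s k x) \<and>
     (\<forall>k<n. held m B s k x \<longrightarrow> x (Suc k) = x k - 1)"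

lemma adapted_potential: "adapted (potential C m s)"
proof (unfold adapted_def, intro allI impI)
  fix n and x x' :: "nat \<Rightarrow> int" assume a: "\<forall>k\<le>n. x k = x' k"
  have "compensated_square w g y n x = compensated_square w g y n x'" for g y
    using a by (intro adaptedD[OF adapted_compensated_square]) auto
  then show "potential C m s n x = potential C m s n x'" unfolding potential_def by (simp only:)
qed

lemma tame_Suc: "tame C m B s (Suc n) x \<longleftrightarrow> tame C m B s n x \<and> 0 < potential C m s (Suc n) x \<and>
    (held m B s n x \<longrightarrow> x (Suc n) = x n - 1)"
  unfolding tame_def by (auto simp: le_Suc_eq less_Suc_eq)

lemma adapted_tame: "adapted (tame C m B s)"
proof (unfold adapted_def, intro allI impI)
  fix n and x x' :: "nat \<Rightarrow> int" assume a: "\<forall>k\<le>n. x k = x' k"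
  have "potential C m s k x = potential C m s k x'" if "k \<le> n" for k
    using a that by (intro adaptedD[OF adapted_potential]) auto
  moreover have "held m B s k x = held m B s k x'" if "k < n" for k
    using a that by (intro adaptedD[OF adapted_held]) auto
  ultimately show "tame C m B s n x = tame C m B s n x'" using a by (auto simp: tame_def)
qed

lemma potential_pos_imp_net_flow:
  assumes "0 < C" "0 < potential C m s n x" "y \<in> {s+1..s+5}"
  shows "\<bar>net_flow w (gate m s y) y n x\<bar> \<le> C"
proof -
  let ?f = "\<lambda>y. compensated_square w (gate m s y) y n x + 2 * recip_squares"
  have nn: "0 \<le> ?f y" for y using compensated_square_ge[of "gate m s y" y n x] zero_le_power2 order_trans by blast
  have "(net_flow w (gate m s y) y n x)^2 \<le> ?f y" by (rule compensated_square_ge)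
  also have "\<dots> \<le> (\<Sum>y\<in>{s+1..s+5}. ?f y)" using assms(3) nn by (intro member_le_sum) auto
  also have "\<dots> \<le> C^2" using assms(1,2) by (simp add: potential_def divide_less_eq)
  finally have "\<bar>net_flow w (gate m s y) y n x\<bar>\<^sup>2 \<le> C^2" by simp
  then show ?thesis using assms(1) by (rule power2_le_imp_le[OF _ less_imp_le])
qed

lemma potential_le_1: "potential C m s n x \<le> 1"
proof -
  have "0 \<le> compensated_square w (gate m s y) y n x + 2 * recip_squares" for y
    using compensated_square_ge[of "gate m s y" y n x] zero_le_power2 order_trans by blast
  then have "0 \<le> (\<Sum>y\<in>{s+1..s+5}. compensated_square w (gate m s y) y n x + 2 * recip_squares) / C^2"
    by (intro divide_nonneg_nonneg sum_nonneg) auto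
  then show ?thesis by (simp add: potential_def)
qed

lemma tame_confinement:
  assumes C: "0 < C" "large_enough C m" and x: "nn_path x n" "x 0 < s" and t: "tame C m B s n x"
    and b7: "\<And>k. k \<le> n \<Longrightarrow> x k \<noteq> s + 7"
  shows "confinement w C m s x n"
proof
  show "large_enough C m" "0 \<le> C" "nn_path x n" "x 0 < s" using C x by auto
next
  fix k y assume "k < n" "y \<in> {s+2..s+5}" "x k = y" "visits x k y \<le> m"
  then have "held m B s k x" by (auto simp: held_def)
  then show "x (Suc k) = y - 1" using t \<open>k < n\<close> \<open>x k = y\<close> by (auto simp: tame_def)
next
  fix k y assume "k \<le> n" "y \<in> {s+1..s+5}"
  then have "\<bar>net_flow w (gate m s y) y k x\<bar> \<le> C"
    using t C by (intro potential_pos_imp_net_flow) (auto simp: tame_def)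
  then show "net_flow w (gate m s y) y k x \<le> C" by simp
qed (rule b7)

context
  fixes C :: real and m B :: nat and s :: int
  assumes C: "0 < C" "large_enough C m" "20 * recip_squares \<le> C^2"
    and B: "\<And>s x n. confinement w C m s x n \<Longrightarrow> visits x n (s + 6) \<le> B"
    and s: "0 < s"
begin

text \<open>Induction on time: as long as \<open>s + 7\<close> has not been reached, confinement gives \<open>Z (s + 6) \<le> B\<close>, so every
step from \<open>s + 6\<close> is a held step.\<close>

lemma tame_below7:
  assumes "nn_path x n" "x 0 = 0" "tame C m B s n x" "k \<le> n"
  shows "x k \<noteq> s + 7"
  using assms
proof (induction n arbitrary: k)
  case 0 then show ?case using s by auto
next
  case (Suc n)
  have t: "tame C m B s n x" "nn_path x n" using Suc.prems by (auto simp: tame_Suc nn_path_Suc)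
  have IH: "x i \<noteq> s + 7" if "i \<le> n" for i using Suc.IH[OF t(2) Suc.prems(2) t(1) that] .
  show ?case
  proof (cases "k = Suc n")
    case False then show ?thesis using IH Suc.prems by auto
  next
    case True
    show ?thesis
    proof
      assume "x k = s + 7"
      then have "x n = s + 6 \<or> x n = s + 8" using Suc.prems(1) True by (auto simp: nn_path_Suc)
      moreover have "x n \<noteq> s + 8"
      proof
        assume "x n = s + 8"
        then have "\<exists>i\<le>n. x i = s + 7" using t(2) Suc.prems(2) s by (intro visited_below) auto
        then show False using IH by blast
      qed
      ultimately have x6: "x n = s + 6" by simp
      have "confinement w C m s x n"
        using Suc.prems(2) s by (intro tame_confinement[OF C(1,2) t(2) _ t(1)] IH) auto
      then have "held m B s n x" using B x6 by (auto simp: held_def)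
      then have "x (Suc n) = x n - 1" using Suc.prems(3) by (simp add: tame_Suc)
      then show False using \<open>x k = s + 7\<close> True x6 by simp
    qed
  qed
qed

lemma potential_martingale:
  "left_prob w h n * potential C m s (Suc n) (extend h n (-1)) +
   (1 - left_prob w h n) * potential C m s (Suc n) (extend h n 1) = potential C m s n h"
proof -
  define p where "p = left_prob w h n"
  let ?q = "\<lambda>y n x. compensated_square w (gate m s y) y n x"
  have "p * (\<Sum>y\<in>{s+1..s+5}. ?q y (Suc n) (extend h n (-1)) + 2 * recip_squares) +
      (1 - p) * (\<Sum>y\<in>{s+1..s+5}. ?q y (Suc n) (extend h n 1) + 2 * recip_squares)
    = (\<Sum>y\<in>{s+1..s+5}. (p * ?q y (Suc n) (extend h n (-1)) + (1 - p) * ?q y (Suc n) (extend h n 1)) + 2 * recip_squares)"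
    unfolding sum_distrib_left sum.distrib[symmetric] by (intro sum.cong) (auto simp: algebra_simps)
  also have "\<dots> = (\<Sum>y\<in>{s+1..s+5}. ?q y n h + 2 * recip_squares)"
    unfolding p_def compensated_square_martingale ..
  finally have e: "p * (\<Sum>y\<in>{s+1..s+5}. ?q y (Suc n) (extend h n (-1)) + 2 * recip_squares) +
      (1 - p) * (\<Sum>y\<in>{s+1..s+5}. ?q y (Suc n) (extend h n 1) + 2 * recip_squares) = (\<Sum>y\<in>{s+1..s+5}. ?q y n h + 2 * recip_squares)" .
  have lin: "p * (1 - a / c) + (1 - p) * (1 - b / c) = 1 - (p * a + (1 - p) * b) / c" for a b c :: real
    by (cases "c = 0") (auto simp: field_simps)
  show ?thesis unfolding p_def[symmetric] potential_def lin e ..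
qed

lemma potential_held:
  assumes "held m B s n h"
  shows "potential C m s (Suc n) (extend h n d) = potential C m s n h"
proof -
  have "compensated_square w (gate m s y) y (Suc n) (extend h n d) = compensated_square w (gate m s y) y n h"
    if y: "y \<in> {s+1..s+5}" for y
  proof -
    have v: "visits (extend h n d) n z = visits h n z" for z by (auto intro: visits_cong)
    have "\<not> (h n = y \<and> gate m s y < visits h n y)"
      using assms y by (auto simp: held_def gate_def)
    then have "compensated_square w (gate m s y) y (Suc n) (extend h n d) = compensated_square w (gate m s y) y n (extend h n d)"
      by (auto simp: compensated_square_def net_flow_def flow_Suc flow2_Suc v)
    also have "\<dots> = compensated_square w (gate m s y) y n h"
      by (rule adapted_extend[OF adapted_compensated_square order_refl])
    finally show ?thesis .
  qed
  then show ?thesis unfolding potential_def by (simp only: cong: sum.cong)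
qed

text \<open>The potential reweighted by a factor 2 for each held step. The reweighting plays the part of a change of
measure to the walk conditioned on making all held steps: such a step has probability at least one
half, so doubling keeps the submartingale property, and since there are at most \<open>4 * m + B\<close> held steps the
normalised factor never exceeds 1.\<close>

definition gain :: "nat \<Rightarrow> (nat \<Rightarrow> int) \<Rightarrow> real" where
  "gain n x = (if reached s n x \<and> tame C m B s n x
     then 2 ^ held_count m B s n x / 2 ^ (4 * m + B) * potential C m s n x else 0)"

lemma gain_nonneg: "0 \<le> gain n x"
  by (auto simp: gain_def tame_def intro: less_imp_le)

lemma gain_le_1: "gain n x \<le> 1"
proof -
  have "2 ^ held_count m B s n x / 2 ^ (4 * m + B) * potential C m s n x \<le> 1 * 1"
    if "0 < potential C m s n x"
    using that held_count_le[of m B s n x] by (intro mult_mono potential_le_1) (auto intro: power_increasing)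
  then show ?thesis by (auto simp: gain_def tame_def)
qed

text \<open>When \<open>s\<close> is reached for the first time, no site on its right has been visited: all flows there are 0 and
the potential is at least one half.\<close>

lemma gain_on_arrival:
  assumes h: "nn_path x (Suc n)" "x 0 = 0" and r: "\<not> reached s n x" "reached s (Suc n) x"
  shows "escape_chance m B \<le> gain (Suc n) x"
proof -
  have below: "x k < s" if k: "k \<le> n" for k
  proof (rule ccontr)
    assume "\<not> x k < s"
    then have "\<exists>i\<le>k. x i = s"
      using h s nn_path_mono[OF h(1), of k] k by (intro visited_below) auto
    then obtain i where "i \<le> k" "x i = s" by blast
    then show False using r(1) k unfolding reached_def by (metis order_trans)
  qed
  have pot: "potential C m s k x = 1 - 10 * recip_squares / C^2" if k: "k \<le> Suc n" for k
  proof -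
    have "compensated_square w (gate m s y) y k x = 0" if y: "y \<in> {s+1..s+5}" for y
    proof -
      have "x i \<noteq> y" if "i < k" for i using below[of i] y k that by auto
      then have "flow w g x k y z = 0" "flow2 w g x k y z = 0" for g z
        unfolding flow_def flow2_def by (intro sum.neutral; auto)+
      then show ?thesis by (simp add: compensated_square_def net_flow_def)
    qed
    then show ?thesis by (simp add: potential_def)
  qed
  have half: "1/2 \<le> 1 - 10 * recip_squares / C^2"
    using C by (simp add: field_simps)
  have nh: "\<not> held m B s k x" if "k \<le> n" for k using below[OF that] by (auto simp: held_def)
  have "tame C m B s (Suc n) x"
    unfolding tame_def
  proof (intro conjI allI impI)
    fix k assume "k \<le> Suc n"
    show "0 < potential C m s k x" unfolding pot[OF \<open>k \<le> Suc n\<close>] using half by linarith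
  next
    fix k assume "k < Suc n" "held m B s k x"
    then show "x (Suc k) = x k - 1" using nh[of k] by simp
  qed
  moreover have "held_count m B s (Suc n) x = 0"
    unfolding held_count_def using nh by (intro sum.neutral) auto
  ultimately have "gain (Suc n) x = 1 / 2 ^ (4 * m + B) * (1 - 10 * recip_squares / C^2)"
    using r(2) pot[of "Suc n"] by (simp add: gain_def)
  also have "\<dots> \<ge> 1 / 2 ^ (4 * m + B) * (1/2)" using half by (intro mult_left_mono) auto
  finally show ?thesis by (simp add: escape_chance_def)
qed

text \<open>At a held time the site on the right is still unvisited, so the prescribed step has probability at least
one half; the step does not change the gated flows. At other times the potential is a martingale, and
\<open>gain\<close> replaces its nonpositive values by 0, which only helps.\<close>

lemma gain_submartingale:
  assumes h: "h \<in> histories n" and r: "reached s n h"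
  shows "gain n h \<le> left_prob w h n * gain (Suc n) (extend h n (-1)) +
    (1 - left_prob w h n) * gain (Suc n) (extend h n 1)"
proof (cases "tame C m B s n h")
  case False
  then show ?thesis using gain_nonneg left_prob_bounds[of h n]
    by (auto simp: gain_def intro!: add_nonneg_nonneg mult_nonneg_nonneg)
next
  case t: True
  define p where "p = left_prob w h n"
  have p: "0 < p" "p < 1" using left_prob_bounds by (auto simp: p_def)
  define K where "K = 2 ^ held_count m B s n h / (2::real) ^ (4 * m + B)"
  have K: "0 < K" by (simp add: K_def)
  have P: "0 < potential C m s n h" using t by (simp add: tame_def)
  have nnh: "nn_path h n" "h 0 = 0" using h histories_nn_path histories_start by auto
  have r': "reached s (Suc n) (extend h n d)" for d
    using r by (simp add: reached_Suc reached_extend)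
  have t': "tame C m B s n (extend h n d)" for d using t adapted_extend[OF adapted_tame] by blast
  have held': "held m B s n (extend h n d) = held m B s n h" for d using adapted_extend[OF adapted_held] by blast
  have hc: "held_count m B s (Suc n) (extend h n d) = held_count m B s n h + (if held m B s n h then 1 else 0)" for d
    unfolding held_count_Suc held' using adapted_extend[OF adapted_held_count, of n n] by simp
  have g: "gain n h = K * potential C m s n h" using t r by (simp add: gain_def K_def)
  show ?thesis
  proof (cases "held m B s n h")
    case True
    have "tame C m B s (Suc n) (extend h n (-1))"
      using t' P potential_held[OF True] by (simp add: tame_Suc)
    then have gL: "gain (Suc n) (extend h n (-1)) = 2 * K * potential C m s n h"
      using r' True by (simp add: gain_def hc potential_held K_def)
    have b7: "h k \<noteq> s + 7" if "k \<le> n" for k using tame_below7[OF nnh t that] .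
    then interpret confinement w C m s h n
      using nnh t s by (intro tame_confinement[OF C(1,2)]) auto
    have "visits h n (h n + 1) = 0"
    proof (cases "h n = s + 6")
      case True
      then have "h n + 1 = s + 7" by simp
      moreover have "\<not> 0 < visits h n (s + 7)" unfolding visits_pos_iff using b7 by blast
      ultimately show ?thesis by (simp only: not_gr_zero)
    next
      case False
      then have "h n \<in> {s+2..s+5}" "visits h n (h n) \<le> m" using True by (auto simp: held_def)
      then show ?thesis using visited_above_imp_gate[of "h n" n] by (meson not_gr_zero not_le order_refl)
    qed
    then have "w (visits h n (h n + 1)) \<le> w (visits h n (h n - 1))" by (intro w_le) simp
    have half: "1/2 \<le> u / (u + v)" if "0 < u" "0 < v" "v \<le> u" for u v :: real
      using that by (simp add: field_simps)
    have "1/2 \<le> p" unfolding p_def left_prob_def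
      by (rule half[OF w_pos w_pos \<open>w (visits h n (h n + 1)) \<le> w (visits h n (h n - 1))\<close>])
    then have "1 * (K * potential C m s n h) \<le> (2 * p) * (K * potential C m s n h)"
      using K P by (intro mult_right_mono) auto
    then have "gain n h \<le> p * gain (Suc n) (extend h n (-1))" by (simp add: g gL mult_ac)
    moreover have "0 \<le> (1 - p) * gain (Suc n) (extend h n 1)" using p gain_nonneg by simp
    ultimately show ?thesis by (simp add: p_def)
  next
    case False
    have ch: "K * potential C m s (Suc n) (extend h n d) \<le> gain (Suc n) (extend h n d)" for d
    proof (cases "0 < potential C m s (Suc n) (extend h n d)")
      case True
      then have "tame C m B s (Suc n) (extend h n d)" using t' False held' by (simp add: tame_Suc)
      then show ?thesis using r' False by (simp add: gain_def hc K_def)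
    next
      case False
      then have "K * potential C m s (Suc n) (extend h n d) \<le> 0" using K by (simp add: mult_le_0_iff)
      then show ?thesis using gain_nonneg order_trans by blast
    qed
    have "gain n h = p * (K * potential C m s (Suc n) (extend h n (-1))) +
        (1 - p) * (K * potential C m s (Suc n) (extend h n 1))"
      unfolding g by (subst potential_martingale[of h n, symmetric]) (simp add: p_def algebra_simps)
    also have "\<dots> \<le> p * gain (Suc n) (extend h n (-1)) + (1 - p) * gain (Suc n) (extend h n 1)"
      using p ch by (intro add_mono mult_left_mono) auto
    finally show ?thesis by (simp add: p_def)
  qed
qed

text \<open>By \<open>gain_on_arrival\<close> and \<open>gain_submartingale\<close>, the mean of \<open>gain\<close> dominates the escape chance times
the probability of having reached \<open>s\<close>. As \<open>gain\<close> is at most 1 and vanishes on histories that reached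
\<open>s + 7\<close>, the claim follows.\<close>

lemma hist_prob_reached_next: "hist_prob n (reached (s + 7)) \<le> (1 - escape_chance m B) * hist_prob n (reached s)"
proof -
  define I where "I n x = (if reached s n x then 1 else 0 :: real)" for n x
  define U where "U n x = escape_chance m B * I n x - gain n x" for n x
  have "mean n U \<le> U 0 (\<lambda>_. 0)"
  proof (rule mean_supermartingale)
    fix n h assume h: "h \<in> histories n"
    define p where "p = left_prob w h n"
    have p: "0 < p" "p < 1" using left_prob_bounds by (auto simp: p_def)
    show "left_prob w h n * U (Suc n) (extend h n (-1)) + (1 - left_prob w h n) * U (Suc n) (extend h n 1) \<le> U n h"
    proof (cases "reached s n h")
      case True
      have "I (Suc n) (extend h n d) = 1" for d
        using True by (simp add: I_def reached_Suc reached_extend)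
      then have "p * U (Suc n) (extend h n (-1)) + (1 - p) * U (Suc n) (extend h n 1) =
          escape_chance m B - (p * gain (Suc n) (extend h n (-1)) + (1 - p) * gain (Suc n) (extend h n 1))"
        by (simp add: U_def algebra_simps)
      also have "\<dots> \<le> escape_chance m B - gain n h" using gain_submartingale[OF h True] by (simp add: p_def)
      finally show ?thesis using True by (simp add: U_def I_def p_def)
    next
      case False
      have "U (Suc n) (extend h n d) \<le> 0" if "d = -1 \<or> d = 1" for d
      proof (cases "reached s (Suc n) (extend h n d)")
        case True
        have hS: "extend h n d \<in> histories (Suc n)" using h that by auto
        have "escape_chance m B \<le> gain (Suc n) (extend h n d)"
          using histories_nn_path[OF hS] histories_start[OF hS] True False
          by (intro gain_on_arrival) (auto simp: reached_extend)
        then show ?thesis using True by (simp add: U_def I_def)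
      next
        case False
        then show ?thesis using gain_nonneg[of "Suc n" "extend h n d"] by (simp add: U_def I_def)
      qed
      then have "p * U (Suc n) (extend h n (-1)) + (1 - p) * U (Suc n) (extend h n 1) \<le> 0"
        using p by (intro add_nonpos_nonpos mult_nonneg_nonpos) auto
      moreover have "U n h = 0" using False by (simp add: U_def I_def gain_def)
      ultimately show ?thesis by (simp add: p_def)
    qed
  qed
  also have "U 0 (\<lambda>_. 0) = 0" using s by (simp add: U_def I_def gain_def reached_def)
  finally have U0: "mean n U \<le> 0" .
  have "hist_prob n (reached (s + 7)) \<le> mean n (\<lambda>n x. I n x - gain n x)"
    unfolding hist_prob_def
  proof (rule mean_mono)
    fix h assume h: "h \<in> histories n"
    have nnh: "nn_path h n" "h 0 = 0" using h histories_nn_path histories_start by auto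
    show "(if reached (s + 7) n h then 1 else 0) \<le> I n h - gain n h"
    proof (cases "reached (s + 7) n h")
      case True
      then obtain k where k: "k \<le> n" "h k = s + 7" by (auto simp: reached_def)
      then have "\<exists>i\<le>k. h i = s"
        using nn_path_mono[OF nnh(1) k(1)] nnh(2) s by (intro visited_below) auto
      then obtain i where "i \<le> k" "h i = s" by blast
      then have "reached s n h" using k(1) unfolding reached_def by (metis order_trans)
      moreover have "\<not> tame C m B s n h" using tame_below7[OF nnh _ k(1)] k(2) by blast
      ultimately show ?thesis using True by (simp add: I_def gain_def)
    next
      case False
      then show ?thesis using gain_le_1[of n h] by (auto simp: I_def gain_def)
    qed
  qed
  also have "\<dots> = mean n (\<lambda>n x. U n x + (1 - escape_chance m B) * I n x)" by (simp add: U_def algebra_simps)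
  also have "\<dots> = mean n U + (1 - escape_chance m B) * hist_prob n (reached s)"
    unfolding mean_def hist_prob_def I_def sum_distrib_left sum.distrib[symmetric]
    by (intro sum.cong refl) (simp add: algebra_simps)
  also have "\<dots> \<le> (1 - escape_chance m B) * hist_prob n (reached s)" using U0 by simp
  finally show ?thesis .
qed

end

lemma hist_prob_le_1: "hist_prob n B \<le> 1"
proof -
  have "hist_prob n B \<le> mean n (\<lambda>_ _. 1)" unfolding hist_prob_def by (rule mean_mono) auto
  then show ?thesis by (simp add: mean_one)
qed

text \<open>The constants of confinement depend on neither the site nor the past, so on arrival at a site the chance
of never getting seven sites further is bounded below uniformly.\<close>

lemma AE_bounded_above:
  assumes b: "bounded (g16 ` {0..}) \<or> bounded (G w g16 ` {0..})"
  shows "AE \<omega> in M. \<exists>N. \<forall>n. X n \<omega> < N"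
proof -
  \<comment> \<open>Five sites, each contributing \<open>2 * recip_squares\<close>: the sum is at most half of \<open>C\<^sup>2\<close>.\<close>
  define C where "C = sqrt (20 * recip_squares) + 1"
  have C: "0 < C" "20 * recip_squares \<le> C^2"
    using recip_squares_nonneg by (auto simp: C_def power2_sum add_nonneg_pos intro: order_trans[OF _ add_increasing2])
  obtain m B where mB: "\<And>s x n. confinement w C m s x n \<Longrightarrow> visits x n (s + 6) \<le> B" and m: "large_enough C m"
    using confinement_bound[OF b less_imp_le[OF C(1)]] by blast
  define c where "c = 1 - 1 / 2 / (2::real) ^ (4 * m + B)"
  have "(1::real) \<le> 2 ^ (4 * m + B)" by (rule one_le_power) simp
  then have "1 / 2 / 2 ^ (4 * m + B) \<le> (1 / 2 / 1 :: real)" by (intro divide_left_mono) auto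
  then have c: "0 \<le> c" "c < 1" unfolding c_def by (linarith, simp)
  have hist_prob: "hist_prob n (reached (7 * int j + 1)) \<le> c ^ j" for n j
  proof (induction j)
    case 0 then show ?case by (simp add: hist_prob_le_1)
  next
    case (Suc j)
    have "hist_prob n (reached ((7 * int j + 1) + 7)) \<le> c * hist_prob n (reached (7 * int j + 1))"
      using hist_prob_reached_next[OF C(1) m C(2) mB, of "7 * int j + 1" n] by (simp add: c_def escape_chance_def)
    also have "\<dots> \<le> c * c ^ j" using Suc c by (intro mult_left_mono)
    finally show ?case by (simp add: algebra_simps)
  qed
  have "AE \<omega> in M. \<exists>j. \<forall>n. \<not> reached (7 * int j + 1) n (\<lambda>i. X i \<omega>)"
    by (rule AE_not_eventual[where c = "\<lambda>j. c ^ j"])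
       (use adapted_reached hist_prob c in \<open>auto simp: reached_Suc intro: LIMSEQ_power_zero\<close>)
  then show ?thesis using AE_nn_path
  proof eventually_elim
    case (elim \<omega>)
    then obtain j where j: "\<And>n. \<not> reached (7 * int j + 1) n (\<lambda>i. X i \<omega>)" by blast
    have "X n \<omega> < 7 * int j + 1" for n
    proof (rule ccontr)
      assume "\<not> ?thesis"
      then have "\<exists>k\<le>n. X k \<omega> = 7 * int j + 1" using elim visited_below[of "\<lambda>i. X i \<omega>" n] by auto
      then show False using j by (auto simp: reached_def)
    qed
    then show ?case by blast
  qed
qed

end

section \<open>The number of recurrent sites\<close>

lemma (in vrrw_A) AE_recurrent_interval:
  assumes b: "bounded (g16 ` {0..}) \<or> bounded (G w g16 ` {0..})"
  shows "AE \<omega> in M. \<exists>a b. balanced_path w (\<lambda>i. X i \<omega>) a b"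
proof -
  interpret refl: vrrw M w "\<lambda>n \<omega>. - X n \<omega>" by (rule reflected_vrrw)
  interpret refl: vrrw_A M w "\<lambda>n \<omega>. - X n \<omega>" ..
  show ?thesis
    using AE_bounded_above[OF b] refl.AE_bounded_above[OF b] AE_nn_path AE_net_flow_bounded
  proof eventually_elim
    case (elim \<omega>)
    then obtain N N' where N: "\<And>n. X n \<omega> < N" "\<And>n. - X n \<omega> < N'" by blast
    have nn: "\<And>n. nn_path (\<lambda>i. X i \<omega>) n" using elim by blast
    have "\<bar>X n \<omega>\<bar> \<le> max N N'" for n using N(1)[of n] N(2)[of n] by auto
    then obtain a b where ab: "a \<le> b" "{y. infinite {n. X n \<omega> = y}} = {a..b}"
      using recurrent_interval[OF nn] by blast
    have "balanced_path w (\<lambda>i. X i \<omega>) a b"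
    proof
      show "\<exists>C. \<forall>n. \<bar>net_flow w 0 y n (\<lambda>i. X i \<omega>)\<bar> \<le> C" for y
        using elim by blast
    qed (use nn ab in auto)
    then show ?case by blast
  qed
qed

theorem proposition1p4:
  fixes M :: "'a measure" and w :: "nat \<Rightarrow> real" and X :: "nat \<Rightarrow> 'a \<Rightarrow> int"
  assumes "assumption_A w"
    and "vrrw M w X"
  shows "(i_minus w = 2 \<longrightarrow> (AE \<omega> in M. ecard (recurrent_sites X \<omega>) > 4)) \<and>
         (i_minus w = 3 \<longrightarrow> (AE \<omega> in M. ecard (recurrent_sites X \<omega>) > 5))"
proof -
  interpret weight_A w by unfold_locales (rule assms(1))
  interpret vrrw M w X by (rule assms(2))
  interpret vrrw_A M w X ..
  have card: "ecard {a..b} = enat (nat (b - a + 1))" if "a \<le> b" for a b :: int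
    by (simp add: ecard_def)
  show ?thesis
  proof (intro conjI impI)
    assume "i_minus w = 2"
    then have "bounded (g16 ` {0..})" by (rule i_minus_2)
    then have "AE \<omega> in M. \<exists>a b. balanced_path w (\<lambda>i. X i \<omega>) a b" by (intro AE_recurrent_interval) simp
    then show "AE \<omega> in M. ecard (recurrent_sites X \<omega>) > 4"
    proof eventually_elim
      case (elim \<omega>)
      then obtain a b where "balanced_path w (\<lambda>i. X i \<omega>) a b" by blast
      then interpret balanced_path w "\<lambda>i. X i \<omega>" a b .
      have "a + 4 \<le> b" using at_least_four_sites not_four_sites by linarith
      then show ?case using card[of a b] by (simp add: recurrent_sites_def R numeral_eq_enat)
    qed
  next
    assume i3: "i_minus w = 3"
    obtain \<eta> where \<eta>: "0 < \<eta>" "\<eta> < 1/2" "\<not> bounded (G w (\<lambda>x. \<eta> * x) ` {0..})"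
      using i_minus_3(2)[OF i3] by blast
    have "AE \<omega> in M. \<exists>a b. balanced_path w (\<lambda>i. X i \<omega>) a b"
      by (rule AE_recurrent_interval[OF i_minus_3(1)[OF i3]])
    then show "AE \<omega> in M. ecard (recurrent_sites X \<omega>) > 5"
    proof eventually_elim
      case (elim \<omega>)
      then obtain a b where "balanced_path w (\<lambda>i. X i \<omega>) a b" by blast
      then interpret balanced_path w "\<lambda>i. X i \<omega>" a b .
      have "a + 5 \<le> b" using at_least_four_sites not_four_sites not_five_sites[OF \<eta>] by linarith
      then show ?case using card[of a b] by (simp add: recurrent_sites_def R numeral_eq_enat)
    qed
  qed
qed

end
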